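(* Let $p>1$ be a real number and let $\kappa$ be a partition. Then there exists a constant $C=C_\kappa$, independent of $\mu$, such that for every partition $\mu$, $$M_{p,\mu}\big(\tilde P^{\mathrm{Sym},\kappa}_{p}\big)\le C\,p^{\,n(\mu)+|\kappa|\,l(\mu)}.$$ Moreover, if $\kappa$ is strict and $r:=l(\kappa)$, then for every partition $\mu$ and every subset $S\subseteq\{1,\dots,r\}$ of odd size, $$M_{p,\mu}\big(\tilde P^{\mathrm{Sym},\kappa}_{p,S}\big)=M_{p,\mu}\big(\tilde P^{\mathrm{Sym},\kappa}_{p}\big).$$
   Context: Partitions: a partition $\lambda=(\lambda_1,\lambda_2,\dots)$ is a weakly decreasing sequence of nonnegative integers with finite sum $|\lambda|$; $l(\lambda)$ is its number of positive parts; $\lambda'$ is the conjugate partition ($\lambda'_i=\#\{j:\lambda_j\ge i\}$); $m_i(\lambda)=\lambda'_i-\lambda'_{i+1}$ is the number of parts equal to $i$. $\lambda$ is strict if $m_i(\lambda)\le 1$ for all $i\ge1$. $n(\lambda):=\sum_{i\ge1}\binom{\lambda'_i}{2}$. Throughout $q:=1/p\in(0,1)$, $(x;q)_\infty=\prod_{i\ge1}(1-xq^{i-1})$, $(x;q)_n=\prod_{i=1}^n(1-xq^{i-1})$ for $n\ge0$. Measures on the set of partitions (nonnegative functions): $$P^{\mathrm{Sym}}_{\infty,p}(\lambda):=\frac{q^{n(\lambda)+|\lambda|}(q;q^2)_\infty}{\prod_{i\ge1}(q^2;q^2)_{\lfloor m_i(\lambda)/2\rfloor}},\qquad \tilde P^{\mathrm{Sym},\kappa}_{p}(\lambda):=p^{\sum_{i\ge1}\kappa_i\lambda'_i}\,P^{\mathrm{Sym}}_{\infty,p}(\lambda),$$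 and, for $\kappa$ of length $r$ and $S\subseteq\{1,\dots,r\}$, $$\tilde P^{\mathrm{Sym},\kappa}_{p,S}(\lambda):=\Big(1+(-1)^{\sum_{i\in S}\lambda'_i}\Big)\tilde P^{\mathrm{Sym},\kappa}_{p}(\lambda).$$ Hall–Littlewood functions: for $l(\lambda)\le n$, $$P_\lambda(x_1,\dots,x_n;q)=\frac1{v_\lambda(q)}\sum_{w\in S_n}w\Big(x_1^{\lambda_1}\cdots x_n^{\lambda_n}\prod_{i<j}\frac{x_i-qx_j}{x_i-x_j}\Big),\quad v_\lambda(q)=\frac{(q;q)_{n-l(\lambda)}}{(1-q)^{n-l(\lambda)}}\prod_{i\ge1}\frac{(q;q)_{m_i(\lambda)}}{(1-q)^{m_i(\lambda)}},$$ where $S_n$ permutes the variables, extended by stability to symmetric functions in countably many variables; $Q_\lambda=b_\lambda(q)P_\lambda$ with $b_\lambda(q)=\prod_{i\ge1}(q;q)_{m_i(\lambda)}$. Define $g^\lambda_{\mu\nu}(q)$ by $Q_\mu Q_\nu=\sum_\lambda g^\lambda_{\mu\nu}(q)Q_\lambda$ and the skew function $P_{\lambda/\mu}:=\sum_\nu g^\lambda_{\mu\nu}(q)P_\nu$ (zero unless $\mu_i\le\lambda_i$ for all $i$). For real $p>1$ put $$|\mathrm{Sur}_p(\lambda,\mu)|:=\frac{P_{\lambda/\mu}(q,q^2,\dots;q)}{P_\lambda(q,q^2,\dots;q)\,Q_\mu(1,q,q^2,\dots;q)};$$ when $p$ is prime this is the number of surjective homomorphisms $\bigoplus_i\mathbb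 Z/p^{\lambda_i}\mathbb{Z}\to\bigoplus_i\mathbb Z/p^{\mu_i}\mathbb{Z}$. The $\mu$-moment of a measure $\nu$ on partitions is $M_{p,\mu}(\nu):=\sum_\lambda\nu(\lambda)\,|\mathrm{Sur}_p(\lambda,\mu)|$. *)

theory Defs
  imports "HOL-Analysis.Analysis" "HOL-Combinatorics.Permutations"
begin

section \<open>Partitions\<close>

text \<open>
  A partition is a function whose values at \<open>1, 2, 3, \<dots>\<close> are its parts. The unused index 0 is
  pinned to the value 0, so that distinct functions in \<open>partitions\<close> are distinct partitions.
\<close>

definition partitions :: "(nat \<Rightarrow> nat) set" where
  "partitions = {la. la 0 = 0 \<and> (\<forall>i\<ge>1. la (Suc i) \<le> la i) \<and> finite {i. la i \<noteq> 0}}"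

definition psize :: "(nat \<Rightarrow> nat) \<Rightarrow> nat" where
  "psize la = (\<Sum>i | la i \<noteq> 0. la i)"

definition plength :: "(nat \<Rightarrow> nat) \<Rightarrow> nat" where
  "plength la = card {i. la i \<noteq> 0}"

definition conjugate :: "(nat \<Rightarrow> nat) \<Rightarrow> nat \<Rightarrow> nat" where
  "conjugate la i = (if i = 0 then 0 else card {j. j \<ge> 1 \<and> la j \<ge> i})"

text \<open>Number of parts equal to \<open>i\<close>; meaningful for \<open>i \<ge> 1\<close> only.\<close>

definition mult :: "(nat \<Rightarrow> nat) \<Rightarrow> nat \<Rightarrow> nat" where
  "mult la i = conjugate la i - conjugate la (Suc i)"

definition strict_partition :: "(nat \<Rightarrow> nat) \<Rightarrow> bool" where
  "strict_partition la \<longleftrightarrow> (\<forall>i\<ge>1. mult la i \<le> 1)"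

text \<open>
  Here and below, sums and products over all \<open>i \<ge> 1\<close> involving \<open>conjugate la i\<close> or \<open>mult la i\<close> are
  cut off at the largest part \<open>la 1\<close>, beyond which both vanish.
\<close>

definition pn :: "(nat \<Rightarrow> nat) \<Rightarrow> nat" where
  "pn la = (\<Sum>i=1..la 1. conjugate la i choose 2)"

section \<open>The measures\<close>

definition qpoch :: "real \<Rightarrow> real \<Rightarrow> nat \<Rightarrow> real" where
  "qpoch x q n = (\<Prod>i=1..n. 1 - x * q ^ (i - 1))"

definition qpoch_inf :: "real \<Rightarrow> real \<Rightarrow> real" where
  "qpoch_inf x q = (\<Prod>i. 1 - x * q ^ i)"

definition PSym :: "real \<Rightarrow> (nat \<Rightarrow> nat) \<Rightarrow> real" where
  "PSym p la = (let q = 1 / p in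
     q ^ (pn la + psize la) * qpoch_inf q (q\<^sup>2) /
     (\<Prod>i=1..la 1. qpoch (q\<^sup>2) (q\<^sup>2) (mult la i div 2)))"

definition PSym_tilt :: "real \<Rightarrow> (nat \<Rightarrow> nat) \<Rightarrow> (nat \<Rightarrow> nat) \<Rightarrow> real" where
  "PSym_tilt p ka la = p ^ (\<Sum>i=1..plength ka. ka i * conjugate la i) * PSym p la"

definition PSym_tilt_sgn :: "real \<Rightarrow> (nat \<Rightarrow> nat) \<Rightarrow> nat set \<Rightarrow> (nat \<Rightarrow> nat) \<Rightarrow> real" where
  "PSym_tilt_sgn p ka S la = (1 + (- 1) ^ (\<Sum>i\<in>S. conjugate la i)) * PSym_tilt p ka la"

section \<open>Hall--Littlewood functions\<close>

text \<open>
  Symmetric functions are represented by their values. The variables are \<open>x 1, x 2, \<dots>\<close>, and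
  \<open>HL_P q la n x\<close> is \<open>P\<^sub>\<lambda>(x\<^sub>1, \<dots>, x\<^sub>n; q)\<close>, which is 0 if \<open>n < l(\<lambda>)\<close>. The symmetrisation formula is
  only meaningful at points with pairwise distinct coordinates (elsewhere Isabelle's \<open>y / 0 = 0\<close>
  intervenes); it is used at such points only. As they are Zariski dense, identities between
  polynomials are the same as identities between their values at these points.
\<close>

definition HL_v :: "real \<Rightarrow> nat \<Rightarrow> (nat \<Rightarrow> nat) \<Rightarrow> real" where
  "HL_v q n la =
     qpoch q q (n - plength la) / (1 - q) ^ (n - plength la) *
     (\<Prod>i=1..la 1. qpoch q q (mult la i) / (1 - q) ^ mult la i)"

definition HL_P :: "real \<Rightarrow> (nat \<Rightarrow> nat) \<Rightarrow> nat \<Rightarrow> (nat \<Rightarrow> real) \<Rightarrow> real" where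
  "HL_P q la n x =
     (if plength la \<le> n then
        1 / HL_v q n la *
        (\<Sum>w | w permutes {1..n}.
           (\<Prod>i=1..n. x (w i) ^ la i) *
           (\<Prod>j=1..n. \<Prod>i=1..<j. (x (w i) - q * x (w j)) / (x (w i) - x (w j))))
      else 0)"

definition HL_b :: "real \<Rightarrow> (nat \<Rightarrow> nat) \<Rightarrow> real" where
  "HL_b q la = (\<Prod>i=1..la 1. qpoch q q (mult la i))"

definition HL_Q :: "real \<Rightarrow> (nat \<Rightarrow> nat) \<Rightarrow> nat \<Rightarrow> (nat \<Rightarrow> real) \<Rightarrow> real" where
  "HL_Q q la n x = HL_b q la * HL_P q la n x"

text \<open>
  Values at an infinite sequence \<open>x 1, x 2, \<dots>\<close> (with pairwise distinct entries): by stability,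
  \<open>P\<^sub>\<lambda>(x\<^sub>1, \<dots>, x\<^sub>n; q)\<close> is the part of the symmetric function \<open>P\<^sub>\<lambda>\<close> involving only the first \<open>n\<close>
  variables, so the (absolutely convergent, for the summable sequences used below) sum of all
  its monomials is the limit.
\<close>

definition HL_P_inf :: "real \<Rightarrow> (nat \<Rightarrow> nat) \<Rightarrow> (nat \<Rightarrow> real) \<Rightarrow> real" where
  "HL_P_inf q la x = lim (\<lambda>n. HL_P q la n x)"

definition HL_Q_inf :: "real \<Rightarrow> (nat \<Rightarrow> nat) \<Rightarrow> (nat \<Rightarrow> real) \<Rightarrow> real" where
  "HL_Q_inf q la x = HL_b q la * HL_P_inf q la x"

text \<open>
  \<open>HL_g q mu nu\<close> is the family of coefficients of \<open>Q\<^sub>\<mu> Q\<^sub>\<nu>\<close> in the basis \<open>(Q\<^sub>\<lambda>)\<close>. An identity of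
  symmetric functions in countably many variables is one that holds in \<open>n\<close> variables for every \<open>n\<close>.
\<close>

definition HL_g :: "real \<Rightarrow> (nat \<Rightarrow> nat) \<Rightarrow> (nat \<Rightarrow> nat) \<Rightarrow> (nat \<Rightarrow> nat) \<Rightarrow> real" where
  "HL_g q mu nu = (THE g.
     {la. g la \<noteq> 0} \<subseteq> partitions \<and> finite {la. g la \<noteq> 0} \<and>
     (\<forall>n x. inj_on x {1..n} \<longrightarrow>
        HL_Q q mu n x * HL_Q q nu n x = (\<Sum>la | g la \<noteq> 0. g la * HL_Q q la n x)))"

text \<open>
  The sum is finite, as \<open>g\<^sup>\<lambda>\<^sub>\<mu>\<^sub>\<nu>\<close> vanishes unless \<open>|\<lambda>| = |\<mu>| + |\<nu>|\<close>. That the skew function is zero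
  unless \<open>\<mu>\<^sub>i \<le> \<lambda>\<^sub>i\<close> for all \<open>i\<close> is a consequence, not part of the definition.
\<close>

definition HL_P_skew_inf :: "real \<Rightarrow> (nat \<Rightarrow> nat) \<Rightarrow> (nat \<Rightarrow> nat) \<Rightarrow> (nat \<Rightarrow> real) \<Rightarrow> real" where
  "HL_P_skew_inf q la mu x =
     (\<Sum>nu | nu \<in> partitions \<and> HL_g q mu nu la \<noteq> 0. HL_g q mu nu la * HL_P_inf q nu x)"

section \<open>Moments\<close>

definition Sur :: "real \<Rightarrow> (nat \<Rightarrow> nat) \<Rightarrow> (nat \<Rightarrow> nat) \<Rightarrow> real" where
  "Sur p la mu = (let q = 1 / p in
     HL_P_skew_inf q la mu (\<lambda>i. q ^ i) /
     (HL_P_inf q la (\<lambda>i. q ^ i) * HL_Q_inf q mu (\<lambda>i. q ^ (i - 1))))"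

text \<open>
  The sum defining the \<open>\<mu>\<close>-moment has nonnegative terms. As a real-valued \<open>infsum\<close> it is 0 when
  the series diverges, so convergence has to be asserted separately.
\<close>

definition has_moment :: "real \<Rightarrow> (nat \<Rightarrow> nat) \<Rightarrow> ((nat \<Rightarrow> nat) \<Rightarrow> real) \<Rightarrow> bool" where
  "has_moment p mu \<nu> \<longleftrightarrow> (\<lambda>la. \<nu> la * Sur p la mu) summable_on partitions"

definition moment :: "real \<Rightarrow> (nat \<Rightarrow> nat) \<Rightarrow> ((nat \<Rightarrow> nat) \<Rightarrow> real) \<Rightarrow> real" where
  "moment p mu \<nu> = (\<Sum>\<^sub>\<infinity>la\<in>partitions. \<nu> la * Sur p la mu)"

end

theory Submission
  imports Defs "HOL-Combinatorics.Multiset_Permutations" "HOL-Computational_Algebra.Formal_Power_Series"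
begin

text \<open>
  Write \<open>a = \<lambda>'\<close> and \<open>c = \<mu>'\<close>. The first step is the product formula
  \<open>|Sur\<^sub>p(\<lambda>,\<mu>)| = \<Prod>\<^sub>i p^(a\<^sub>i c\<^sub>i) (q;q)\<^bsub>a\<^sub>i - c\<^sub>i\<^sub>+\<^sub>1\<^esub> / (q;q)\<^bsub>a\<^sub>i - c\<^sub>i\<^esub>\<close> for \<open>c \<le> a\<close>. Straightening the
  symmetrisation sums by \<open>R(\<dots>,s,s+1,\<dots>) = q R(\<dots>,s+1,s,\<dots>)\<close> gives the Pieri rule for the elementary
  symmetric functions; its inverse, found from the q-binomial theorem one column at a time, expands
  \<open>P\<^sub>\<mu> \<Sum>\<^sub>\<nu> q^n(\<nu>) P\<^sub>\<nu>\<close>, and at \<open>x\<^sub>i = q\<^sup>i\<close> only the identity permutation contributes to \<open>P\<^sub>\<nu>\<close>.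

  With \<open>d = a - c\<close>, the moment is then \<open>p^(n(\<mu>) + \<Sum>\<^sub>i \<kappa>\<^sub>i c\<^sub>i)\<close> times a sum over \<open>d\<close> that couples only
  neighbouring columns and is computed from the last column to the first. Without tilting, the sum over
  all columns after the \<open>i\<close>-th is the reciprocal of the numerator \<open>(q;q)\<^bsub>a\<^sub>i - c\<^sub>i\<^sub>+\<^sub>1\<^esub>\<close>, and each of
  the \<open>r\<close> tilted columns costs a factor bounded uniformly in \<open>c\<close>; this is the upper bound. With
  signs, for strict \<open>\<kappa>\<close>, the sum over all columns after the first, times the tilt of the first, is that
  reciprocal times a combination of functions \<open>(\<sigma> p^k)^(d\<^sub>1)\<close> with \<open>k \<ge> 1\<close> and \<open>\<sigma> = (-1)^|S|\<close>, so for
  odd \<open>|S|\<close> it is annihilated by Euler's identity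
  \<open>\<Sum>\<^sub>d (-p^k)^d q^(d(d+1)/2) / (q;q)\<^sub>d = \<Prod>\<^sub>j\<^sub>\<ge>\<^sub>1 (1 - q^(j-k)) = 0\<close>.
\<close>

section \<open>Partitions and their columns\<close>

text \<open>Columns are used throughout because \<open>PSym\<close>, the Pieri coefficients and the
  surjection count are all products over columns in which a column sees only its neighbours.

  No single structure constant is evaluated. Since P_nu(q, q^2, ...) = q^(|nu| + n(nu)) / b_nu, the
  skew function needs only the sum of g q^(n(nu)) / b_nu over nu of a fixed size k. This is the
  coefficient of Q_lambda in Q_mu h_k, because h_k is the sum of q^(n(nu)) P_nu; hence inverting the
  Pieri rule for the e_k suffices. But \<open>HL_g\<close> is a definite description, so expansions
  of all products and linear independence are still required, with symmetric functions given only by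
  their values at points with distinct coordinates.

  The column sum has no last column to start from: beyond those of mu and kappa there are infinitely
  many free ones. Their total is a fixed point of the one-column step, once truncation has secured
  convergence. Strictness of kappa keeps the exponents k positive in this recursion; at k = 0
  Euler's product would not vanish.\<close>

lemma partition_antimono:
  assumes "c \<in> partitions" "1 \<le> i" "i \<le> j"
  shows "c j \<le> c i"
  using assms(3)
proof (induction j rule: dec_induct)
  case (step n)
  then have "c (Suc n) \<le> c n" using assms by (auto simp: partitions_def)
  with step show ?case by simp
qed simp

lemma partition_support:
  assumes "c \<in> partitions"
  shows "{i. c i \<noteq> 0} = {1..plength c}"
proof -
  have fin: "finite {i. c i \<noteq> 0}" and z: "c 0 = 0" using assms by (auto simp: partitions_def)
  show ?thesis
  proof (cases "{i. c i \<noteq> 0} = {}")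
    case False
    define m where "m = Max {i. c i \<noteq> 0}"
    have m: "c m \<noteq> 0" "\<And>i. c i \<noteq> 0 \<Longrightarrow> i \<le> m"
      using Max_in[OF fin False] Max_ge[OF fin] by (auto simp: m_def)
    have "{i. c i \<noteq> 0} = {1..m}"
    proof (intro equalityI subsetI)
      fix i assume "i \<in> {i. c i \<noteq> 0}"
      then show "i \<in> {1..m}" using m z by (cases i) auto
    next
      fix i assume "i \<in> {1..m}"
      then have "c m \<le> c i" using partition_antimono[OF assms, of i m] by auto
      then show "i \<in> {i. c i \<noteq> 0}" using m by auto
    qed
    then show ?thesis by (simp add: plength_def)
  qed (simp add: plength_def)
qed

lemma partition_pos_iff: "c \<in> partitions \<Longrightarrow> c i > 0 \<longleftrightarrow> 1 \<le> i \<and> i \<le> plength c"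
  using partition_support[of c] by (metis (mono_tags, lifting) atLeastAtMost_iff mem_Collect_eq neq0_conv)

lemma partition_eq_0: "c \<in> partitions \<Longrightarrow> plength c < i \<Longrightarrow> c i = 0"
  using partition_pos_iff[of c i] by auto

lemma partition_0: "c \<in> partitions \<Longrightarrow> c 0 = 0"
  by (simp add: partitions_def)

lemma partition_plength_le: "c \<in> partitions \<Longrightarrow> (\<And>i. K < i \<Longrightarrow> c i = 0) \<Longrightarrow> plength c \<le> K"
  using partition_pos_iff[of c "plength c"] by (cases "plength c \<le> K") auto

lemma psize_eq_sum:
  assumes "c \<in> partitions" "plength c \<le> K"
  shows "psize c = (\<Sum>i=1..K. c i)"
  unfolding psize_def partition_support[OF assms(1)]
  by (rule sum.mono_neutral_left) (use assms partition_eq_0 in auto)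

lemma conjugate_set_finite:
  assumes "c \<in> partitions" "i \<ge> 1"
  shows "{j. j \<ge> 1 \<and> c j \<ge> i} \<subseteq> {1..plength c}"
  using assms partition_pos_iff[OF assms(1)] by force

lemma conjugate_le_plength: "c \<in> partitions \<Longrightarrow> conjugate c i \<le> plength c"
  using card_mono[OF _ conjugate_set_finite, of c i] by (auto simp: conjugate_def)

text \<open>Since the parts decrease, the rows of length at least i form an initial segment, so
  counting them amounts to locating the last one. This equivalence makes conjugation an involution
  on partitions.\<close>

lemma le_conjugate_iff:
  assumes "c \<in> partitions" "i \<ge> 1" "j \<ge> 1"
  shows "j \<le> conjugate c i \<longleftrightarrow> i \<le> c j"
proof -
  let ?S = "{j. j \<ge> 1 \<and> c j \<ge> i}"
  have fin: "finite ?S" using conjugate_set_finite[OF assms(1,2)] finite_subset by blast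
  have c: "conjugate c i = card ?S" using assms by (simp add: conjugate_def)
  show ?thesis
  proof
    assume "i \<le> c j"
    then have "{1..j} \<subseteq> ?S" using partition_antimono[OF assms(1), of _ j]
      by (auto intro: order.trans)
    then have "card {1..j} \<le> card ?S" by (rule card_mono[OF fin])
    then show "j \<le> conjugate c i" using c by simp
  next
    assume le: "j \<le> conjugate c i"
    show "i \<le> c j"
    proof (rule ccontr)
      assume "\<not> i \<le> c j"
      then have "k < j" if "k \<in> ?S" for k
        using partition_antimono[OF assms(1) assms(3), of k] that by (cases "k < j") auto
      then have "?S \<subseteq> {1..<j}" by auto
      then have "card ?S \<le> j - 1" using card_mono[of "{1..<j}" ?S] by simp
      with le c assms show False by simp
    qed
  qed
qed

lemma conjugate_in_partitions:
  assumes "c \<in> partitions"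
  shows "conjugate c \<in> partitions"
proof -
  have "conjugate c (Suc i) \<le> conjugate c i" if "i \<ge> 1" for i
  proof (cases "conjugate c (Suc i) = 0")
    case False
    then show ?thesis
      using le_conjugate_iff[OF assms, of "Suc i" "conjugate c (Suc i)"]
        le_conjugate_iff[OF assms, of i "conjugate c (Suc i)"] that by simp
  qed simp
  moreover have "{i. conjugate c i \<noteq> 0} \<subseteq> {..c 1}"
  proof
    fix i assume "i \<in> {i. conjugate c i \<noteq> 0}"
    then show "i \<in> {..c 1}" using le_conjugate_iff[OF assms, of i 1]
      by (cases "i = 0") (auto simp: conjugate_def)
  qed
  then have "finite {i. conjugate c i \<noteq> 0}" using finite_subset by blast
  moreover have "conjugate c 0 = 0" by (simp add: conjugate_def)
  ultimately show ?thesis unfolding partitions_def by blast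
qed

lemma conjugate_conjugate:
  assumes "c \<in> partitions"
  shows "conjugate (conjugate c) = c"
proof
  fix i
  show "conjugate (conjugate c) i = c i"
  proof (cases "i = 0")
    case True then show ?thesis using assms by (simp add: conjugate_def partition_0)
  next
    case False
    have "{j. 1 \<le> j \<and> i \<le> conjugate c j} = {1..c i}"
      using le_conjugate_iff[OF assms, of _ i] False by auto
    then show ?thesis using False by (simp add: conjugate_def)
  qed
qed

lemma bij_conjugate: "bij_betw conjugate partitions partitions"
  by (rule bij_betwI[where g = conjugate]) (auto simp: conjugate_conjugate conjugate_in_partitions)

lemma conjugate_1: "c \<in> partitions \<Longrightarrow> conjugate c (Suc 0) = plength c"
proof -
  assume c: "c \<in> partitions"
  have "1 \<le> j \<and> Suc 0 \<le> c j \<longleftrightarrow> j \<in> {1..plength c}" for j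
    using partition_pos_iff[OF c, of j] by auto
  then have "{j. 1 \<le> j \<and> Suc 0 \<le> c j} = {1..plength c}" by blast
  then show ?thesis by (simp add: conjugate_def)
qed

lemma plength_conjugate: "c \<in> partitions \<Longrightarrow> plength (conjugate c) = c (Suc 0)"
  using conjugate_1[of "conjugate c"] by (simp add: conjugate_conjugate conjugate_in_partitions)

lemma mult_conjugate: "c \<in> partitions \<Longrightarrow> mult (conjugate c) i = c i - c (Suc i)"
  by (simp add: mult_def conjugate_conjugate)

lemma pn_conjugate: "c \<in> partitions \<Longrightarrow> pn (conjugate c) = (\<Sum>i=1..plength c. c i choose 2)"
  by (simp add: pn_def conjugate_conjugate conjugate_1)

text \<open>Both sides count the boxes (i, j) with \<open>i \<le> c j\<close>.\<close>

lemma psize_conjugate: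
  assumes "c \<in> partitions"
  shows "psize (conjugate c) = psize c"
proof -
  have "psize (conjugate c) = (\<Sum>i=1..c 1. conjugate c i)"
    using psize_eq_sum[OF conjugate_in_partitions[OF assms], of "c 1"] by (simp add: plength_conjugate assms)
  also have "\<dots> = (\<Sum>i=1..c 1. \<Sum>j=1..plength c. if i \<le> c j then 1 else 0)"
  proof (rule sum.cong[OF refl])
    fix i assume i: "i \<in> {1..c 1}"
    have "{j. 1 \<le> j \<and> i \<le> c j} = {j \<in> {1..plength c}. i \<le> c j}"
      using conjugate_set_finite[OF assms, of i] i by auto
    then show "conjugate c i = (\<Sum>j=1..plength c. if i \<le> c j then 1 else 0)"
      using i by (simp add: conjugate_def sum.If_cases Int_def)
  qed
  also have "\<dots> = (\<Sum>j=1..plength c. \<Sum>i=1..c 1. if i \<le> c j then 1 else 0)"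
    by (rule sum.swap)
  also have "\<dots> = (\<Sum>j=1..plength c. c j)"
  proof (rule sum.cong[OF refl])
    fix j assume j: "j \<in> {1..plength c}"
    have "{i \<in> {1..c 1}. i \<le> c j} = {1..c j}" using partition_antimono[OF assms, of 1 j] j by auto
    then show "(\<Sum>i=1..c 1. if i \<le> c j then 1 else 0) = c j" by (simp add: sum.If_cases Int_def)
  qed
  also have "\<dots> = psize c" using psize_eq_sum[OF assms order.refl] by simp
  finally show ?thesis .
qed

definition partitions_of :: "nat \<Rightarrow> (nat \<Rightarrow> nat) set" where
  "partitions_of N = {c \<in> partitions. psize c = N}"

lemma partition_le_psize:
  assumes "c \<in> partitions"
  shows "c i \<le> psize c"
proof (cases "c i = 0")
  case False
  have "finite {i. c i \<noteq> 0}" using assms by (simp add: partitions_def)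
  then show ?thesis unfolding psize_def
    by (intro member_le_sum) (use False in auto)
qed simp

lemma plength_le_psize: "c \<in> partitions \<Longrightarrow> plength c \<le> psize c"
  using partition_le_psize[OF conjugate_in_partitions, of c "Suc 0"]
  by (simp add: conjugate_1 psize_conjugate)

lemma finite_partitions_of: "finite (partitions_of N)"
proof (rule finite_subset)
  let ?F = "{c::nat \<Rightarrow> nat. \<forall>i. (i \<in> {..N} \<longrightarrow> c i \<in> {..N}) \<and> (i \<notin> {..N} \<longrightarrow> c i = 0)}"
  show "partitions_of N \<subseteq> ?F"
  proof
    fix c assume "c \<in> partitions_of N"
    then have c: "c \<in> partitions" "psize c = N" by (auto simp: partitions_of_def)
    have "c i \<le> N" for i using partition_le_psize[OF c(1), of i] c(2) by simp
    moreover have "c i = 0" if "N < i" for i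
      using partition_eq_0[OF c(1), of i] plength_le_psize[OF c(1)] c(2) that by simp
    ultimately show "c \<in> ?F" by simp
  qed
  show "finite ?F" by (rule finite_set_of_finite_funs) auto
qed

lemma partitions_of_conjugate: "c \<in> partitions_of N \<Longrightarrow> conjugate c \<in> partitions_of N"
  by (simp add: partitions_of_def psize_conjugate conjugate_in_partitions)

lemma bij_conjugate_of: "bij_betw conjugate (partitions_of N) (partitions_of N)"
  by (rule bij_betwI[where g = conjugate])
     (auto simp: partitions_of_conjugate, auto simp: partitions_of_def conjugate_conjugate)

definition empty_partition :: "nat \<Rightarrow> nat" where "empty_partition = (\<lambda>_. 0)"

lemma empty_partition_in [simp]: "empty_partition \<in> partitions" by (simp add: partitions_def empty_partition_def)

lemma partitions_of_0: "partitions_of 0 = {empty_partition}"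
proof -
  have "c = empty_partition" if "c \<in> partitions" "psize c = 0" for c
  proof
    fix i show "c i = empty_partition i" using partition_le_psize[OF that(1), of i] that(2) by (simp add: empty_partition_def)
  qed
  moreover have "psize empty_partition = 0" by (simp add: psize_def empty_partition_def)
  ultimately show ?thesis by (auto simp: partitions_of_def)
qed


section \<open>Hall--Littlewood symmetrisation and the Pieri rule\<close>

lemma qpoch_0 [simp]: "qpoch x q 0 = 1"
  by (simp add: qpoch_def)

lemma qpoch_Suc: "qpoch x q (Suc n) = qpoch x q n * (1 - x * q ^ n)"
  by (simp add: qpoch_def)

lemma qpoch_pos:
  assumes "0 < q" "q < 1"
  shows "qpoch q q n > 0"
proof (induction n)
  case (Suc n)
  have "q ^ Suc n < 1" using assms by (intro power_Suc_less_one) auto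
  then show ?case using Suc by (simp add: qpoch_Suc)
qed simp

text \<open>The Gaussian binomial coefficient. The case distinction is there because
  \<open>n - k\<close> truncates on naturals, and the bare quotient would not vanish for k >
  n.\<close>

definition qbin :: "real \<Rightarrow> nat \<Rightarrow> nat \<Rightarrow> real" where
  "qbin q n k = (if k \<le> n then qpoch q q n / (qpoch q q k * qpoch q q (n - k)) else 0)"

lemma qbin_0 [simp]: "0 < q \<Longrightarrow> q < 1 \<Longrightarrow> qbin q n 0 = 1"
  using qpoch_pos[of q n] by (simp add: qbin_def)

lemma qbin_self [simp]: "0 < q \<Longrightarrow> q < 1 \<Longrightarrow> qbin q n n = 1"
  using qpoch_pos[of q n] by (simp add: qbin_def)

lemma qbin_gt [simp]: "n < k \<Longrightarrow> qbin q n k = 0"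
  by (simp add: qbin_def)

lemma qbin_Suc_Suc:
  assumes "0 < q" "q < 1" "k \<le> n"
  shows "qbin q (Suc n) (Suc k) = qbin q n (Suc k) + q ^ (n - k) * qbin q n k"
proof (cases "k = n")
  case True
  then show ?thesis using assms by simp
next
  case False
  then obtain m where m: "n = k + Suc m" using assms by (metis add_Suc_right le_neq_implies_less less_imp_Suc_add)
  have p: "qpoch q q j > 0" for j by (rule qpoch_pos) (use assms in auto)
  have k: "1 - q * q ^ k \<noteq> 0" and m': "1 - q * q ^ m \<noteq> 0"
    using p[of "Suc k"] p[of "Suc m"] by (auto simp: qpoch_Suc)
  have gen: "P * (v + t * u) / ((A * u) * (B * v)) = P / ((A * u) * B) + t * (P / (A * (B * v)))"
    if "A \<noteq> 0" "B \<noteq> 0" "u \<noteq> 0" "v \<noteq> 0" for A B u v P t :: real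
    using that by (simp add: field_simps)
  \<comment> \<open>The recurrence rests on 1 - q^(n+1) = (1 - q^(m+1)) + q^(m+1) (1 - q^(k+1)) with
    n = k + m + 1: each summand cancels one factor of the denominator.\<close>
  have "qpoch q q (Suc n) = qpoch q q n * (1 - q * q ^ n)" by (rule qpoch_Suc)
  also have "1 - q * q ^ n = (1 - q * q ^ m) + q ^ Suc m * (1 - q * q ^ k)"
    by (simp add: m algebra_simps power_add)
  finally have "qpoch q q (Suc n) = qpoch q q n * ((1 - q * q ^ m) + q ^ Suc m * (1 - q * q ^ k))" .
  then have "qbin q (Suc n) (Suc k) = qpoch q q n * ((1 - q * q ^ m) + q ^ Suc m * (1 - q * q ^ k))
      / (qpoch q q (Suc k) * qpoch q q (Suc m))"
    by (simp add: qbin_def m)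
  also have "\<dots> = qpoch q q n / (qpoch q q (Suc k) * qpoch q q m)
     + q ^ Suc m * (qpoch q q n / (qpoch q q k * qpoch q q (Suc m)))"
    unfolding qpoch_Suc using gen[of "qpoch q q k" "qpoch q q m"] p[of k] p[of m] k m' by simp
  also have "\<dots> = qbin q n (Suc k) + q ^ (n - k) * qbin q n k"
    by (simp add: qbin_def m)
  finally show ?thesis .
qed

text \<open>Like \<open>PiE\<close>, but with default 0 instead of \<open>undefined\<close> outside
  I, so that the elements are column sequences themselves and can be compared with sets of
  partitions.\<close>

definition Pi_zero :: "nat set \<Rightarrow> (nat \<Rightarrow> nat set) \<Rightarrow> (nat \<Rightarrow> nat) set" where
  "Pi_zero I B = {f. (\<forall>i\<in>I. f i \<in> B i) \<and> (\<forall>i. i \<notin> I \<longrightarrow> f i = 0)}"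

lemma Pi_zero_empty [simp]: "Pi_zero {} B = {\<lambda>_. 0}"
  by (auto simp: Pi_zero_def)

lemma Pi_zero_insert_bij:
  assumes "i \<notin> I"
  shows "bij_betw (\<lambda>(v, f). f(i := v)) (B i \<times> Pi_zero I B) (Pi_zero (insert i I) B)"
proof (rule bij_betwI[where g = "\<lambda>f. (f i, f(i := 0))"])
  show "(\<lambda>(v, f). f(i := v)) \<in> B i \<times> Pi_zero I B \<rightarrow> Pi_zero (insert i I) B"
    using assms by (auto simp: Pi_zero_def)
  show "(\<lambda>f. (f i, f(i := 0))) \<in> Pi_zero (insert i I) B \<rightarrow> B i \<times> Pi_zero I B"
    using assms by (auto simp: Pi_zero_def)
qed (use assms in \<open>auto simp: Pi_zero_def fun_upd_idem\<close>)

lemma sum_Pi_zero_insert: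
  assumes "i \<notin> I"
  shows "sum F (Pi_zero (insert i I) B) = (\<Sum>v\<in>B i. \<Sum>f\<in>Pi_zero I B. F (f(i := v)))"
  unfolding sum.cartesian_product
  by (subst sum.reindex_bij_betw[OF Pi_zero_insert_bij[OF assms], symmetric]) (simp add: case_prod_unfold)

lemma finite_Pi_zero:
  assumes "finite I" "\<And>i. i \<in> I \<Longrightarrow> finite (B i)"
  shows "finite (Pi_zero I B)"
  using assms
proof (induction I rule: finite_induct)
  case (insert i I)
  then show ?case using bij_betw_finite[OF Pi_zero_insert_bij[OF insert(2), of B]] by auto
qed simp

lemma prod_sum_Pi_zero:
  fixes h :: "nat \<Rightarrow> nat \<Rightarrow> 'a::comm_semiring_1"
  assumes "finite I"
  shows "(\<Sum>f\<in>Pi_zero I B. \<Prod>i\<in>I. h i (f i)) = (\<Prod>i\<in>I. \<Sum>v\<in>B i. h i v)"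
  using assms
proof (induction I rule: finite_induct)
  case (insert i I)
  have "(\<Sum>f\<in>Pi_zero (insert i I) B. \<Prod>j\<in>insert i I. h j (f j))
      = (\<Sum>v\<in>B i. \<Sum>f\<in>Pi_zero I B. h i v * (\<Prod>j\<in>I. h j (f j)))"
    unfolding sum_Pi_zero_insert[OF insert(2)]
  proof (intro sum.cong refl)
    fix v f
    have "(\<Prod>j\<in>I. h j ((f(i := v)) j)) = (\<Prod>j\<in>I. h j (f j))"
      by (rule prod.cong) (use insert in auto)
    then show "(\<Prod>j\<in>insert i I. h j ((f(i := v)) j)) = h i v * (\<Prod>j\<in>I. h j (f j))"
      using insert by simp
  qed
  also have "\<dots> = (\<Sum>v\<in>B i. h i v * (\<Prod>j\<in>I. \<Sum>v\<in>B j. h j v))"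
    by (simp add: sum_distrib_left[symmetric] insert)
  also have "\<dots> = (\<Prod>j\<in>insert i I. \<Sum>v\<in>B j. h j v)"
    using insert by (simp add: sum_distrib_right)
  finally show ?case .
qed simp

section \<open>Straightening of symmetrisation sums\<close>

definition HL_sym :: "real \<Rightarrow> nat \<Rightarrow> (nat \<Rightarrow> nat) \<Rightarrow> (nat \<Rightarrow> real) \<Rightarrow> real" where
  "HL_sym q n \<alpha> x = (\<Sum>w | w permutes {1..n}. (\<Prod>i=1..n. x (w i) ^ \<alpha> i) *
     (\<Prod>j=1..n. \<Prod>i=1..<j. (x (w i) - q * x (w j)) / (x (w i) - x (w j))))"

lemma HL_sym_cong:
  "(\<And>i. 1 \<le> i \<Longrightarrow> i \<le> n \<Longrightarrow> \<alpha> i = \<beta> i) \<Longrightarrow> HL_sym q n \<alpha> x = HL_sym q n \<beta> x"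
  unfolding HL_sym_def by (intro sum.cong arg_cong2[where f = "(*)"] prod.cong refl) auto

text \<open>Pair w with its composite with the transposition of i and i + 1. The other factors are
  permuted among themselves, and for the two variables X, Y involved both sides become q (X^2 - Y^2)
  / (X - Y) times the same factor. Exponents are arbitrary because multiplying by e_k leaves the
  weakly decreasing ones.\<close>

lemma HL_sym_swap:
  assumes inj: "inj_on x {1..n}" and i: "1 \<le> i" "i < n" and \<alpha>: "\<alpha> i = s" "\<alpha> (Suc i) = Suc s"
  shows "HL_sym q n \<alpha> x = q * HL_sym q n (\<alpha>(i := Suc s, Suc i := s)) x"
proof -
  define \<beta> where "\<beta> = \<alpha>(i := Suc s, Suc i := s)"
  define \<tau> where "\<tau> = Transposition.transpose i (Suc i)"
  define h where "h w a b = (x (w a) - q * x (w b)) / (x (w a) - x (w b))" for w :: "nat \<Rightarrow> nat" and a b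
  define t where "t \<alpha> w = (\<Prod>i=1..n. x (w i) ^ \<alpha> i) * (\<Prod>j=1..n. \<Prod>i=1..<j. h w i j)"
    for \<alpha> :: "nat \<Rightarrow> nat" and w
  have HL: "HL_sym q n \<gamma> x = (\<Sum>w | w permutes {1..n}. t \<gamma> w)" for \<gamma>
    by (simp add: HL_sym_def t_def h_def)
  have \<tau>: "\<tau> permutes {1..n}" unfolding \<tau>_def using i by (intro permutes_swap_id) auto
  define S where "S = (SIGMA j:{1..n}. {1..<j})"
  \<comment> \<open>All pairs except the adjacent one. The transposition maps this set to itself, as
    it reverses the order of no other pair.\<close>
  define S' where "S' = S - {(Suc i, i)}"
  define M where "M w = (\<Prod>k\<in>{1..n} - {i, Suc i}. x (w k) ^ \<alpha> k)" for w
  define N where "N w = (\<Prod>(b, a)\<in>S'. h w a b)" for w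
  have finS: "finite S" by (simp add: S_def)
  have mem: "(Suc i, i) \<in> S" using i by (auto simp: S_def)
  have mono: "(\<Prod>k=1..n. x (w k) ^ \<gamma> k) = x (w i) ^ \<gamma> i * x (w (Suc i)) ^ \<gamma> (Suc i) * M w"
    if "\<And>k. k \<notin> {i, Suc i} \<Longrightarrow> \<gamma> k = \<alpha> k" for w \<gamma>
  proof -
    have "{1..n} = insert i (insert (Suc i) ({1..n} - {i, Suc i}))" using i by auto
    then have "(\<Prod>k=1..n. x (w k) ^ \<gamma> k) =
       (\<Prod>k\<in>insert i (insert (Suc i) ({1..n} - {i, Suc i})). x (w k) ^ \<gamma> k)" by simp
    also have "\<dots> = x (w i) ^ \<gamma> i * x (w (Suc i)) ^ \<gamma> (Suc i) * (\<Prod>k\<in>{1..n} - {i, Suc i}. x (w k) ^ \<gamma> k)"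
      by (subst prod.insert; simp add: mult.assoc)
    also have "(\<Prod>k\<in>{1..n} - {i, Suc i}. x (w k) ^ \<gamma> k) = M w"
      unfolding M_def by (rule prod.cong) (use that in auto)
    finally show ?thesis .
  qed
  have pairs: "(\<Prod>j=1..n. \<Prod>i=1..<j. h w i j) = h w i (Suc i) * N w" for w
  proof -
    have "(\<Prod>j=1..n. \<Prod>i=1..<j. h w i j) = (\<Prod>(b, a)\<in>S. h w a b)"
      unfolding S_def by (subst prod.Sigma) auto
    also have "\<dots> = h w i (Suc i) * N w"
      unfolding N_def S'_def using prod.remove[OF finS mem, of "\<lambda>(b, a). h w a b"] by simp
    finally show ?thesis .
  qed
  have M\<tau>: "M (w \<circ> \<tau>) = M w" for w
    unfolding M_def \<tau>_def by (rule prod.cong) (auto simp: Transposition.transpose_def)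
  have N\<tau>: "N (w \<circ> \<tau>) = N w" for w
  proof -
    have inv: "(\<tau> b, \<tau> a) \<in> S'" if "(b, a) \<in> S'" for a b
      using that i unfolding S'_def S_def \<tau>_def Transposition.transpose_def by (auto split: if_splits)
    have inv2: "\<tau> (\<tau> a) = a" for a by (simp add: \<tau>_def)
    have "bij_betw (\<lambda>(b, a). (\<tau> b, \<tau> a)) S' S'"
      by (rule bij_betwI[where g = "\<lambda>(b, a). (\<tau> b, \<tau> a)"]) (auto simp: inv inv2)
    from prod.reindex_bij_betw[OF this, of "\<lambda>(b, a). h w a b"]
    show ?thesis by (simp add: N_def h_def case_prod_unfold)
  qed
  have key: "t \<alpha> w + t \<alpha> (w \<circ> \<tau>) = q * (t \<beta> w + t \<beta> (w \<circ> \<tau>))" if w: "w permutes {1..n}" for w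
  proof -
    define X Y where "X = x (w i)" and "Y = x (w (Suc i))"
    have "w i \<noteq> w (Suc i)" using permutes_inj[OF w] by (metis injD n_not_Suc_n)
    moreover have "w i \<in> {1..n}" "w (Suc i) \<in> {1..n}"
      using permutes_in_image[OF w, of i] permutes_in_image[OF w, of "Suc i"] i by auto
    ultimately have XY: "X \<noteq> Y" using inj unfolding X_def Y_def inj_on_def by blast
    have \<tau>i: "\<tau> i = Suc i" "\<tau> (Suc i) = i" by (simp_all add: \<tau>_def)
    have 1: "t \<alpha> w = X ^ s * Y ^ Suc s * ((X - q * Y) / (X - Y)) * (M w * N w)"
      unfolding t_def pairs mono[OF refl] by (simp add: \<alpha> h_def X_def Y_def)
    have 2: "t \<alpha> (w \<circ> \<tau>) = Y ^ s * X ^ Suc s * ((Y - q * X) / (Y - X)) * (M w * N w)"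
      unfolding t_def pairs mono[OF refl] M\<tau> N\<tau> by (simp add: \<alpha> h_def X_def Y_def \<tau>i)
    have mono\<beta>: "(\<Prod>k=1..n. x (w k) ^ \<beta> k) = x (w i) ^ \<beta> i * x (w (Suc i)) ^ \<beta> (Suc i) * M w" for w
      by (rule mono) (simp add: \<beta>_def)
    have 3: "t \<beta> w = X ^ Suc s * Y ^ s * ((X - q * Y) / (X - Y)) * (M w * N w)"
      unfolding t_def pairs mono\<beta> by (simp add: \<beta>_def h_def X_def Y_def)
    have 4: "t \<beta> (w \<circ> \<tau>) = Y ^ Suc s * X ^ s * ((Y - q * X) / (Y - X)) * (M w * N w)"
      unfolding t_def pairs mono\<beta> M\<tau> N\<tau> by (simp add: \<beta>_def h_def X_def Y_def \<tau>i)
    have eq: "(Y - q * X) / (Y - X) = (q * X - Y) / (X - Y)"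
      using XY by (simp add: field_simps)
    have "Y * ((X - q * Y) / (X - Y)) + X * ((q * X - Y) / (X - Y))
        = q * (X * ((X - q * Y) / (X - Y)) + Y * ((q * X - Y) / (X - Y)))"
      using XY by (simp add: field_simps)
    then have "X ^ s * Y ^ s * (M w * N w) * (Y * ((X - q * Y) / (X - Y)) + X * ((q * X - Y) / (X - Y)))
        = X ^ s * Y ^ s * (M w * N w) * (q * (X * ((X - q * Y) / (X - Y)) + Y * ((q * X - Y) / (X - Y))))"
      by simp
    then show ?thesis unfolding 1 2 3 4 eq by (simp only: power_Suc) (simp add: algebra_simps)
  qed
  \<comment> \<open>Summing over all w meets each pair twice, hence the factor 2.\<close>
  have dbl: "2 * HL_sym q n \<gamma> x = (\<Sum>w | w permutes {1..n}. t \<gamma> w + t \<gamma> (w \<circ> \<tau>))" for \<gamma>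
    unfolding HL sum.distrib
    using sum_permutations_compose_right[OF \<tau>, of "t \<gamma>"] by simp
  have "2 * HL_sym q n \<alpha> x = q * (2 * HL_sym q n \<beta> x)"
    unfolding dbl sum_distrib_left by (rule sum.cong) (auto simp: key)
  then show ?thesis by (simp add: \<beta>_def)
qed

text \<open>With exponents in a list, whose length is the number of variables, runs of equal parts
  become \<open>replicate\<close> blocks, the units on which straightening acts.\<close>

definition HL_list :: "real \<Rightarrow> (nat \<Rightarrow> real) \<Rightarrow> nat list \<Rightarrow> real" where
  "HL_list q x l = HL_sym q (length l) (\<lambda>i. l ! (i - 1)) x"

lemma HL_list_swap:
  assumes "inj_on x {1..length (l1 @ [s, Suc s] @ l2)}"
  shows "HL_list q x (l1 @ [s, Suc s] @ l2) = q * HL_list q x (l1 @ [Suc s, s] @ l2)"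
proof -
  let ?n = "length (l1 @ [s, Suc s] @ l2)" and ?i = "Suc (length l1)"
  let ?\<alpha> = "\<lambda>i. (l1 @ [s, Suc s] @ l2) ! (i - 1)"
  have "HL_sym q ?n ?\<alpha> x = q * HL_sym q ?n (?\<alpha>(?i := Suc s, Suc ?i := s)) x"
    by (rule HL_sym_swap) (use assms in \<open>auto simp: nth_append\<close>)
  also have "HL_sym q ?n (?\<alpha>(?i := Suc s, Suc ?i := s)) x = HL_sym q ?n (\<lambda>i. (l1 @ [Suc s, s] @ l2) ! (i - 1)) x"
    by (rule HL_sym_cong) (auto simp: nth_append nth_Cons split: nat.splits)
  finally show ?thesis by (simp add: HL_list_def)
qed

text \<open>The sum of \<open>F |\<epsilon>| (l + \<epsilon>)\<close> over all 0-1 vectors \<open>\<epsilon>\<close> of the same length as \<open>l\<close>.\<close>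

fun increment_sum :: "(nat \<Rightarrow> nat list \<Rightarrow> real) \<Rightarrow> nat list \<Rightarrow> real" where
  "increment_sum F [] = F 0 []"
| "increment_sum F (s # l) = increment_sum (\<lambda>k l'. F k (s # l')) l + increment_sum (\<lambda>k l'. F (Suc k) (Suc s # l')) l"

lemma increment_sum_cong:
  "(\<And>k l'. length l' = length l \<Longrightarrow> F k l' = F' k l') \<Longrightarrow> increment_sum F l = increment_sum F' l"
proof (induction l arbitrary: F F')
  case (Cons s l)
  show ?case unfolding increment_sum.simps
    by (intro arg_cong2[where f = "(+)"] Cons.IH Cons.prems) auto
qed simp

lemma increment_sum_add: "increment_sum (\<lambda>k l'. F k l' + F' k l') l = increment_sum F l + increment_sum F' l"
  by (induction l arbitrary: F F') simp_all

lemma increment_sum_cmult: "increment_sum (\<lambda>k l'. a * F k l') l = a * increment_sum F l"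
  by (induction l arbitrary: F) (simp_all add: distrib_left)

lemma increment_sum_sum: "increment_sum (\<lambda>k l'. \<Sum>w\<in>W. F w k l') l = (\<Sum>w\<in>W. increment_sum (F w) l)"
  by (induction l arbitrary: F) (simp_all add: sum.distrib)

lemma increment_sum_append:
  "increment_sum F (l1 @ l2) = increment_sum (\<lambda>k1 l1'. increment_sum (\<lambda>k2 l2'. F (k1 + k2) (l1' @ l2')) l2) l1"
  by (induction l1 arbitrary: F) simp_all

fun monomial_list :: "real list \<Rightarrow> nat list \<Rightarrow> real" where
  "monomial_list (y # ys) (a # l) = y ^ a * monomial_list ys l"
| "monomial_list _ _ = 1"

lemma monomial_list_eq:
  "length ys = length l \<Longrightarrow> monomial_list ys l = (\<Prod>i<length l. ys ! i ^ (l ! i))"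
  by (induction ys l rule: list_induct2) (simp_all add: prod.lessThan_Suc_shift del: prod.lessThan_Suc)

text \<open>The sum of g k e_k(ys) over all k. A weight g in place of a fixed degree makes the
  recursion over the variables close.\<close>

fun elem_sum :: "(nat \<Rightarrow> real) \<Rightarrow> real list \<Rightarrow> real" where
  "elem_sum g [] = g 0"
| "elem_sum g (y # ys) = elem_sum g ys + y * elem_sum (\<lambda>k. g (Suc k)) ys"

lemma elem_sum_move: "elem_sum g (xs @ y # ys) = elem_sum g (y # xs @ ys)"
  by (induction xs arbitrary: g) (simp_all add: algebra_simps)

lemma elem_sum_mset_cong: "mset xs = mset ys \<Longrightarrow> elem_sum g xs = elem_sum g ys"
proof (induction xs arbitrary: g ys)
  case (Cons x xs)
  then have "x \<in> set ys" by (metis list.set_intros(1) set_mset_mset)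
  then obtain ys1 ys2 where ys: "ys = ys1 @ x # ys2" by (meson split_list)
  with Cons.prems have "mset xs = mset (ys1 @ ys2)" by simp
  then have "\<And>g. elem_sum g xs = elem_sum g (ys1 @ ys2)" by (rule Cons.IH)
  then show ?case unfolding ys elem_sum_move by simp
qed simp

lemma increment_sum_monomial_list:
  "length ys = length l \<Longrightarrow> increment_sum (\<lambda>k l'. g k * monomial_list ys l') l = elem_sum g ys * monomial_list ys l"
proof (induction ys l arbitrary: g rule: list_induct2)
  case (Cons y ys a l)
  have "(\<lambda>k l'. g k * monomial_list (y # ys) (a # l')) = (\<lambda>k l'. y ^ a * (g k * monomial_list ys l'))"
    "(\<lambda>k l'. g (Suc k) * monomial_list (y # ys) (Suc a # l')) = (\<lambda>k l'. y ^ Suc a * (g (Suc k) * monomial_list ys l'))"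
    by (simp_all add: fun_eq_iff)
  then have "increment_sum (\<lambda>k l'. g k * monomial_list (y # ys) l') (a # l)
     = y ^ a * increment_sum (\<lambda>k l'. g k * monomial_list ys l') l
       + y ^ Suc a * increment_sum (\<lambda>k l'. g (Suc k) * monomial_list ys l') l"
    by (simp only: increment_sum.simps increment_sum_cmult)
  then show ?case unfolding Cons.IH by (simp add: algebra_simps)
qed simp

lemma HL_list_eq:
  "HL_list q x l = (\<Sum>w | w permutes {1..length l}. (\<Prod>j=1..length l. \<Prod>i=1..<j. (x (w i) - q * x (w j)) / (x (w i) - x (w j)))
      * monomial_list (map (\<lambda>i. x (w i)) [1..<Suc (length l)]) l)"
  unfolding HL_list_def HL_sym_def
proof (intro sum.cong refl)
  fix w
  have "(\<Prod>i=1..length l. x (w i) ^ (l ! (i - 1))) = monomial_list (map (\<lambda>i. x (w i)) [1..<Suc (length l)]) l"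
    by (subst monomial_list_eq) (auto simp: prod.atLeast1_atMost_eq simp del: upt_Suc)
  then show "(\<Prod>i=1..length l. x (w i) ^ (l ! (i - 1))) * (\<Prod>j=1..length l. \<Prod>i=1..<j. (x (w i) - q * x (w j)) / (x (w i) - x (w j)))
    = (\<Prod>j=1..length l. \<Prod>i=1..<j. (x (w i) - q * x (w j)) / (x (w i) - x (w j))) * monomial_list (map (\<lambda>i. x (w i)) [1..<Suc (length l)]) l"
    by simp
qed

text \<open>A symmetric factor can be moved inside the symmetrisation and expanded against the
  monomial of each w: every product of distinct variables raises the exponents by a 0-1
  vector.\<close>

lemma elem_sum_mult_HL_list:
  "elem_sum g (map x [1..<Suc (length l)]) * HL_list q x l = increment_sum (\<lambda>k l'. g k * HL_list q x l') l"
proof -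
  let ?n = "length l"
  let ?h = "\<lambda>w. \<Prod>j=1..?n. \<Prod>i=1..<j. (x (w i) - q * x (w j)) / (x (w i) - x (w j))"
  let ?y = "\<lambda>w. map (\<lambda>i. x (w i)) [1..<Suc ?n]"
  have "increment_sum (\<lambda>k l'. g k * HL_list q x l') l
      = increment_sum (\<lambda>k l'. \<Sum>w | w permutes {1..?n}. ?h w * (g k * monomial_list (?y w) l')) l"
    by (rule increment_sum_cong) (simp add: HL_list_eq sum_distrib_left mult_ac del: upt_Suc)
  also have "\<dots> = (\<Sum>w | w permutes {1..?n}. ?h w * (elem_sum g (?y w) * monomial_list (?y w) l))"
    unfolding increment_sum_sum increment_sum_cmult by (simp add: increment_sum_monomial_list del: upt_Suc)
  also have "\<dots> = (\<Sum>w | w permutes {1..?n}. ?h w * (elem_sum g (map x [1..<Suc ?n]) * monomial_list (?y w) l))"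
  proof (intro sum.cong refl)
    fix w assume "w \<in> {w. w permutes {1..?n}}"
    then have w: "w permutes {1..?n}" by simp
    have "mset (map w [1..<Suc ?n]) = mset [1..<Suc ?n]"
    proof (subst set_eq_iff_mset_eq_distinct[symmetric])
      show "distinct (map w [1..<Suc ?n])"
        using permutes_inj_on[OF w] by (simp add: distinct_map del: upt_Suc)
      show "set (map w [1..<Suc ?n]) = set [1..<Suc ?n]"
        using permutes_image[OF w] by (simp add: atLeastLessThanSuc_atLeastAtMost del: upt_Suc)
    qed simp
    then have "mset (map x (map w [1..<Suc ?n])) = mset (map x [1..<Suc ?n])"
      by (metis mset_map)
    then have "mset (?y w) = mset (map x [1..<Suc ?n])" by (simp add: o_def del: upt_Suc)
    from elem_sum_mset_cong[OF this, of g]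
    show "?h w * (elem_sum g (?y w) * monomial_list (?y w) l) = ?h w * (elem_sum g (map x [1..<Suc ?n]) * monomial_list (?y w) l)"
      by simp
  qed
  also have "\<dots> = elem_sum g (map x [1..<Suc ?n]) * HL_list q x l"
    by (simp add: HL_list_eq sum_distrib_left mult_ac del: upt_Suc)
  finally show ?thesis ..
qed


text \<open>R is abstract since only the exchange rule matters. The rule is tied to one length N
  because a fixed point x is known to have distinct coordinates only among its first N.\<close>

context
  fixes R :: "nat list \<Rightarrow> real" and q :: real and N :: nat
  assumes swap: "\<And>l1 s l2. length (l1 @ [s, Suc s] @ l2) = N \<Longrightarrow>
      R (l1 @ [s, Suc s] @ l2) = q * R (l1 @ [Suc s, s] @ l2)"
    and q: "0 < q" "q < 1"
begin

lemma swap_block: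
  "length pre + Suc j + length suf = N \<Longrightarrow>
    R (pre @ replicate j s @ [Suc s] @ suf) = q ^ j * R (pre @ [Suc s] @ replicate j s @ suf)"
proof (induction j arbitrary: suf)
  case (Suc j)
  have "R (pre @ replicate (Suc j) s @ [Suc s] @ suf) = R ((pre @ replicate j s) @ [s, Suc s] @ suf)"
    by (simp add: replicate_app_Cons_same)
  also have "\<dots> = q * R ((pre @ replicate j s) @ [Suc s, s] @ suf)"
    by (rule swap) (use Suc.prems in simp)
  also have "R ((pre @ replicate j s) @ [Suc s, s] @ suf) = R (pre @ replicate j s @ [Suc s] @ (s # suf))"
    by simp
  also have "\<dots> = q ^ j * R (pre @ [Suc s] @ replicate j s @ s # suf)"
    by (rule Suc.IH) (use Suc.prems in simp)
  also have "pre @ [Suc s] @ replicate j s @ s # suf = pre @ [Suc s] @ replicate (Suc j) s @ suf"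
    by (simp add: replicate_append_same)
  finally show ?case by simp
qed simp

text \<open>Sorting an increment with r ones costs q to the number of its inversions, and over all
  r-subsets of an m-block these powers add up to the Gaussian binomial. Splitting off the last entry
  turns this into the q-Pascal rule.\<close>

lemma increment_sum_replicate:
  "length pre + m + length suf = N \<Longrightarrow>
    increment_sum (\<lambda>k l'. G k * R (pre @ l' @ suf)) (replicate m s)
    = (\<Sum>r\<le>m. G r * qbin q m r * R (pre @ replicate r (Suc s) @ replicate (m - r) s @ suf))"
proof (induction m arbitrary: G suf)
  case 0
  then show ?case using q by simp
next
  case (Suc m)
  let ?R = "\<lambda>r. R (pre @ replicate r (Suc s) @ replicate (Suc m - r) s @ suf)"
  have "increment_sum (\<lambda>k l'. G k * R (pre @ l' @ suf)) (replicate (Suc m) s)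
     = increment_sum (\<lambda>k l'. G k * R (pre @ l' @ suf)) (replicate m s @ [s])"
    by (simp add: replicate_append_same)
  also have "\<dots> = increment_sum (\<lambda>k l'. G k * R (pre @ l' @ ([s] @ suf))) (replicate m s)
       + increment_sum (\<lambda>k l'. G (Suc k) * R (pre @ l' @ ([Suc s] @ suf))) (replicate m s)"
    unfolding increment_sum_append by (simp add: increment_sum_add)
  also have "increment_sum (\<lambda>k l'. G k * R (pre @ l' @ ([s] @ suf))) (replicate m s)
     = (\<Sum>r\<le>m. G r * qbin q m r * R (pre @ replicate r (Suc s) @ replicate (m - r) s @ [s] @ suf))"
    by (rule Suc.IH) (use Suc.prems in simp)
  also have "\<dots> = (\<Sum>r\<le>m. G r * qbin q m r * ?R r)"
  proof (intro sum.cong refl)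
    fix r assume "r \<in> {..m}"
    then have e: "replicate (m - r) s @ [s] @ suf = replicate (Suc m - r) s @ suf"
      by (simp add: Suc_diff_le replicate_app_Cons_same)
    show "G r * qbin q m r * R (pre @ replicate r (Suc s) @ replicate (m - r) s @ [s] @ suf)
        = G r * qbin q m r * ?R r" by (simp only: e)
  qed
  also have "increment_sum (\<lambda>k l'. G (Suc k) * R (pre @ l' @ ([Suc s] @ suf))) (replicate m s)
     = (\<Sum>r\<le>m. G (Suc r) * qbin q m r * R (pre @ replicate r (Suc s) @ replicate (m - r) s @ [Suc s] @ suf))"
    by (rule Suc.IH) (use Suc.prems in simp)
  also have "\<dots> = (\<Sum>r\<le>m. G (Suc r) * (q ^ (m - r) * qbin q m r) * ?R (Suc r))"
  proof (intro sum.cong refl)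
    fix r assume "r \<in> {..m}"
    then have "R ((pre @ replicate r (Suc s)) @ replicate (m - r) s @ [Suc s] @ suf)
       = q ^ (m - r) * R ((pre @ replicate r (Suc s)) @ [Suc s] @ replicate (m - r) s @ suf)"
      by (intro swap_block) (use Suc.prems in simp)
    then show "G (Suc r) * qbin q m r * R (pre @ replicate r (Suc s) @ replicate (m - r) s @ [Suc s] @ suf)
      = G (Suc r) * (q ^ (m - r) * qbin q m r) * ?R (Suc r)"
      by (simp add: replicate_app_Cons_same)
  qed
  also have "(\<Sum>r\<le>m. G r * qbin q m r * ?R r) = (\<Sum>r\<le>Suc m. G r * qbin q m r * ?R r)"
    by simp
  also have "\<dots> = G 0 * ?R 0 + (\<Sum>r\<le>m. G (Suc r) * qbin q m (Suc r) * ?R (Suc r))"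
    by (subst sum.atMost_Suc_shift) (use q in simp)
  also have "\<dots> + (\<Sum>r\<le>m. G (Suc r) * (q ^ (m - r) * qbin q m r) * ?R (Suc r))
     = G 0 * ?R 0 + (\<Sum>r\<le>m. G (Suc r) * qbin q (Suc m) (Suc r) * ?R (Suc r))"
    unfolding add.assoc sum.distrib[symmetric]
    by (intro arg_cong2[where f = "(+)"] refl sum.cong) (simp add: qbin_Suc_Suc[OF q] algebra_simps)
  also have "\<dots> = (\<Sum>r\<le>Suc m. G r * qbin q (Suc m) r * ?R r)"
    by (subst sum.atMost_Suc_shift) (use q in simp)
  finally show ?case .
qed

end

text \<open>The parts of the partition with columns c, in decreasing order, up to the value K. The
  entry \<open>c 0\<close>, otherwise pinned to 0, holds the number of variables here, so that the
  zero parts form a block of size \<open>c 0 - c 1\<close>.\<close>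

fun column_list :: "(nat \<Rightarrow> nat) \<Rightarrow> nat \<Rightarrow> nat list" where
  "column_list c 0 = replicate (c 0 - c 1) 0"
| "column_list c (Suc K) = replicate (c (Suc K) - c (Suc (Suc K))) (Suc K) @ column_list c K"

text \<open>The blocks of equal parts after an increment, each sorted by itself; of the parts equal
  to i, \<open>b (i + 1) - c (i + 1)\<close> were raised. No sorting across blocks is needed: a
  raised part does not exceed the unraised parts of earlier blocks.\<close>

fun incremented_list :: "(nat \<Rightarrow> nat) \<Rightarrow> (nat \<Rightarrow> nat) \<Rightarrow> nat \<Rightarrow> nat list" where
  "incremented_list b c 0 = replicate (b 1 - c 1) 1 @ replicate (c 0 - b 1) 0"
| "incremented_list b c (Suc K) = replicate (b (Suc (Suc K)) - c (Suc (Suc K))) (Suc (Suc K))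
     @ replicate (c (Suc K) - b (Suc (Suc K))) (Suc K) @ incremented_list b c K"

lemma incremented_list_cong:
  "(\<And>i. 1 \<le> i \<Longrightarrow> i \<le> Suc K \<Longrightarrow> b i = b' i) \<Longrightarrow> incremented_list b c K = incremented_list b' c K"
  by (induction K) simp_all

text \<open>The unraised parts of one block and the raised parts of the next have equal value and
  merge into one block of b. The prefix is what the earlier block leaves over; in the induction v
  becomes \<open>b (K + 2)\<close>.\<close>

lemma incremented_list_eq_aux:
  assumes "\<And>i. 1 \<le> i \<Longrightarrow> i \<le> Suc K \<Longrightarrow> c i \<le> b i \<and> b i \<le> c (i - 1)" "b 0 = c 0" "v \<le> c (Suc K)"
  shows "replicate (c (Suc K) - v) (Suc K) @ incremented_list b c K = replicate (b (Suc K) - v) (Suc K) @ column_list b K"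
  using assms
proof (induction K arbitrary: v)
  case 0
  from "0.prems"(1)[of 1] "0.prems"(2,3)
  have e: "b 1 - v = (c 1 - v) + (b 1 - c 1)" by simp
  show ?case by (simp only: One_nat_def[symmetric] e replicate_add) (use 0 in simp)
next
  case (Suc K)
  from Suc.prems(1)[of "Suc (Suc K)"] Suc.prems(3)
  have e: "b (Suc (Suc K)) - v = (c (Suc (Suc K)) - v) + (b (Suc (Suc K)) - c (Suc (Suc K)))"
    and le: "b (Suc (Suc K)) \<le> c (Suc K)" by simp_all
  have "replicate (c (Suc K) - b (Suc (Suc K))) (Suc K) @ incremented_list b c K
      = replicate (b (Suc K) - b (Suc (Suc K))) (Suc K) @ column_list b K"
    by (rule Suc.IH) (use Suc.prems le in auto)
  then show ?case by (simp add: e replicate_add)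
qed

lemma incremented_list_eq:
  assumes "\<And>i. 1 \<le> i \<Longrightarrow> i \<le> Suc K \<Longrightarrow> c i \<le> b i \<and> b i \<le> c (i - 1)" "b 0 = c 0"
    "c (Suc K) = 0" "b (Suc (Suc K)) = 0"
  shows "incremented_list b c K = column_list b (Suc K)"
  using incremented_list_eq_aux[of K c b 0] assms by simp

lemma length_column_list:
  assumes "\<And>i. i \<le> K \<Longrightarrow> c (Suc i) \<le> c i"
  shows "length (column_list c K) = c 0 - c (Suc K) \<and> c (Suc K) \<le> c 0"
  using assms by (induction K) (auto intro: le_trans)

lemma length_incremented_list:
  assumes "\<And>i. 1 \<le> i \<Longrightarrow> i \<le> Suc K \<Longrightarrow> c i \<le> b i \<and> b i \<le> c (i - 1)"
  shows "length (incremented_list b c K) = c 0 - c (Suc K)"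
  using assms
proof (induction K)
  case 0
  from 0[of 1] show ?case by simp
next
  case (Suc K)
  have "c (Suc K) \<le> c 0"
  proof -
    have "i \<le> Suc K \<Longrightarrow> c i \<le> c 0" for i
    proof (induction i)
      case (Suc i)
      then show ?case using Suc.prems Suc_leD \<open>\<And>i. 1 \<le> i \<Longrightarrow> i \<le> Suc (Suc K) \<Longrightarrow> c i \<le> b i \<and> b i \<le> c (i - 1)\<close>[of "Suc i"] by simp
    qed simp
    then show ?thesis by simp
  qed
  then show ?case using Suc.prems[of "Suc (Suc K)"] Suc.IH Suc.prems by simp
qed

text \<open>Blocks are sorted from the smallest parts to the largest. \<open>pre\<close> holds the
  blocks on the left that are still unsorted, and the sorted remainder serves as the suffix in
  \<open>increment_sum_replicate\<close>.\<close>

lemma increment_sum_column_list: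
  fixes R :: "nat list \<Rightarrow> real"
  assumes swap: "\<And>l1 s l2. length (l1 @ [s, Suc s] @ l2) = N \<Longrightarrow>
      R (l1 @ [s, Suc s] @ l2) = q * R (l1 @ [Suc s, s] @ l2)"
    and q: "0 < q" "q < 1"
    and anti: "\<And>i. i \<le> K \<Longrightarrow> c (Suc i) \<le> c i"
    and len: "length pre + (c 0 - c (Suc K)) = N"
  shows "increment_sum (\<lambda>k l'. G k * R (pre @ l')) (column_list c K)
    = (\<Sum>b\<in>Pi_zero {1..Suc K} (\<lambda>i. {c i..c (i - 1)}).
         G (\<Sum>i=1..Suc K. b i - c i) * (\<Prod>i=1..Suc K. qbin q (c (i - 1) - c i) (b i - c i))
         * R (pre @ incremented_list b c K))"
  using anti len
proof (induction K arbitrary: G pre)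
  case 0
  have *: "(\<Sum>v\<in>{c 1..c 0}. F v) = (\<Sum>r\<le>c 0 - c 1. F (c 1 + r))" for F :: "nat \<Rightarrow> real"
    by (rule sum.reindex_bij_witness[of _ "\<lambda>r. c 1 + r" "\<lambda>v. v - c 1"]) (use 0(1)[of 0] in auto)
  have "increment_sum (\<lambda>k l'. G k * R (pre @ l' @ [])) (replicate (c 0 - c 1) 0)
     = (\<Sum>r\<le>c 0 - c 1. G r * qbin q (c 0 - c 1) r * R (pre @ replicate r (Suc 0) @ replicate (c 0 - c 1 - r) 0 @ []))"
    by (rule increment_sum_replicate[OF swap q]) (use 0(2) in auto)
  also have "\<dots> = (\<Sum>v\<in>{c 1..c 0}. G (v - c 1) * qbin q (c 0 - c 1) (v - c 1) *
      R (pre @ replicate (v - c 1) (Suc 0) @ replicate (c 0 - v) 0))"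
    unfolding * by simp
  also have "\<dots> = (\<Sum>b\<in>Pi_zero (insert 1 {}) (\<lambda>i. {c i..c (i - 1)}).
         G (\<Sum>i\<in>insert 1 {}. b i - c i) * (\<Prod>i\<in>insert 1 {}. qbin q (c (i - 1) - c i) (b i - c i))
         * R (pre @ incremented_list b c 0))"
    by (subst sum_Pi_zero_insert) simp_all
  finally show ?case by simp
next
  case (Suc K)
  let ?B = "\<lambda>i. {c i..c (i - 1)}"
  let ?P = "Pi_zero {1..Suc K} ?B"
  let ?w = "\<lambda>b. \<Prod>i=1..Suc K. qbin q (c (i - 1) - c i) (b i - c i)"
  let ?s = "\<lambda>b. \<Sum>i=1..Suc K. b i - c i"
  let ?k = "Suc (Suc K)"
  define m where "m = c (Suc K) - c ?k"
  have cK: "c (Suc K) \<le> c 0" "c ?k \<le> c (Suc K)"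
    using length_column_list[of K c] Suc.prems(1) by auto
  have "increment_sum (\<lambda>k l'. G k * R (pre @ l')) (column_list c (Suc K))
     = increment_sum (\<lambda>k1 l1'. increment_sum (\<lambda>k2 l2'. G (k1 + k2) * R ((pre @ l1') @ l2')) (column_list c K)) (replicate m (Suc K))"
    by (simp add: increment_sum_append m_def)
  also have "\<dots> = increment_sum (\<lambda>k1 l1'. \<Sum>b\<in>?P. G (k1 + ?s b) * ?w b * R ((pre @ l1') @ incremented_list b c K))
        (replicate m (Suc K))"
  proof (rule increment_sum_cong)
    fix k and l' :: "nat list" assume "length l' = length (replicate m (Suc K))"
    then have l: "length (pre @ l') + (c 0 - c (Suc K)) = N"
      using Suc.prems(2) cK by (simp add: m_def)
    show "increment_sum (\<lambda>k2 l2'. G (k + k2) * R ((pre @ l') @ l2')) (column_list c K)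
        = (\<Sum>b\<in>?P. G (k + ?s b) * ?w b * R ((pre @ l') @ incremented_list b c K))"
      by (rule Suc.IH[where G = "\<lambda>j. G (k + j)", OF _ l]) (use Suc.prems(1) in simp)
  qed
  also have "\<dots> = (\<Sum>b\<in>?P. ?w b * increment_sum (\<lambda>k l'. G (k + ?s b) * R (pre @ l' @ incremented_list b c K)) (replicate m (Suc K)))"
    unfolding increment_sum_sum by (intro sum.cong refl, subst increment_sum_cmult[symmetric]) (simp add: mult_ac)
  also have "\<dots> = (\<Sum>b\<in>?P. ?w b * (\<Sum>v\<in>{c ?k..c (Suc K)}. G ((v - c ?k) + ?s b) * qbin q m (v - c ?k) *
       R (pre @ replicate (v - c ?k) ?k @ replicate (c (Suc K) - v) (Suc K) @ incremented_list b c K)))"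
  proof (intro sum.cong refl arg_cong2[where f = "(*)"])
    fix b assume b: "b \<in> ?P"
    have "length (incremented_list b c K) = c 0 - c (Suc K)"
      by (rule length_incremented_list) (use b in \<open>auto simp: Pi_zero_def\<close>)
    then have "increment_sum (\<lambda>k l'. G (k + ?s b) * R (pre @ l' @ incremented_list b c K)) (replicate m (Suc K))
      = (\<Sum>r\<le>m. G (r + ?s b) * qbin q m r * R (pre @ replicate r ?k @ replicate (m - r) (Suc K) @ incremented_list b c K))"
      by (intro increment_sum_replicate[OF swap q, where G = "\<lambda>k. G (k + ?s b)"])
         (use Suc.prems(2) cK in \<open>simp_all add: m_def\<close>)
    also have "\<dots> = (\<Sum>v\<in>{c ?k..c (Suc K)}. G ((v - c ?k) + ?s b) * qbin q m (v - c ?k) *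
       R (pre @ replicate (v - c ?k) ?k @ replicate (c (Suc K) - v) (Suc K) @ incremented_list b c K))"
      by (rule sum.reindex_bij_witness[of _ "\<lambda>v. v - c ?k" "\<lambda>r. c ?k + r"]) (use cK in \<open>auto simp: m_def\<close>)
    finally show "increment_sum (\<lambda>k l'. G (k + ?s b) * R (pre @ l' @ incremented_list b c K)) (replicate m (Suc K)) = \<dots>" .
  qed
  also have "\<dots> = (\<Sum>v\<in>{c ?k..c (Suc K)}. \<Sum>b\<in>?P. ?w b * (G ((v - c ?k) + ?s b) * qbin q m (v - c ?k) *
       R (pre @ replicate (v - c ?k) ?k @ replicate (c (Suc K) - v) (Suc K) @ incremented_list b c K)))"
    unfolding sum_distrib_left by (rule sum.swap)
  also have "\<dots> = (\<Sum>b\<in>Pi_zero (insert ?k {1..Suc K}) ?B.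
         G (\<Sum>i\<in>insert ?k {1..Suc K}. b i - c i) * (\<Prod>i\<in>insert ?k {1..Suc K}. qbin q (c (i - 1) - c i) (b i - c i))
         * R (pre @ incremented_list b c (Suc K)))"
  proof (subst sum_Pi_zero_insert, simp, simp only: diff_Suc_1, intro sum.cong refl)
    fix v and b :: "nat \<Rightarrow> nat"
    define b' where "b' = b(?k := v)"
    have 1: "?s b' = ?s b" "?w b' = ?w b" "incremented_list b' c K = incremented_list b c K"
      by (auto simp: b'_def intro!: sum.cong prod.cong incremented_list_cong)
    have 2: "b' ?k = v" by (simp add: b'_def)
    have 3: "(\<Sum>i\<in>insert ?k {1..Suc K}. b' i - c i) = (b' ?k - c ?k) + ?s b'"
      "(\<Prod>i\<in>insert ?k {1..Suc K}. qbin q (c (i - 1) - c i) (b' i - c i)) = qbin q m (b' ?k - c ?k) * ?w b'"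
      by (simp_all add: m_def)
    show "?w b * (G ((v - c ?k) + ?s b) * qbin q m (v - c ?k) *
       R (pre @ replicate (v - c ?k) ?k @ replicate (c (Suc K) - v) (Suc K) @ incremented_list b c K))
      = G (\<Sum>i\<in>insert ?k {1..Suc K}. (b(?k := v)) i - c i) *
        (\<Prod>i\<in>insert ?k {1..Suc K}. qbin q (c (i - 1) - c i) ((b(?k := v)) i - c i)) *
        R (pre @ incremented_list (b(?k := v)) c (Suc K))"
      unfolding b'_def[symmetric] 3 1 2 incremented_list.simps by (simp add: mult_ac)
  qed
  also have "insert ?k {1..Suc K} = {1..Suc (Suc K)}" by auto
  finally show ?case .
qed


text \<open>As a function of y the product tends to 1 at infinity and has at x k a simple pole with
  residue (1 - q) x k times the other factors. The induction uses its hypothesis both at y and at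
  the newly added point x m.\<close>

lemma partial_fraction:
  fixes x :: "'i \<Rightarrow> real"
  assumes "finite S" "inj_on x S" "y \<notin> x ` S"
  shows "(\<Prod>j\<in>S. (y - q * x j) / (y - x j)) =
    1 + (1 - q) * (\<Sum>k\<in>S. x k / (y - x k) * (\<Prod>j\<in>S - {k}. (x k - q * x j) / (x k - x j)))"
  using assms
proof (induction S arbitrary: y rule: finite_induct)
  case (insert m S)
  define A where "A k = (\<Prod>j\<in>S - {k}. (x k - q * x j) / (x k - x j))" for k
  have m: "x m \<notin> x ` S" using insert by auto
  have IH: "(\<Prod>j\<in>S. (z - q * x j) / (z - x j)) = 1 + (1 - q) * (\<Sum>k\<in>S. x k / (z - x k) * A k)"
    if "z \<notin> x ` S" for z
    unfolding A_def by (rule insert.IH) (use insert that in auto)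
  have ym: "y \<noteq> x m" using insert by auto
  have Ak: "(\<Prod>j\<in>insert m S - {k}. (x k - q * x j) / (x k - x j)) = (x k - q * x m) / (x k - x m) * A k"
    if "k \<in> S" for k
  proof -
    have "insert m S - {k} = insert m (S - {k})" using that insert by auto
    then show ?thesis using insert by (simp add: A_def)
  qed
  have "(\<Sum>k\<in>insert m S. x k / (y - x k) * (\<Prod>j\<in>insert m S - {k}. (x k - q * x j) / (x k - x j)))
     = x m / (y - x m) * (\<Prod>j\<in>S. (x m - q * x j) / (x m - x j))
       + (\<Sum>k\<in>S. x k / (y - x k) * ((x k - q * x m) / (x k - x m) * A k))"
    using insert by (subst sum.insert) (auto simp: Ak)
  also have "\<dots> = x m / (y - x m) + (\<Sum>k\<in>S. ((1 - q) * x m / ((y - x m) * (x m - x k))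
        + (x k - q * x m) / ((y - x k) * (x k - x m))) * (x k * A k))"
    unfolding IH[OF m] by (simp add: distrib_left distrib_right sum.distrib sum_distrib_left mult_ac)
  also have "\<dots> = x m / (y - x m) + (\<Sum>k\<in>S. (y - q * x m) / (y - x m) * (x k / (y - x k) * A k))"
  proof (intro arg_cong2[where f = "(+)"] refl sum.cong)
    fix k assume k: "k \<in> S"
    have ne: "y \<noteq> x k" "x k \<noteq> x m" using k insert.prems(2) m by (blast, metis imageI)
    have "(1 - q) * x m / ((y - x m) * (x m - x k)) + (x k - q * x m) / ((y - x k) * (x k - x m))
       = (- ((1 - q) * x m) * (y - x k) + (x k - q * x m) * (y - x m)) / ((y - x m) * (y - x k) * (x k - x m))"
    proof -
      have "(1 - q) * x m / ((y - x m) * (x m - x k)) = - ((1 - q) * x m) / ((y - x m) * (x k - x m))"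
        by (metis minus_diff_eq minus_divide_divide mult_minus_right)
      then show ?thesis using ne ym by (simp add: divide_simps) (simp add: algebra_simps)
    qed
    also have "\<dots> = (y - q * x m) * (x k - x m) / ((y - x m) * (y - x k) * (x k - x m))"
      by (simp add: algebra_simps)
    also have "\<dots> = (y - q * x m) / ((y - x m) * (y - x k))" using ne by simp
    finally show "((1 - q) * x m / ((y - x m) * (x m - x k)) + (x k - q * x m) / ((y - x k) * (x k - x m))) * (x k * A k)
        = (y - q * x m) / (y - x m) * (x k / (y - x k) * A k)"
      by simp
  qed
  finally have sum_eq: "(\<Sum>k\<in>insert m S. x k / (y - x k) * (\<Prod>j\<in>insert m S - {k}. (x k - q * x j) / (x k - x j)))
    = x m / (y - x m) + (y - q * x m) / (y - x m) * (\<Sum>k\<in>S. x k / (y - x k) * A k)"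
    by (simp add: sum_distrib_left)
  have "(y - q * x m) / (y - x m) = 1 + (1 - q) * (x m / (y - x m))"
    using ym by (simp add: field_simps)
  moreover have "(\<Prod>j\<in>insert m S. (y - q * x j) / (y - x j))
      = (y - q * x m) / (y - x m) * (1 + (1 - q) * (\<Sum>k\<in>S. x k / (y - x k) * A k))"
    using insert IH[of y] by simp
  moreover have "L = 1 + (1 - q) * (u + t * Z)" if "t = 1 + (1 - q) * u" "L = t * (1 + (1 - q) * Z)" for L t u Z
    unfolding that by (simp add: algebra_simps)
  ultimately show ?case unfolding sum_eq by blast
qed simp

text \<open>This is the partial fraction expansion at y = 0, where every factor equals q. A
  vanishing coordinate has to be split off first: its own summand is a power of q, and in the other
  summands its factor is 1.\<close>

lemma sum_prod_ratio:
  fixes x :: "'i \<Rightarrow> real"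
  assumes "finite S" "inj_on x S" "q \<noteq> 1"
  shows "(\<Sum>k\<in>S. \<Prod>j\<in>S - {k}. (x k - q * x j) / (x k - x j)) = (1 - q ^ card S) / (1 - q)"
proof -
  have nz: "(\<Sum>k\<in>S. \<Prod>j\<in>S - {k}. (x k - q * x j) / (x k - x j)) = (1 - q ^ card S) / (1 - q)"
    if "finite S" "inj_on x S" "0 \<notin> x ` S" for S
  proof -
    have "(\<Prod>j\<in>S. (0 - q * x j) / (0 - x j)) = (\<Prod>j\<in>S. q)"
      by (rule prod.cong) (use that in auto)
    moreover have "(\<Sum>k\<in>S. x k / (0 - x k) * (\<Prod>j\<in>S - {k}. (x k - q * x j) / (x k - x j)))
        = (\<Sum>k\<in>S. - (\<Prod>j\<in>S - {k}. (x k - q * x j) / (x k - x j)))"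
      by (rule sum.cong) (use that in \<open>auto simp: divide_simps\<close>)
    ultimately have "q ^ card S = 1 + (1 - q) * (\<Sum>k\<in>S. - (\<Prod>j\<in>S - {k}. (x k - q * x j) / (x k - x j)))"
      using partial_fraction[OF that, of q] by simp
    then show ?thesis using assms(3) by (simp add: sum_negf field_simps)
  qed
  show ?thesis
  proof (cases "0 \<in> x ` S")
    case False
    then show ?thesis using nz assms by blast
  next
    case True
    then obtain m where m: "m \<in> S" "x m = 0" by auto
    define S' where "S' = S - {m}"
    have S: "S = insert m S'" "m \<notin> S'" "finite S'" using m assms by (auto simp: S'_def)
    have nz': "x j \<noteq> 0" if "j \<in> S'" for j using that m assms(2) by (auto simp: S'_def inj_on_def)
    have "(\<Sum>k\<in>S'. \<Prod>j\<in>S - {k}. (x k - q * x j) / (x k - x j)) = (\<Sum>k\<in>S'. \<Prod>j\<in>S' - {k}. (x k - q * x j) / (x k - x j))"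
    proof (intro sum.cong refl)
      fix k assume k: "k \<in> S'"
      then have "S - {k} = insert m (S' - {k})" using S by auto
      then show "(\<Prod>j\<in>S - {k}. (x k - q * x j) / (x k - x j)) = (\<Prod>j\<in>S' - {k}. (x k - q * x j) / (x k - x j))"
        using S m nz'[OF k] by simp
    qed
    also have "\<dots> = (1 - q ^ card S') / (1 - q)"
      by (rule nz) (use S assms nz' in \<open>auto simp: inj_on_def\<close>)
    finally have 1: "(\<Sum>k\<in>S'. \<Prod>j\<in>S - {k}. (x k - q * x j) / (x k - x j)) = (1 - q ^ card S') / (1 - q)" .
    have "(\<Prod>j\<in>S - {m}. (x m - q * x j) / (x m - x j)) = (\<Prod>j\<in>S'. q)"
      unfolding S'_def[symmetric] by (rule prod.cong) (use m nz' in auto)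
    then have 2: "(\<Prod>j\<in>S'. (x m - q * x j) / (x m - x j)) = q ^ card S'"
      by (simp add: S'_def)
    have "(\<Sum>k\<in>S. \<Prod>j\<in>S - {k}. (x k - q * x j) / (x k - x j)) = q ^ card S' + (1 - q ^ card S') / (1 - q)"
      unfolding sum.remove[OF assms(1) m(1)] S'_def[symmetric] 1 2 ..
    also have "\<dots> = (1 - q ^ card S) / (1 - q)"
      using S assms(3) by (simp add: field_simps)
    finally show ?thesis .
  qed
qed

fun ratio_prod :: "real \<Rightarrow> (nat \<Rightarrow> real) \<Rightarrow> nat list \<Rightarrow> real" where
  "ratio_prod q x [] = 1"
| "ratio_prod q x (a # as) = (\<Prod>b\<in>set as. (x a - q * x b) / (x a - x b)) * ratio_prod q x as"

text \<open>Choosing the first entry leaves the same sum over the remaining set, so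
  \<open>sum_prod_ratio\<close> supplies one q-integer at a time.\<close>

lemma sum_ratio_prod:
  assumes "finite S" "inj_on x S" "q \<noteq> 1"
  shows "(\<Sum>as\<in>permutations_of_set S. ratio_prod q x as) = qpoch q q (card S) / (1 - q) ^ card S"
  using assms
proof (induction "card S" arbitrary: S)
  case 0
  then show ?case by simp
next
  case (Suc n)
  then have ne: "S \<noteq> {}" by auto
  have "(\<Sum>as\<in>permutations_of_set S. ratio_prod q x as)
      = (\<Sum>a\<in>S. \<Sum>as\<in>(#) a ` permutations_of_set (S - {a}). ratio_prod q x as)"
    unfolding permutations_of_set_nonempty[OF ne]
    by (subst sum.UNION_disjoint) (use Suc.prems in auto)
  also have "\<dots> = (\<Sum>a\<in>S. (\<Prod>b\<in>S - {a}. (x a - q * x b) / (x a - x b)) * (qpoch q q n / (1 - q) ^ n))"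
  proof (intro sum.cong refl)
    fix a assume a: "a \<in> S"
    have "(\<Sum>as\<in>(#) a ` permutations_of_set (S - {a}). ratio_prod q x as)
      = (\<Sum>as\<in>permutations_of_set (S - {a}). ratio_prod q x (a # as))"
      by (subst sum.reindex) (auto simp: inj_on_def)
    also have "\<dots> = (\<Sum>as\<in>permutations_of_set (S - {a}). (\<Prod>b\<in>S - {a}. (x a - q * x b) / (x a - x b)) * ratio_prod q x as)"
      by (intro sum.cong refl) (auto dest: permutations_of_setD)
    also have "\<dots> = (\<Prod>b\<in>S - {a}. (x a - q * x b) / (x a - x b)) * (qpoch q q n / (1 - q) ^ n)"
    proof -
      have n: "n = card (S - {a})" using Suc(2) Suc.prems a by (simp add: card_Diff_singleton)
      have "(\<Sum>as\<in>permutations_of_set (S - {a}). ratio_prod q x as) = qpoch q q n / (1 - q) ^ n"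
        using Suc(1)[OF n] Suc.prems n by (simp add: inj_on_diff)
      then show ?thesis unfolding sum_distrib_left[symmetric] by simp
    qed
    finally show "(\<Sum>as\<in>(#) a ` permutations_of_set (S - {a}). ratio_prod q x as) = \<dots>" .
  qed
  also have "\<dots> = (1 - q ^ Suc n) / (1 - q) * (qpoch q q n / (1 - q) ^ n)"
    unfolding sum_distrib_right[symmetric] sum_prod_ratio[OF Suc.prems] Suc(2)[symmetric] ..
  also have "\<dots> = qpoch q q (card S) / (1 - q) ^ card S"
    unfolding Suc(2)[symmetric] by (simp add: qpoch_Suc mult.commute)
  finally show ?case .
qed

text \<open>Needed for P of the empty partition to be 1, the starting value of the later recursions:
  the symmetrised trivial monomial does not depend on the point.\<close>

lemma HL_sym_0:
  assumes "inj_on x {1..n}" "q \<noteq> 1"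
  shows "HL_sym q n (\<lambda>_. 0) x = qpoch q q n / (1 - q) ^ n"
proof -
  let ?l = "\<lambda>w. map w [1..<Suc n]"
  have rp: "ratio_prod q x as = (\<Prod>j<length as. \<Prod>i<j. (x (as ! i) - q * x (as ! j)) / (x (as ! i) - x (as ! j)))"
    if "distinct as" for as
    using that
  proof (induction as rule: rev_induct)
    case (snoc a as)
    have app: "ratio_prod q x (as @ [a]) = ratio_prod q x as * (\<Prod>b\<in>set as. (x b - q * x a) / (x b - x a))"
      if "distinct (as @ [a])" for as
      using that by (induction as) (auto simp: prod.union_disjoint mult_ac)
    have "(\<Prod>b\<in>set as. (x b - q * x a) / (x b - x a)) = (\<Prod>i<length as. (x (as ! i) - q * x a) / (x (as ! i) - x a))"
      using snoc.prems by (intro prod.reindex_bij_betw[symmetric] bij_betw_nth) auto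
    moreover have "(\<Prod>j<length as. \<Prod>i<j. (x ((as @ [a]) ! i) - q * x ((as @ [a]) ! j)) / (x ((as @ [a]) ! i) - x ((as @ [a]) ! j)))
        = (\<Prod>j<length as. \<Prod>i<j. (x (as ! i) - q * x (as ! j)) / (x (as ! i) - x (as ! j)))"
      by (intro prod.cong refl) (simp add: nth_append)
    moreover have "(\<Prod>i<length as. (x ((as @ [a]) ! i) - q * x a) / (x ((as @ [a]) ! i) - x a))
      = (\<Prod>i<length as. (x (as ! i) - q * x a) / (x (as ! i) - x a))"
      by (intro prod.cong refl) (simp add: nth_append)
    ultimately show ?case unfolding app[OF snoc.prems] using snoc by simp
  qed simp
  have img: "?l ` {w. w permutes {1..n}} \<subseteq> permutations_of_set {1..n}"
  proof
    fix l assume "l \<in> ?l ` {w. w permutes {1..n}}"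
    then obtain w where w: "w permutes {1..n}" "l = ?l w" by auto
    have "set (?l w) = {1..n}" using permutes_image[OF w(1)]
      by (simp add: atLeastLessThanSuc_atLeastAtMost del: upt_Suc)
    moreover have "distinct (?l w)" using permutes_inj_on[OF w(1)] by (simp add: distinct_map del: upt_Suc)
    ultimately show "l \<in> permutations_of_set {1..n}" using w by (intro permutations_of_setI) auto
  qed
  have inj: "inj_on ?l {w. w permutes {1..n}}"
  proof (rule inj_onI)
    fix v w assume *: "v \<in> {w. w permutes {1..n}}" "w \<in> {w. w permutes {1..n}}" "?l v = ?l w"
    show "v = w"
    proof
      fix i show "v i = w i"
      proof (cases "i \<in> {1..n}")
        case True then show ?thesis using *(3) by (auto simp del: upt_Suc)
      next
        case False then show ?thesis using *(1,2) by (simp add: permutes_def)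
      qed
    qed
  qed
  have "card (?l ` {w. w permutes {1..n}}) = card (permutations_of_set {1..n})"
    using card_image[OF inj] by (simp add: card_permutations)
  then have bij: "bij_betw ?l {w. w permutes {1..n}} (permutations_of_set {1..n})"
    unfolding bij_betw_def using card_subset_eq[OF _ img] inj by simp
  have "HL_sym q n (\<lambda>_. 0) x = (\<Sum>w | w permutes {1..n}. ratio_prod q x (?l w))"
    unfolding HL_sym_def
  proof (intro sum.cong refl)
    fix w assume "w \<in> {w. w permutes {1..n}}"
    then have "?l w \<in> permutations_of_set {1..n}" using img by blast
    then have "distinct (?l w)" by (rule permutations_of_setD)
    then have "ratio_prod q x (?l w) = (\<Prod>j<n. \<Prod>i<j. (x (?l w ! i) - q * x (?l w ! j)) / (x (?l w ! i) - x (?l w ! j)))"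
      by (subst rp) (simp_all del: upt_Suc)
    also have "\<dots> = (\<Prod>j<n. \<Prod>i<j. (x (w (Suc i)) - q * x (w (Suc j))) / (x (w (Suc i)) - x (w (Suc j))))"
      by (intro prod.cong refl) (auto simp del: upt_Suc)
    also have "\<dots> = (\<Prod>j=1..n. \<Prod>i=1..<j. (x (w i) - q * x (w j)) / (x (w i) - x (w j)))"
      by (simp add: prod.atLeast1_atMost_eq atLeastLessThanSuc_atLeastAtMost)
    finally show "(\<Prod>i=1..n. x (w i) ^ 0) * (\<Prod>j=1..n. \<Prod>i=1..<j. (x (w i) - q * x (w j)) / (x (w i) - x (w j)))
        = ratio_prod q x (?l w)" by simp
  qed
  also have "\<dots> = qpoch q q (card {1..n}) / (1 - q) ^ card {1..n}"
    unfolding sum.reindex_bij_betw[OF bij, of "ratio_prod q x"]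
    by (rule sum_ratio_prod) (use assms in auto)
  finally show ?thesis by simp
qed

text \<open>The q-factorial [m]_q!, in terms of which both \<open>HL_v\<close> and the q-binomials
  can be written.\<close>

definition qpoch_normalized :: "real \<Rightarrow> nat \<Rightarrow> real" where
  "qpoch_normalized q m = qpoch q q m / (1 - q) ^ m"

lemma qpoch_normalized_0 [simp]: "qpoch_normalized q 0 = 1"
  by (simp add: qpoch_normalized_def)

lemma qpoch_normalized_pos: "0 < q \<Longrightarrow> q < 1 \<Longrightarrow> qpoch_normalized q m > 0"
  by (simp add: qpoch_normalized_def qpoch_pos)

lemma qbin_qpoch_normalized:
  assumes "0 < q" "q < 1" "k \<le> n"
  shows "qbin q n k = qpoch_normalized q n / (qpoch_normalized q k * qpoch_normalized q (n - k))"
proof -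
  have "(1 - q) ^ n = (1 - q) ^ k * (1 - q) ^ (n - k)"
    using assms by (simp add: power_add[symmetric])
  then show ?thesis using assms by (simp add: qbin_def qpoch_normalized_def)
qed

lemma HL_v_conjugate:
  assumes "c \<in> partitions" "plength c \<le> L"
  shows "HL_v q n (conjugate c) = qpoch_normalized q (n - c 1) * (\<Prod>i=1..L. qpoch_normalized q (c i - c (Suc i)))"
proof -
  have "(\<Prod>i=1..plength c. qpoch_normalized q (c i - c (Suc i))) = (\<Prod>i=1..L. qpoch_normalized q (c i - c (Suc i)))"
    by (rule prod.mono_neutral_left) (use assms partition_eq_0[OF assms(1)] in auto)
  then show ?thesis
    using assms by (simp add: HL_v_def plength_conjugate conjugate_1 mult_conjugate qpoch_normalized_def)
qed

lemma column_list_eq_map: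
  assumes "c \<in> partitions" "c 1 \<le> n"
  shows "column_list (c(0 := n)) K = map (\<lambda>j. card {i\<in>{1..K}. j \<le> c i}) [Suc (c (Suc K))..<Suc n]"
proof (induction K)
  case 0
  have "map (\<lambda>j. card {i\<in>{1..0}. j \<le> c i}) [Suc (c 1)..<Suc n] = replicate (n - c 1) 0"
    by (simp add: map_replicate_const del: upt_Suc)
  then show ?case by (simp del: upt_Suc)
next
  case (Suc K)
  have le: "c (Suc (Suc K)) \<le> c (Suc K)" "c (Suc K) \<le> n"
    using partition_antimono[OF assms(1), of "Suc K" "Suc (Suc K)"]
      partition_antimono[OF assms(1), of 1 "Suc K"] assms(2) by auto
  have split: "[Suc (c (Suc (Suc K)))..<Suc n] = [Suc (c (Suc (Suc K)))..<Suc (c (Suc K))] @ [Suc (c (Suc K))..<Suc n]"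
    using le upt_add_eq_append[of "Suc (c (Suc (Suc K)))" "Suc (c (Suc K))" "n - c (Suc K)"] by (simp del: upt_Suc)
  have 1: "map (\<lambda>j. card {i\<in>{1..Suc K}. j \<le> c i}) [Suc (c (Suc (Suc K)))..<Suc (c (Suc K))]
      = replicate (c (Suc K) - c (Suc (Suc K))) (Suc K)"
  proof -
    have "card {i\<in>{1..Suc K}. j \<le> c i} = Suc K" if "j \<le> c (Suc K)" for j
    proof -
      have "{i\<in>{1..Suc K}. j \<le> c i} = {1..Suc K}"
        using order.trans[OF that partition_antimono[OF assms(1), of _ "Suc K"]] by auto
      then show ?thesis by simp
    qed
    then have "map (\<lambda>j. card {i\<in>{1..Suc K}. j \<le> c i}) [Suc (c (Suc (Suc K)))..<Suc (c (Suc K))]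
       = map (\<lambda>j. Suc K) [Suc (c (Suc (Suc K)))..<Suc (c (Suc K))]"
      by (intro map_cong refl) (simp del: upt_Suc)
    then show ?thesis by (simp add: map_replicate_const del: upt_Suc)
  qed
  have 2: "map (\<lambda>j. card {i\<in>{1..Suc K}. j \<le> c i}) [Suc (c (Suc K))..<Suc n]
     = map (\<lambda>j. card {i\<in>{1..K}. j \<le> c i}) [Suc (c (Suc K))..<Suc n]"
  proof (intro map_cong refl)
    fix j assume "j \<in> set [Suc (c (Suc K))..<Suc n]"
    then have "\<not> j \<le> c (Suc K)" by (simp del: upt_Suc)
    then have "{i\<in>{1..Suc K}. j \<le> c i} = {i\<in>{1..K}. j \<le> c i}" by (auto simp: le_Suc_eq)
    then show "card {i\<in>{1..Suc K}. j \<le> c i} = card {i\<in>{1..K}. j \<le> c i}" by simp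
  qed
  show ?case unfolding split map_append 1 2 using Suc by (simp del: upt_Suc)
qed

lemma HL_P_conjugate:
  assumes "c \<in> partitions" "c 1 \<le> n" "plength c \<le> K"
  shows "HL_P q (conjugate c) n x = HL_list q x (column_list (c(0 := n)) K) / HL_v q n (conjugate c)"
    and "length (column_list (c(0 := n)) K) = n"
proof -
  have cK: "c (Suc K) = 0" by (rule partition_eq_0) (use assms in auto)
  have l: "column_list (c(0 := n)) K = map (conjugate c) [1..<Suc n]"
  proof -
    have "card {i\<in>{1..K}. j \<le> c i} = conjugate c j" if "j \<ge> 1" for j
    proof -
      have "{i\<in>{1..K}. j \<le> c i} = {i. i \<ge> 1 \<and> j \<le> c i}"
        using conjugate_set_finite[OF assms(1) that] assms(3) by auto
      then show ?thesis using that by (simp add: conjugate_def)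
    qed
    then show ?thesis unfolding column_list_eq_map[OF assms(1,2)] cK
      by (simp del: upt_Suc)
  qed
  show len: "length (column_list (c(0 := n)) K) = n" unfolding l by simp
  have "HL_sym q n (conjugate c) x = HL_list q x (column_list (c(0 := n)) K)"
    unfolding HL_list_def len by (rule HL_sym_cong) (simp add: l del: upt_Suc)
  then show "HL_P q (conjugate c) n x = HL_list q x (column_list (c(0 := n)) K) / HL_v q n (conjugate c)"
    using assms by (simp add: HL_P_def plength_conjugate HL_sym_def)
qed

lemma HL_P_eq_0: "c \<in> partitions \<Longrightarrow> n < c 1 \<Longrightarrow> HL_P q (conjugate c) n x = 0"
  by (simp add: HL_P_def plength_conjugate)

lemma HL_v_pos:
  assumes "c \<in> partitions" "0 < q" "q < 1"
  shows "HL_v q n (conjugate c) > 0"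
  unfolding HL_v_conjugate[OF assms(1) order.refl] using assms qpoch_normalized_pos by (simp add: prod_pos)

lemma HL_P_empty_partition:
  assumes "inj_on x {1..n}" "0 < q" "q < 1"
  shows "HL_P q (conjugate empty_partition) n x = 1"
proof -
  have z: "conjugate empty_partition = (\<lambda>_. 0)" by (auto simp: conjugate_def empty_partition_def)
  have "plength empty_partition = 0" by (simp add: plength_def empty_partition_def)
  then have v: "HL_v q n (conjugate empty_partition) = qpoch_normalized q n"
    unfolding HL_v_conjugate[OF empty_partition_in order.refl] by (simp add: empty_partition_def)
  have "HL_P q (conjugate empty_partition) n x = 1 / HL_v q n (conjugate empty_partition) * HL_sym q n (conjugate empty_partition) x"
    unfolding HL_P_def HL_sym_def plength_conjugate[OF empty_partition_in] by (simp add: empty_partition_def)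
  also have "\<dots> = 1"
    unfolding v unfolding z using HL_sym_0[OF assms(1), of q] qpoch_pos[of q n] assms by (simp add: qpoch_normalized_def)
  finally show ?thesis .
qed


text \<open>Partitions are given by their columns: \<open>vstrip b c\<close> says that \<open>\<lambda>/\<mu>\<close> is a vertical strip for
  \<open>b = \<lambda>'\<close> and \<open>c = \<mu>'\<close>.\<close>

definition vstrip :: "(nat \<Rightarrow> nat) \<Rightarrow> (nat \<Rightarrow> nat) \<Rightarrow> bool" where
  "vstrip b c \<longleftrightarrow> (\<forall>i\<ge>1. c i \<le> b i \<and> b (Suc i) \<le> c i)"

definition HL_e :: "nat \<Rightarrow> nat \<Rightarrow> (nat \<Rightarrow> real) \<Rightarrow> real" where
  "HL_e k n x = elem_sum (\<lambda>j. if j = k then 1 else 0) (map x [1..<Suc n])"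

text \<open>The coefficient of P_lambda in P_mu e_k for b = lambda' and c = mu', a vertical strip;
  the degree k = |lambda| - |mu| is implied.\<close>

definition pieri_e :: "real \<Rightarrow> (nat \<Rightarrow> nat) \<Rightarrow> (nat \<Rightarrow> nat) \<Rightarrow> real" where
  "pieri_e q b c = (\<Prod>i=1..plength b. qbin q (b i - b (Suc i)) (b i - c i))"

text \<open>For given b the conditions on the columns of a decouple, and interlacing alone forces a
  to be a partition. Sums over strips therefore factor over columns.\<close>

lemma vstrip_eq_Pi_zero:
  assumes "b \<in> partitions" "plength b \<le> L"
  shows "{a \<in> partitions. vstrip b a} = Pi_zero {1..L} (\<lambda>i. {b (Suc i)..b i})"
proof (intro equalityI subsetI)
  fix a assume "a \<in> {a \<in> partitions. vstrip b a}"
  then have a: "a \<in> partitions" "vstrip b a" by auto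
  have "a i = 0" if "i > L" for i
    using a(2)[unfolded vstrip_def, rule_format, of i] that partition_eq_0[OF assms(1), of i] assms(2) by simp
  then show "a \<in> Pi_zero {1..L} (\<lambda>i. {b (Suc i)..b i})"
    using a partition_0[OF a(1)] by (auto simp: Pi_zero_def vstrip_def not_le)
next
  fix a assume a: "a \<in> Pi_zero {1..L} (\<lambda>i. {b (Suc i)..b i})"
  have v: "vstrip b a" unfolding vstrip_def
  proof (intro allI impI)
    fix i :: nat assume i: "i \<ge> 1"
    show "a i \<le> b i \<and> b (Suc i) \<le> a i"
      using a i partition_eq_0[OF assms(1), of "Suc i"] assms(2)
      by (cases "i \<le> L") (auto simp: Pi_zero_def)
  qed
  have "a (Suc i) \<le> a i" if "i \<ge> 1" for i
    using v that unfolding vstrip_def by (meson le_SucI le_trans)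
  moreover have "finite {i. a i \<noteq> 0}"
    by (rule finite_subset[of _ "{1..L}"]) (use a in \<open>auto simp: Pi_zero_def\<close>)
  moreover have "a 0 = 0" using a by (simp add: Pi_zero_def)
  ultimately show "a \<in> {a \<in> partitions. vstrip b a}" using v by (auto simp: partitions_def)
qed

lemma vstrip_over_eq_Pi_zero:
  assumes "c \<in> partitions" "c 1 \<le> n"
  defines "c' \<equiv> c(0 := n)"
  shows "{b \<in> partitions. vstrip b c \<and> b 1 \<le> n} = Pi_zero {1..Suc (plength c)} (\<lambda>i. {c' i..c' (i - 1)})"
proof (intro equalityI subsetI)
  fix b assume "b \<in> {b \<in> partitions. vstrip b c \<and> b 1 \<le> n}"
  then have b: "b \<in> partitions" "vstrip b c" "b 1 \<le> n" by auto
  have v: "b (Suc i) \<le> c i" if "1 \<le> i" for i using b(2) that by (auto simp: vstrip_def)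
  have "b i = 0" if "i > Suc (plength c)" for i
    using v[of "i - 1"] that partition_eq_0[OF assms(1), of "i - 1"] by simp
  moreover have "c' i \<le> b i \<and> b i \<le> c' (i - 1)" if "1 \<le> i" for i
    using b that v[of "i - 1"] by (cases "i = 1") (auto simp: c'_def vstrip_def)
  ultimately show "b \<in> Pi_zero {1..Suc (plength c)} (\<lambda>i. {c' i..c' (i - 1)})"
    using partition_0[OF b(1)] by (auto simp: Pi_zero_def not_le)
next
  fix b assume b: "b \<in> Pi_zero {1..Suc (plength c)} (\<lambda>i. {c' i..c' (i - 1)})"
  have v: "c' i \<le> b i \<and> b i \<le> c' (i - 1)" if "1 \<le> i" for i
    using b that partition_eq_0[OF assms(1), of i]
  proof (cases "i \<le> Suc (plength c)")
    case True
    then show ?thesis using b that by (auto simp: Pi_zero_def)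
  qed (auto simp: Pi_zero_def c'_def)
  have vs: "vstrip b c"
    unfolding vstrip_def
  proof (intro allI impI)
    fix i :: nat assume "i \<ge> 1"
    then show "c i \<le> b i \<and> b (Suc i) \<le> c i" using v[of i] v[of "Suc i"] by (simp add: c'_def)
  qed
  have "b 1 \<le> n" using v[of 1] by (simp add: c'_def)
  moreover have "b (Suc i) \<le> b i" if "i \<ge> 1" for i
    using vs that unfolding vstrip_def by (meson le_trans)
  moreover have "finite {i. b i \<noteq> 0}"
    by (rule finite_subset[of _ "{1..Suc (plength c)}"]) (use b in \<open>auto simp: Pi_zero_def\<close>)
  moreover have "b 0 = 0" using b by (simp add: Pi_zero_def)
  ultimately show "b \<in> {b \<in> partitions. vstrip b c \<and> b 1 \<le> n}" using vs by (auto simp: partitions_def)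
qed

lemma prod_shift_pred: "(\<Prod>i=1..Suc K. f (i - 1)) = f 0 * (\<Prod>i=1..K. f i :: real)"
proof -
  have "(\<Prod>i=1..Suc K. f (i - 1)) = (\<Prod>i<Suc K. f i)" unfolding One_nat_def prod.atLeast1_atMost_eq by simp
  also have "\<dots> = f 0 * (\<Prod>i<K. f (Suc i))" by (rule prod.lessThan_Suc_shift)
  finally show ?thesis by (simp add: prod.atLeast1_atMost_eq)
qed

text \<open>The passage from R to P. The q-factorials of the block sizes of c form
  \<open>HL_v\<close> of c, and an index shift turns those of c (i - 1) - b i into denominators of
  \<open>pieri_e\<close>. The one factor that involves n, [n - b 1]_q!, belongs to
  \<open>HL_v\<close> of b, so the coefficient is the same for every n.\<close>

lemma pieri_coeff:
  assumes q: "0 < q" "q < 1" and c: "c \<in> partitions" "c 1 \<le> n"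
    and b: "b \<in> partitions" "vstrip b c" "b 1 \<le> n"
  defines "c' \<equiv> c(0 := n)" and "K \<equiv> plength c"
  shows "(\<Prod>i=1..Suc K. qbin q (c' (i - 1) - c' i) (b i - c' i)) / HL_v q n (conjugate c)
    = pieri_e q b c / HL_v q n (conjugate b)"
proof -
  have bc: "c i \<le> b i" "b (Suc i) \<le> c i" if "1 \<le> i" for i using b(2) that by (auto simp: vstrip_def)
  have c0: "c (Suc K) = 0" by (rule partition_eq_0[OF c(1)]) (simp add: K_def)
  have b0: "b (Suc (Suc K)) = 0" using bc(2)[of "Suc K"] c0 by simp
  have pb: "plength b \<le> Suc K"
  proof (rule partition_plength_le[OF b(1)])
    fix i assume "Suc K < i"
    then show "b i = 0" using partition_antimono[OF b(1), of "Suc (Suc K)" i] b0 by simp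
  qed
  have nz: "qpoch_normalized q m \<noteq> 0" for m using qpoch_normalized_pos[OF q, of m] by simp
  have "(\<Prod>i=1..Suc K. qbin q (c' (i - 1) - c' i) (b i - c' i))
     = (\<Prod>i=1..Suc K. qpoch_normalized q (c' (i - 1) - c' i)) / ((\<Prod>i=1..Suc K. qpoch_normalized q (b i - c i)) * (\<Prod>i=1..Suc K. qpoch_normalized q (c' (i - 1) - b i)))"
    unfolding prod.distrib[symmetric] prod_dividef[symmetric]
  proof (intro prod.cong refl)
    fix i assume i: "i \<in> {1..Suc K}"
    have "b i \<le> c' (i - 1)" using bc(2)[of "i - 1"] i b(3) by (cases "i = 1") (auto simp: c'_def)
    moreover have "c i \<le> b i" "c' i = c i" using bc(1)[of i] i by (auto simp: c'_def)
    ultimately show "qbin q (c' (i - 1) - c' i) (b i - c' i)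
        = qpoch_normalized q (c' (i - 1) - c' i) / (qpoch_normalized q (b i - c i) * qpoch_normalized q (c' (i - 1) - b i))"
      by (subst qbin_qpoch_normalized[OF q]) auto
  qed
  also have "(\<Prod>i=1..Suc K. qpoch_normalized q (c' (i - 1) - c' i)) = HL_v q n (conjugate c)"
  proof -
    have "(\<Prod>i=1..Suc K. qpoch_normalized q (c' (i - 1) - c' i)) = (\<Prod>i=1..Suc K. (\<lambda>i. qpoch_normalized q (c' i - c' (Suc i))) (i - 1))"
      by (intro prod.cong refl) auto
    also have "\<dots> = qpoch_normalized q (n - c 1) * (\<Prod>i=1..K. qpoch_normalized q (c' i - c' (Suc i)))"
      using prod_shift_pred[of "\<lambda>i. qpoch_normalized q (c' i - c' (Suc i))" K] by (simp add: c'_def del: prod.cl_ivl_Suc)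
    also have "(\<Prod>i=1..K. qpoch_normalized q (c' i - c' (Suc i))) = (\<Prod>i=1..K. qpoch_normalized q (c i - c (Suc i)))"
      by (intro prod.cong refl) (auto simp: c'_def)
    finally show ?thesis unfolding HL_v_conjugate[OF c(1) order.refl] K_def .
  qed
  also have "(\<Prod>i=1..Suc K. qpoch_normalized q (c' (i - 1) - b i)) = qpoch_normalized q (n - b 1) * (\<Prod>i=1..Suc K. qpoch_normalized q (c i - b (Suc i)))"
  proof -
    have "(\<Prod>i=1..Suc K. qpoch_normalized q (c' (i - 1) - b i)) = (\<Prod>i=1..Suc K. (\<lambda>i. qpoch_normalized q (c' i - b (Suc i))) (i - 1))"
      by (intro prod.cong refl) auto
    also have "\<dots> = qpoch_normalized q (n - b 1) * (\<Prod>i=1..K. qpoch_normalized q (c' i - b (Suc i)))"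
      using prod_shift_pred[of "\<lambda>i. qpoch_normalized q (c' i - b (Suc i))" K] by (simp add: c'_def del: prod.cl_ivl_Suc)
    also have "(\<Prod>i=1..K. qpoch_normalized q (c' i - b (Suc i))) = (\<Prod>i=1..K. qpoch_normalized q (c i - b (Suc i)))"
      by (intro prod.cong refl) (auto simp: c'_def)
    also have "\<dots> = (\<Prod>i=1..Suc K. qpoch_normalized q (c i - b (Suc i)))" by (simp add: c0 b0)
    finally show ?thesis .
  qed
  finally have lhs: "(\<Prod>i=1..Suc K. qbin q (c' (i - 1) - c' i) (b i - c' i))
     = HL_v q n (conjugate c) / ((\<Prod>i=1..Suc K. qpoch_normalized q (b i - c i)) * (qpoch_normalized q (n - b 1) * (\<Prod>i=1..Suc K. qpoch_normalized q (c i - b (Suc i)))))" .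
  have "pieri_e q b c = (\<Prod>i=1..Suc K. qbin q (b i - b (Suc i)) (b i - c i))"
    unfolding pieri_e_def
  proof (rule prod.mono_neutral_left)
    show "\<forall>i\<in>{1..Suc K} - {1..plength b}. qbin q (b i - b (Suc i)) (b i - c i) = 1"
      using partition_eq_0[OF b(1)] q by auto
  qed (use pb in auto)
  also have "\<dots> = (\<Prod>i=1..Suc K. qpoch_normalized q (b i - b (Suc i))) / ((\<Prod>i=1..Suc K. qpoch_normalized q (b i - c i)) * (\<Prod>i=1..Suc K. qpoch_normalized q (c i - b (Suc i))))"
    unfolding prod.distrib[symmetric] prod_dividef[symmetric]
  proof (intro prod.cong refl)
    fix i assume i: "i \<in> {1..Suc K}"
    then show "qbin q (b i - b (Suc i)) (b i - c i) = qpoch_normalized q (b i - b (Suc i)) / (qpoch_normalized q (b i - c i) * qpoch_normalized q (c i - b (Suc i)))"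
      using bc[of i] by (subst qbin_qpoch_normalized[OF q]) auto
  qed
  finally have rhs: "pieri_e q b c = (\<Prod>i=1..Suc K. qpoch_normalized q (b i - b (Suc i))) / ((\<Prod>i=1..Suc K. qpoch_normalized q (b i - c i)) * (\<Prod>i=1..Suc K. qpoch_normalized q (c i - b (Suc i))))" .
  have P: "(\<Prod>i=1..Suc K. qpoch_normalized q (f i)) \<noteq> 0" for f using nz by (simp add: prod_zero_iff del: prod.cl_ivl_Suc)
  have gen: "v / (A * (B * C)) / v = D / (A * C) / (B * D)" if "v \<noteq> 0" "D \<noteq> 0" for v A B C D :: real
    using that by (simp add: field_simps)
  show ?thesis
    unfolding lhs rhs HL_v_conjugate[OF b(1) pb]
  proof (rule gen)
    show "HL_v q n (conjugate c) \<noteq> 0" using HL_v_pos[OF c(1) q, of n] by simp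
    show "(\<Prod>i=1..Suc K. qpoch_normalized q (b i - b (Suc i))) \<noteq> 0" by (rule P)
  qed
qed

lemma pieri:
  assumes q: "0 < q" "q < 1" and c: "c \<in> partitions" and x: "inj_on x {1..n}"
  shows "HL_e k n x * HL_P q (conjugate c) n x =
    (\<Sum>b | b \<in> partitions_of (psize c + k) \<and> vstrip b c. pieri_e q b c * HL_P q (conjugate b) n x)"
proof (cases "c 1 \<le> n")
  case False
  have "HL_P q (conjugate b) n x = 0" if "b \<in> partitions_of (psize c + k) \<and> vstrip b c" for b
    using that False by (intro HL_P_eq_0) (auto simp: partitions_of_def vstrip_def intro: less_le_trans)
  moreover have "HL_P q (conjugate c) n x = 0"
    using False c by (intro HL_P_eq_0) auto
  ultimately show ?thesis by simp
next
  case True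
  define K where "K = plength c"
  define c' where "c' = c(0 := n)"
  define G where "G j = (if j = k then 1 else 0 :: real)" for j
  let ?P = "Pi_zero {1..Suc K} (\<lambda>i. {c' i..c' (i - 1)})"
  let ?v = "HL_v q n (conjugate c)"
  have c0: "c (Suc K) = 0" by (rule partition_eq_0[OF c]) (simp add: K_def)
  have len: "length (column_list c' K) = n"
    unfolding c'_def by (rule HL_P_conjugate(2)[OF c True]) (simp add: K_def)
  have P: "?P = {b \<in> partitions. vstrip b c \<and> b 1 \<le> n}"
    unfolding c'_def K_def using vstrip_over_eq_Pi_zero[OF c True] by simp
  have finP: "finite ?P" by (rule finite_Pi_zero) auto
  have "HL_e k n x * HL_P q (conjugate c) n x = HL_e k n x * HL_list q x (column_list c' K) / ?v"
    unfolding HL_P_conjugate(1)[OF c True order.refl] c'_def K_def by simp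
  also have "HL_e k n x * HL_list q x (column_list c' K) = increment_sum (\<lambda>k l'. G k * HL_list q x l') (column_list c' K)"
    unfolding HL_e_def using elem_sum_mult_HL_list[of G x "column_list c' K" q] unfolding len G_def .
  also have "\<dots> = increment_sum (\<lambda>k l'. G k * HL_list q x ([] @ l')) (column_list c' K)" by simp
  also have "\<dots> = (\<Sum>b\<in>?P.
         G (\<Sum>i=1..Suc K. b i - c' i) * (\<Prod>i=1..Suc K. qbin q (c' (i - 1) - c' i) (b i - c' i))
         * HL_list q x ([] @ incremented_list b c' K))"
  proof (rule increment_sum_column_list[where N = n, OF _ q])
    show "HL_list q x (l1 @ [s, Suc s] @ l2) = q * HL_list q x (l1 @ [Suc s, s] @ l2)"
      if "length (l1 @ [s, Suc s] @ l2) = n" for l1 s l2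
      by (rule HL_list_swap) (use x that in simp)
    show "c' (Suc i) \<le> c' i" for i
      using partition_antimono[OF c, of 1 "Suc i"] partition_antimono[OF c, of i "Suc i"] True
      by (cases i) (auto simp: c'_def)
    show "length [] + (c' 0 - c' (Suc K)) = n" by (simp add: c'_def c0)
  qed
  also have "\<dots> / ?v = (\<Sum>b\<in>?P. G (\<Sum>i=1..Suc K. b i - c' i) * (pieri_e q b c * HL_P q (conjugate b) n x))"
    unfolding sum_divide_distrib
  proof (intro sum.cong refl)
    fix b assume b': "b \<in> ?P"
    then have b: "b \<in> partitions" "vstrip b c" "b 1 \<le> n" unfolding P by auto
    have b0: "b i = 0" if "i > Suc K" for i using b' that by (auto simp: Pi_zero_def)
    have pb: "plength b \<le> Suc K" by (rule partition_plength_le[OF b(1) b0])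
    have "incremented_list b c' K = incremented_list (b(0 := n)) c' K"
      by (rule incremented_list_cong) simp
    also have "\<dots> = column_list (b(0 := n)) (Suc K)"
    proof (rule incremented_list_eq)
      show "c' i \<le> (b(0 := n)) i \<and> (b(0 := n)) i \<le> c' (i - 1)" if "1 \<le> i" "i \<le> Suc K" for i
        using b' that by (auto simp: Pi_zero_def)
    qed (use b0 c0 in \<open>auto simp: c'_def\<close>)
    finally have l: "HL_list q x ([] @ incremented_list b c' K) = HL_v q n (conjugate b) * HL_P q (conjugate b) n x"
      using HL_P_conjugate(1)[OF b(1) b(3) pb, of q x] HL_v_pos[OF b(1) q, of n] by simp
    have "(\<Prod>i=1..Suc K. qbin q (c' (i - 1) - c' i) (b i - c' i)) / ?v
        = pieri_e q b c / HL_v q n (conjugate b)"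
      unfolding c'_def K_def by (rule pieri_coeff[OF q c True b])
    then have "(\<Prod>i=1..Suc K. qbin q (c' (i - 1) - c' i) (b i - c' i)) * HL_v q n (conjugate b) = pieri_e q b c * ?v"
      using HL_v_pos[OF b(1) q, of n] HL_v_pos[OF c q, of n] by (simp add: field_simps del: prod.cl_ivl_Suc)
    then have m: "(\<Prod>i=1..Suc K. qbin q (c' (i - 1) - c' i) (b i - c' i)) * (HL_v q n (conjugate b) * HL_P q (conjugate b) n x)
       = (pieri_e q b c * ?v) * HL_P q (conjugate b) n x" by (metis mult.assoc)
    have gen: "g * A * L / v = g * (p * P)" if "L = L'" "A * L' = (p * v) * P" "v \<noteq> 0" for g A L L' v p P :: real
    proof -
      have "g * A * L / v = g * (A * L') / v" unfolding that(1) by (simp only: mult.assoc)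
      then show ?thesis unfolding that(2) using that(3) by simp
    qed
    show "G (\<Sum>i=1..Suc K. b i - c' i) * (\<Prod>i=1..Suc K. qbin q (c' (i - 1) - c' i) (b i - c' i))
         * HL_list q x ([] @ incremented_list b c' K) / ?v
       = G (\<Sum>i=1..Suc K. b i - c' i) * (pieri_e q b c * HL_P q (conjugate b) n x)"
      using HL_v_pos[OF c q, of n] by (intro gen[OF l m]) simp
  qed
  also have "\<dots> = (\<Sum>b\<in>?P. if psize b = psize c + k then pieri_e q b c * HL_P q (conjugate b) n x else 0)"
  proof (intro sum.cong refl)
    fix b assume b': "b \<in> ?P"
    then have b: "b \<in> partitions" "vstrip b c" unfolding P by auto
    have b0: "b i = 0" if "i > Suc K" for i using b' that by (auto simp: Pi_zero_def)
    have pb: "plength b \<le> Suc K" by (rule partition_plength_le[OF b(1) b0])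
    have "(\<Sum>i=1..Suc K. c' i) = (\<Sum>i=1..Suc K. c i)"
      by (rule sum.cong) (auto simp: c'_def)
    then have pc: "(\<Sum>i=1..Suc K. c' i) = psize c"
      using psize_eq_sum[OF c, of "Suc K"] by (simp add: K_def)
    have "(\<Sum>i=1..Suc K. b i - c' i) + (\<Sum>i=1..Suc K. c' i) = (\<Sum>i=1..Suc K. b i)"
      unfolding sum.distrib[symmetric] by (rule sum.cong) (use b' in \<open>auto simp: Pi_zero_def\<close>)
    then have "(\<Sum>i=1..Suc K. b i - c' i) + psize c = psize b"
      unfolding pc psize_eq_sum[OF b(1) pb] .
    then have "(\<Sum>i=1..Suc K. b i - c' i) = k \<longleftrightarrow> psize b = psize c + k" by linarith
    then show "G (\<Sum>i=1..Suc K. b i - c' i) * (pieri_e q b c * HL_P q (conjugate b) n x)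
      = (if psize b = psize c + k then pieri_e q b c * HL_P q (conjugate b) n x else 0)"
      by (simp add: G_def del: sum.cl_ivl_Suc)
  qed
  also have "\<dots> = (\<Sum>b | b \<in> ?P \<and> psize b = psize c + k. pieri_e q b c * HL_P q (conjugate b) n x)"
    using finP by (simp add: sum.inter_filter[symmetric])
  \<comment> \<open>Strips with b 1 > n vanish in n variables, so the range of summation can be made
    independent of n.\<close>
  also have "\<dots> = (\<Sum>b | b \<in> partitions_of (psize c + k) \<and> vstrip b c. pieri_e q b c * HL_P q (conjugate b) n x)"
  proof (rule sum.mono_neutral_left)
    show "finite {b \<in> partitions_of (psize c + k). vstrip b c}" using finite_partitions_of by simp
    show "{b \<in> ?P. psize b = psize c + k} \<subseteq> {b \<in> partitions_of (psize c + k). vstrip b c}"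
      unfolding P by (auto simp: partitions_of_def)
    show "\<forall>b\<in>{b \<in> partitions_of (psize c + k). vstrip b c} - {b \<in> ?P. psize b = psize c + k}.
        pieri_e q b c * HL_P q (conjugate b) n x = 0"
      unfolding P
    proof
      fix b assume "b \<in> {b \<in> partitions_of (psize c + k). vstrip b c}
        - {b \<in> {b \<in> partitions. vstrip b c \<and> b 1 \<le> n}. psize b = psize c + k}"
      then have "HL_P q (conjugate b) n x = 0"
        by (intro HL_P_eq_0) (auto simp: partitions_of_def)
      then show "pieri_e q b c * HL_P q (conjugate b) n x = 0" by simp
    qed
  qed
  finally show ?thesis .
qed


section \<open>Inverting the Pieri rule\<close>

lemma qbin_sym: "k \<le> n \<Longrightarrow> qbin q n (n - k) = qbin q n k"
  by (simp add: qbin_def mult.commute)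

lemma qbin_Suc_Suc':
  assumes "0 < q" "q < 1"
  shows "qbin q (Suc n) (Suc k) = q ^ Suc k * qbin q n (Suc k) + qbin q n k"
proof (cases "k < n")
  case True
  then obtain j where j: "n = k + Suc j" by (metis add_Suc_right less_imp_Suc_add)
  have "qbin q (Suc n) (Suc k) = qbin q (Suc n) (Suc j)"
    using qbin_sym[of "Suc k" "Suc n" q] j by simp
  also have "\<dots> = qbin q n (Suc j) + q ^ Suc k * qbin q n j"
    using qbin_Suc_Suc[OF assms, of j n] j by simp
  also have "qbin q n (Suc j) = qbin q n k" using qbin_sym[of k n q] j by simp
  also have "qbin q n j = qbin q n (Suc k)" using qbin_sym[of "Suc k" n q] j by simp
  finally show ?thesis by simp
next
  case False
  then show ?thesis using assms by (cases "k = n") auto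
qed

text \<open>The q-binomial theorem at x = 1, a root of (x; q)_m. The proof telescopes: each partial
  sum is a single q-binomial up to sign and power, and the full one is out of range.\<close>

lemma qbin_alternating_sum:
  assumes "0 < q" "q < 1" "0 < m"
  shows "(\<Sum>j\<le>m. (- 1) ^ j * q ^ (j choose 2) * qbin q m j) = 0"
proof -
  obtain n where m: "m = Suc n" using assms(3) by (cases m) auto
  have "(\<Sum>j\<le>k. (- 1) ^ j * q ^ (j choose 2) * qbin q (Suc n) j) = (- 1) ^ k * q ^ (Suc k choose 2) * qbin q n k" for k
  proof (induction k)
    case 0
    then show ?case using assms by (simp add: numeral_2_eq_2)
  next
    case (Suc k)
    have c: "Suc (Suc k) choose 2 = (Suc k choose 2) + Suc k"
      by (simp add: numeral_2_eq_2)
    show ?case unfolding sum.atMost_Suc Suc.IH qbin_Suc_Suc'[OF assms(1,2)] c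
      by (simp add: algebra_simps power_add)
  qed
  from this[of m] show ?thesis unfolding m by simp
qed

text \<open>The coefficient of P_lambda in P_mu h_k, where h_k is the complete symmetric function of
  degree k = |lambda| - |mu|, a = lambda' and c = mu'. The lower entry
  \<open>c i - c (Suc i)\<close> is the multiplicity of i in mu.\<close>

definition skew_coeff :: "real \<Rightarrow> (nat \<Rightarrow> nat) \<Rightarrow> (nat \<Rightarrow> nat) \<Rightarrow> real" where
  "skew_coeff q a c = (if \<forall>i. c i \<le> a i then
     \<Prod>i=1..plength a. q ^ ((a i - c i) choose 2) * qbin q (a i - c (Suc i)) (c i - c (Suc i)) else 0)"

lemma skew_coeff_eq:
  assumes "0 < q" "q < 1" "a \<in> partitions" "c \<in> partitions" "plength a \<le> L" "plength c \<le> L"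
  shows "skew_coeff q a c = (\<Prod>i=1..L. if c i \<le> a i then
     q ^ ((a i - c i) choose 2) * qbin q (a i - c (Suc i)) (c i - c (Suc i)) else 0)"
proof (cases "\<forall>i. c i \<le> a i")
  case True
  have "c i = 0" if "i > plength a" for i
    using True partition_eq_0[OF assms(3) that] by (metis le_zero_eq)
  then have "(\<Prod>i=1..plength a. q ^ ((a i - c i) choose 2) * qbin q (a i - c (Suc i)) (c i - c (Suc i)))
     = (\<Prod>i=1..L. q ^ ((a i - c i) choose 2) * qbin q (a i - c (Suc i)) (c i - c (Suc i)))"
    using assms by (intro prod.mono_neutral_left) (auto simp: partition_eq_0[OF assms(3)] numeral_2_eq_2)
  then show ?thesis using True by (simp add: skew_coeff_def)
next
  case False
  then obtain i where i: "a i < c i" by (auto simp: not_le)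
  then have "i \<in> {1..L}" using partition_pos_iff[OF assms(4), of i] assms(6) by auto
  then have "(\<Prod>i=1..L. if c i \<le> a i then
     q ^ ((a i - c i) choose 2) * qbin q (a i - c (Suc i)) (c i - c (Suc i)) else 0) = 0"
    using i by (intro prod_zero) (auto simp: not_le intro!: bexI[of _ i])
  moreover have "skew_coeff q a c = 0" unfolding skew_coeff_def using False by (rule if_not_P)
  ultimately show ?thesis by simp
qed

lemma neg_one_power_diff_sum:
  assumes "\<And>i. i \<in> I \<Longrightarrow> a i \<le> b i" "finite I"
  shows "(- 1 :: real) ^ (sum b I - sum a I) = (\<Prod>i\<in>I. (- 1) ^ (b i - a i))"
  using assms by (simp add: sum_subtractf_nat[symmetric] power_sum)

text \<open>One column of the inversion. The two q-binomials are regrouped so that only one of them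
  depends on v; what remains is the alternating sum over j = v - c, with upper limit b - c >
  0.\<close>

lemma local_inversion:
  assumes q: "0 < q" "q < 1" and le: "c' \<le> c" "c < b"
  shows "(\<Sum>v\<in>{c'..b}. (- 1) ^ (b - v) * (if c \<le> v then q ^ ((v - c) choose 2) * qbin q (v - c') (c - c') else 0)
      * qbin q (b - c') (b - v)) = 0"
proof -
  have nz: "qpoch q q n \<noteq> 0" for n using qpoch_pos[OF q, of n] by simp
  have "(\<Sum>v\<in>{c'..b}. (- 1) ^ (b - v) * (if c \<le> v then q ^ ((v - c) choose 2) * qbin q (v - c') (c - c') else 0)
      * qbin q (b - c') (b - v))
    = (\<Sum>v\<in>{c..b}. (- 1) ^ (b - v) * (q ^ ((v - c) choose 2) * qbin q (v - c') (c - c')) * qbin q (b - c') (b - v))"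
    by (intro sum.mono_neutral_cong_right) (use le in auto)
  also have "\<dots> = (\<Sum>v\<in>{c..b}. (- 1) ^ (b - c) * qbin q (b - c') (c - c') * ((- 1) ^ (v - c) * q ^ ((v - c) choose 2) * qbin q (b - c) (v - c)))"
  proof (intro sum.cong refl)
    fix v assume v: "v \<in> {c..b}"
    have "(- 1 :: real) ^ (b - v) = (- 1) ^ (b - c) * (- 1) ^ (v - c)"
    proof -
      have "b - c = (b - v) + (v - c)" using v by simp
      then have "(- 1 :: real) ^ (b - c) * (- 1) ^ (v - c) = (- 1) ^ (b - v) * ((- 1) ^ (v - c) * (- 1) ^ (v - c))"
        by (simp only: power_add mult.assoc)
      then show ?thesis by (simp add: power_add[symmetric])
    qed
    moreover have "qbin q (v - c') (c - c') * qbin q (b - c') (b - v) = qbin q (b - c') (c - c') * qbin q (b - c) (v - c)"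
    proof -
      obtain s where s: "c = c' + s" using le le_Suc_ex by blast
      obtain j where j: "v = c' + s + j" using v s le_Suc_ex by auto
      obtain i where i: "b = c' + s + j + i" using v j le_Suc_ex by auto
      show ?thesis using nz by (simp add: qbin_def s j i add.assoc)
    qed
    ultimately show "(- 1) ^ (b - v) * (q ^ ((v - c) choose 2) * qbin q (v - c') (c - c')) * qbin q (b - c') (b - v)
      = (- 1) ^ (b - c) * qbin q (b - c') (c - c') * ((- 1) ^ (v - c) * q ^ ((v - c) choose 2) * qbin q (b - c) (v - c))"
      by (simp add: mult_ac)
  qed
  also have "\<dots> = (- 1) ^ (b - c) * qbin q (b - c') (c - c') * (\<Sum>v\<in>{c..b}. (- 1) ^ (v - c) * q ^ ((v - c) choose 2) * qbin q (b - c) (v - c))"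
    by (simp add: sum_distrib_left)
  also have "(\<Sum>v\<in>{c..b}. (- 1) ^ (v - c) * q ^ ((v - c) choose 2) * qbin q (b - c) (v - c))
     = (\<Sum>j\<le>b - c. (- 1) ^ j * q ^ (j choose 2) * qbin q (b - c) j)"
    by (rule sum.reindex_bij_witness[of _ "\<lambda>j. c + j" "\<lambda>v. v - c"]) (use le in auto)
  also have "\<dots> = 0" by (rule qbin_alternating_sum) (use q le in auto)
  finally show ?thesis by simp
qed

text \<open>The sum factors over columns. If c differs from b, consider the last column m where it
  does: b and c agree at m + 1, so the range of summation is the one in
  \<open>local_inversion\<close>, and this factor is 0.\<close>

lemma skew_inversion:
  assumes q: "0 < q" "q < 1" and b: "b \<in> partitions" and c: "c \<in> partitions"
  shows "(\<Sum>a | a \<in> partitions \<and> vstrip b a. (- 1) ^ (psize b - psize a) * skew_coeff q a c * pieri_e q b a)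
    = (if b = c then 1 else 0)"
proof (cases "\<forall>i. c i \<le> b i")
  case False
  have "skew_coeff q a c = 0" if "vstrip b a" "a \<in> partitions" for a
  proof -
    obtain i where i: "b i < c i" using False by (auto simp: not_le)
    then have "i \<ge> 1" using partition_pos_iff[OF c, of i] by simp
    then have "a i < c i" using i that unfolding vstrip_def by (meson le_less_trans)
    then have "\<not> (\<forall>i. c i \<le> a i)" by (auto simp: not_le)
    then show ?thesis unfolding skew_coeff_def by (rule if_not_P)
  qed
  then show ?thesis using False by (auto intro!: sum.neutral)
next
  case True
  define L where "L = plength b"
  have b0: "b i = 0" if "i > L" for i using partition_eq_0[OF b] that by (simp add: L_def)
  have pc: "plength c \<le> L" by (rule partition_plength_le[OF c]) (metis True b0 le_zero_eq)
  let ?B = "\<lambda>i. {b (Suc i)..b i}"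
  define F where "F i v = (- 1) ^ (b i - v) * (if c i \<le> v then
     q ^ ((v - c i) choose 2) * qbin q (v - c (Suc i)) (c i - c (Suc i)) else 0) * qbin q (b i - b (Suc i)) (b i - v)" for i v
  have "(\<Sum>a | a \<in> partitions \<and> vstrip b a. (- 1) ^ (psize b - psize a) * skew_coeff q a c * pieri_e q b a)
     = (\<Sum>a\<in>Pi_zero {1..L} ?B. \<Prod>i\<in>{1..L}. F i (a i))"
    unfolding vstrip_eq_Pi_zero[OF b order.refl, folded L_def, symmetric]
  proof (intro sum.cong refl)
    fix a assume a: "a \<in> {a \<in> partitions. vstrip b a}"
    have pa: "plength a \<le> L"
      using a vstrip_eq_Pi_zero[OF b order.refl, folded L_def] by (intro partition_plength_le) (auto simp: Pi_zero_def)
    have "(- 1 :: real) ^ (psize b - psize a) = (\<Prod>i=1..L. (- 1) ^ (b i - a i))"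
    proof -
      have "a i \<le> b i" if "i \<in> {1..L}" for i using a that by (auto simp: vstrip_def)
      then have "(- 1 :: real) ^ (sum b {1..L} - sum a {1..L}) = (\<Prod>i=1..L. (- 1) ^ (b i - a i))"
        by (intro neg_one_power_diff_sum) auto
      then show ?thesis using psize_eq_sum[OF b, of L] psize_eq_sum[of a L] a pa by (simp add: L_def)
    qed
    moreover have "skew_coeff q a c = (\<Prod>i=1..L. if c i \<le> a i then
         q ^ ((a i - c i) choose 2) * qbin q (a i - c (Suc i)) (c i - c (Suc i)) else 0)"
      by (rule skew_coeff_eq) (use q c a pa pc in auto)
    moreover have "pieri_e q b a = (\<Prod>i=1..L. qbin q (b i - b (Suc i)) (b i - a i))"
      by (simp add: pieri_e_def L_def)
    ultimately show "(- 1) ^ (psize b - psize a) * skew_coeff q a c * pieri_e q b a = (\<Prod>i\<in>{1..L}. F i (a i))"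
      by (simp only: F_def prod.distrib)
  qed
  also have "\<dots> = (\<Prod>i\<in>{1..L}. \<Sum>v\<in>?B i. F i v)" by (rule prod_sum_Pi_zero) simp
  also have "\<dots> = (if b = c then 1 else 0)"
  proof (cases "b = c")
    case True
    have "(\<Sum>v\<in>?B i. F i v) = 1" if "i \<in> {1..L}" for i
    proof -
      have le: "b (Suc i) \<le> b i" using partition_antimono[OF b, of i "Suc i"] that by simp
      have "(\<Sum>v\<in>?B i. F i v) = (\<Sum>v\<in>{b i}. F i v)"
        by (rule sum.mono_neutral_right) (use le in \<open>auto simp: F_def True\<close>)
      also have "\<dots> = 1" using q by (simp add: F_def True numeral_2_eq_2)
      finally show ?thesis .
    qed
    then show ?thesis using True by simp
  next
    case False
    let ?S = "{i. b i \<noteq> c i}"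
    have fin: "finite ?S"
    proof (rule finite_subset[of _ "{..L}"])
      have "c i = 0 \<and> b i = 0" if "L < i" for i using b0[OF that] True by (metis le_zero_eq)
      then show "?S \<subseteq> {..L}" by (metis (mono_tags, lifting) atMost_iff linorder_not_less mem_Collect_eq subsetI)
    qed simp
    moreover have "?S \<noteq> {}" using False by auto
    ultimately have mS: "Max ?S \<in> ?S" by (rule Max_in)
    define m where "m = Max ?S"
    have m: "b m \<noteq> c m" using mS by (simp add: m_def)
    have eq: "b (Suc m) = c (Suc m)"
      using Max_ge[OF fin, of "Suc m"] by (auto simp: m_def)
    have lt: "c m < b m" using m True by (metis le_neq_implies_less)
    then have mL: "m \<in> {1..L}" using partition_pos_iff[OF b, of m] by (simp add: L_def)
    have "(\<Sum>v\<in>?B m. F m v) = 0"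
      unfolding F_def eq
      by (rule local_inversion[OF q _ lt]) (use partition_antimono[OF c, of m "Suc m"] mL in simp)
    then show ?thesis using False mL by (intro trans[OF prod_zero]) auto
  qed
  finally show ?thesis .
qed

text \<open>For empty c this is the sum of q^(n(nu)) P_nu over |nu| = k, that is, h_k.\<close>

definition skew_sum :: "real \<Rightarrow> nat \<Rightarrow> (nat \<Rightarrow> nat) \<Rightarrow> nat \<Rightarrow> (nat \<Rightarrow> real) \<Rightarrow> real" where
  "skew_sum q k c n x = (\<Sum>a\<in>partitions_of (psize c + k). skew_coeff q a c * HL_P q (conjugate a) n x)"

lemma psize_mono:
  assumes "c \<in> partitions" "a \<in> partitions" "\<And>i. c i \<le> a i"
  shows "psize c \<le> psize a"
proof -
  have "plength c \<le> plength a"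
    using assms by (intro partition_plength_le[OF assms(1)]) (metis le_zero_eq partition_eq_0)
  then show ?thesis
    using psize_eq_sum[OF assms(1), of "plength a"] psize_eq_sum[OF assms(2) order.refl] assms(3)
    by (simp add: sum_mono)
qed

lemma vstrip_psize_le:
  assumes "vstrip b a" "a \<in> partitions" "b \<in> partitions"
  shows "psize a \<le> psize b"
  by (rule psize_mono[OF assms(2,3)])
     (metis assms(1) assms(2) partition_0 vstrip_def le0 not_less_eq_eq One_nat_def le_zero_eq)

text \<open>The relation between the e_j and the h_k, multiplied by P_mu. Expanding every e_j by
  Pieri's rule and collecting the coefficient of a fixed P_b leaves the sum of
  \<open>skew_inversion\<close>.\<close>

lemma skew_sum_rec:
  assumes q: "0 < q" "q < 1" and c: "c \<in> partitions" and x: "inj_on x {1..n}"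
  shows "(\<Sum>j\<le>k. (- 1) ^ j * HL_e j n x * skew_sum q (k - j) c n x) = (if k = 0 then HL_P q (conjugate c) n x else 0)"
proof -
  let ?P = "\<lambda>b. HL_P q (conjugate b) n x"
  let ?N = "psize c + k"
  let ?t = "\<lambda>b a. (- 1) ^ (psize b - psize a) * skew_coeff q a c * pieri_e q b a"
  let ?A = "\<lambda>b. {a \<in> partitions. vstrip b a}"
  have finA: "finite (?A b)" if "b \<in> partitions" for b
    unfolding vstrip_eq_Pi_zero[OF that order.refl] by (rule finite_Pi_zero) auto
  have "(\<Sum>j\<le>k. (- 1) ^ j * HL_e j n x * skew_sum q (k - j) c n x)
     = (\<Sum>j\<le>k. \<Sum>a\<in>partitions_of (psize c + (k - j)). \<Sum>b | b \<in> partitions_of ?N \<and> vstrip b a. ?t b a * ?P b)"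
  proof (intro sum.cong refl)
    fix j assume j: "j \<in> {..k}"
    have "(- 1) ^ j * HL_e j n x * skew_sum q (k - j) c n x
      = (\<Sum>a\<in>partitions_of (psize c + (k - j)). (- 1) ^ j * skew_coeff q a c * (HL_e j n x * ?P a))"
      unfolding skew_sum_def sum_distrib_left by (simp add: mult_ac)
    also have "\<dots> = (\<Sum>a\<in>partitions_of (psize c + (k - j)). \<Sum>b | b \<in> partitions_of ?N \<and> vstrip b a. ?t b a * ?P b)"
    proof (intro sum.cong refl)
      fix a assume a: "a \<in> partitions_of (psize c + (k - j))"
      then have ap: "a \<in> partitions" and N: "psize a + j = ?N" using j by (auto simp: partitions_of_def)
      have "(- 1) ^ j * skew_coeff q a c * (HL_e j n x * ?P a)
         = (\<Sum>b | b \<in> partitions_of ?N \<and> vstrip b a. (- 1) ^ j * skew_coeff q a c * (pieri_e q b a * ?P b))"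
        unfolding pieri[OF q ap x] N sum_distrib_left ..
      also have "\<dots> = (\<Sum>b | b \<in> partitions_of ?N \<and> vstrip b a. ?t b a * ?P b)"
      proof (intro sum.cong refl)
        fix b assume "b \<in> {b. b \<in> partitions_of ?N \<and> vstrip b a}"
        then have "psize b - psize a = j" using N by (auto simp: partitions_of_def)
        then show "(- 1) ^ j * skew_coeff q a c * (pieri_e q b a * ?P b) = ?t b a * ?P b" by simp
      qed
      finally show "(- 1) ^ j * skew_coeff q a c * (HL_e j n x * ?P a) = \<dots>" .
    qed
    finally show "(- 1) ^ j * HL_e j n x * skew_sum q (k - j) c n x = \<dots>" .
  qed
  also have "\<dots> = (\<Sum>j\<le>k. \<Sum>b\<in>partitions_of ?N. \<Sum>a | a \<in> partitions_of (psize c + (k - j)) \<and> vstrip b a. ?t b a * ?P b)"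
    by (intro sum.cong refl sum.swap_restrict finite_partitions_of)
  also have "\<dots> = (\<Sum>b\<in>partitions_of ?N. \<Sum>j\<le>k. \<Sum>a | a \<in> partitions_of (psize c + (k - j)) \<and> vstrip b a. ?t b a * ?P b)"
    by (rule sum.swap)
  also have "\<dots> = (\<Sum>b\<in>partitions_of ?N. (if b = c then 1 else 0) * ?P b)"
  proof (intro sum.cong refl)
    fix b assume b': "b \<in> partitions_of ?N"
    then have b: "b \<in> partitions" and pb: "psize b = ?N" by (auto simp: partitions_of_def)
    \<comment> \<open>Grouping by size reaches only those a that are at least as large as c; for
      smaller a the coefficient \<open>skew_coeff q a c\<close> is 0, so the sum extends to all
      strips.\<close>
    let ?S = "{a \<in> ?A b. psize c \<le> psize a}"
    have "(\<Sum>j\<le>k. \<Sum>a | a \<in> partitions_of (psize c + (k - j)) \<and> vstrip b a. ?t b a * ?P b)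
       = (\<Sum>j\<le>k. \<Sum>a | a \<in> ?S \<and> psize b - psize a = j. ?t b a * ?P b)"
    proof (intro sum.cong refl)
      fix j assume "j \<in> {..k}"
      then show "{a. a \<in> partitions_of (psize c + (k - j)) \<and> vstrip b a} = {a. a \<in> ?S \<and> psize b - psize a = j}"
        using pb vstrip_psize_le[of b] b by (fastforce simp: partitions_of_def)
    qed
    also have "\<dots> = (\<Sum>a\<in>?S. ?t b a * ?P b)"
    proof (rule sum.group)
      show "finite ?S" by (rule finite_subset[OF _ finA[OF b]]) auto
    qed (use pb in auto)
    also have "\<dots> = (\<Sum>a\<in>?A b. ?t b a * ?P b)"
    proof (rule sum.mono_neutral_left)
      show "\<forall>a\<in>?A b - ?S. ?t b a * ?P b = 0"
        using psize_mono[OF c] by (auto simp: skew_coeff_def)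
    qed (use finA[OF b] in auto)
    also have "\<dots> = (if b = c then 1 else 0) * ?P b"
      unfolding sum_distrib_right[symmetric] skew_inversion[OF q b c] ..
    finally show "(\<Sum>j\<le>k. \<Sum>a | a \<in> partitions_of (psize c + (k - j)) \<and> vstrip b a. ?t b a * ?P b) = \<dots>" .
  qed
  also have "\<dots> = (\<Sum>b\<in>partitions_of ?N. if c = b then ?P b else 0)"
    by (intro sum.cong refl) auto
  also have "\<dots> = (if c \<in> partitions_of ?N then ?P c else 0)"
    by (simp add: finite_partitions_of)
  also have "\<dots> = (if k = 0 then ?P c else 0)" using c by (simp add: partitions_of_def)
  finally show ?thesis .
qed

lemma HL_e_0: "HL_e 0 n x = 1"
proof -
  have "elem_sum (\<lambda>j. 0) ys = 0" for ys by (induction ys) auto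
  then have "elem_sum (\<lambda>j. if j = 0 then 1 else 0) ys = 1" for ys
    by (induction ys) auto
  then show ?thesis unfolding HL_e_def .
qed

text \<open>Both sides solve the same triangular recursion in \<open>k\<close>.\<close>

lemma skew_sum_eq_mult:
  assumes q: "0 < q" "q < 1" and c: "c \<in> partitions" and x: "inj_on x {1..n}"
  shows "skew_sum q k c n x = HL_P q (conjugate c) n x * skew_sum q k empty_partition n x"
proof (induction k rule: less_induct)
  case (less k)
  let ?P = "HL_P q (conjugate c) n x"
  have split: "(\<Sum>j\<le>k. f j) = f 0 + (\<Sum>j=1..k. f j)" for f :: "nat \<Rightarrow> real"
    by (simp add: atMost_atLeast0 sum.atLeast_Suc_atMost)
  have 1: "skew_sum q k d n x = (if k = 0 then HL_P q (conjugate d) n x else 0)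
      - (\<Sum>j=1..k. (- 1) ^ j * HL_e j n x * skew_sum q (k - j) d n x)" if "d \<in> partitions" for d
    using skew_sum_rec[OF q that x, of k] unfolding split by (simp add: HL_e_0)
  have "(\<Sum>j=1..k. (- 1) ^ j * HL_e j n x * skew_sum q (k - j) c n x)
     = ?P * (\<Sum>j=1..k. (- 1) ^ j * HL_e j n x * skew_sum q (k - j) empty_partition n x)"
    unfolding sum_distrib_left
  proof (intro sum.cong refl)
    fix j assume "j \<in> {1..k}"
    then have "skew_sum q (k - j) c n x = ?P * skew_sum q (k - j) empty_partition n x" by (intro less) auto
    then show "(- 1) ^ j * HL_e j n x * skew_sum q (k - j) c n x
        = ?P * ((- 1) ^ j * HL_e j n x * skew_sum q (k - j) empty_partition n x)" by simp
  qed
  then show ?case unfolding 1[OF c] 1[OF empty_partition_in] HL_P_empty_partition[OF x q] by (simp add: algebra_simps)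
qed


section \<open>Linear independence\<close>

lemma digit_expansion_unique:
  fixes d e :: "nat \<Rightarrow> nat"
  assumes "\<And>j. j < n \<Longrightarrow> d j < M" "\<And>j. j < n \<Longrightarrow> e j < M"
    "(\<Sum>j<n. d j * M ^ j) = (\<Sum>j<n. e j * M ^ j)" "j < n"
  shows "d j = e j"
  using assms
proof (induction n arbitrary: d e j)
  case (Suc n)
  have split: "(\<Sum>j<Suc n. f j * M ^ j) = f 0 + M * (\<Sum>j<n. f (Suc j) * M ^ j)" for f
    by (subst sum.lessThan_Suc_shift) (simp add: sum_distrib_left mult_ac)
  have eq: "d 0 + M * (\<Sum>j<n. d (Suc j) * M ^ j) = e 0 + M * (\<Sum>j<n. e (Suc j) * M ^ j)"
    using Suc.prems(3) unfolding split .
  have M: "d 0 < M" "e 0 < M" using Suc.prems(1,2) by auto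
  have "d 0 = e 0" using arg_cong[OF eq, of "\<lambda>t. t mod M"] M by simp
  then have "(\<Sum>j<n. d (Suc j) * M ^ j) = (\<Sum>j<n. e (Suc j) * M ^ j)"
    using eq M by simp
  then have "d (Suc i) = e (Suc i)" if "i < n" for i
    using Suc.IH[of "\<lambda>j. d (Suc j)" "\<lambda>j. e (Suc j)" i] Suc.prems(1,2) that by simp
  then show ?case using Suc.prems(4) \<open>d 0 = e 0\<close> by (cases j) simp_all
qed simp

lemma tendsto_power_quotient_0:
  assumes "b < a"
  shows "((\<lambda>T::real. T ^ b / T ^ a) \<longlongrightarrow> 0) at_top"
proof -
  have "((\<lambda>T::real. inverse (T ^ (a - b))) \<longlongrightarrow> 0) at_top"
    by (rule tendsto_inverse_0_at_top) (use assms in \<open>auto intro!: filterlim_pow_at_top filterlim_ident\<close>)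
  moreover have "\<forall>\<^sub>F T in at_top. inverse (T ^ (a - b)) = (T::real) ^ b / T ^ a"
    using eventually_gt_at_top[of 0]
  proof eventually_elim
    case (elim T)
    have "T ^ a = T ^ b * T ^ (a - b)" using assms by (simp add: power_add[symmetric])
    then show ?case using elim by (simp add: field_simps)
  qed
  ultimately show ?thesis by (rule Lim_transform_eventually)
qed

lemma tendsto_ratio:
  assumes "a \<noteq> b"
  shows "((\<lambda>T::real. (T ^ a - q * T ^ b) / (T ^ a - T ^ b)) \<longlongrightarrow> (if b < a then 1 else q)) at_top"
proof (cases "b < a")
  case True
  have "((\<lambda>T::real. (1 - q * (T ^ b / T ^ a)) / (1 - T ^ b / T ^ a)) \<longlongrightarrow> (1 - q * 0) / (1 - 0)) at_top"
    by (intro tendsto_intros tendsto_power_quotient_0 True) auto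
  moreover have "\<forall>\<^sub>F T in at_top. (1 - q * (T ^ b / T ^ a)) / (1 - T ^ b / T ^ a) = (T ^ a - q * T ^ b) / ((T::real) ^ a - T ^ b)"
    using eventually_gt_at_top[of 0]
  proof eventually_elim
    case (elim T)
    then have "T ^ a \<noteq> 0" by simp
    then have "1 - q * (T ^ b / T ^ a) = (T ^ a - q * T ^ b) / T ^ a" "1 - T ^ b / T ^ a = (T ^ a - T ^ b) / T ^ a"
      by (simp_all add: diff_divide_distrib)
    then show ?case using \<open>T ^ a \<noteq> 0\<close> by simp
  qed
  ultimately show ?thesis using True by (auto intro: Lim_transform_eventually)
next
  case False
  then have lt: "a < b" using assms by simp
  have "((\<lambda>T::real. (T ^ a / T ^ b - q) / (T ^ a / T ^ b - 1)) \<longlongrightarrow> (0 - q) / (0 - 1)) at_top"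
    by (intro tendsto_intros tendsto_power_quotient_0 lt) auto
  moreover have "\<forall>\<^sub>F T in at_top. (T ^ a / T ^ b - q) / (T ^ a / T ^ b - 1) = (T ^ a - q * T ^ b) / ((T::real) ^ a - T ^ b)"
    using eventually_gt_at_top[of 0]
  proof eventually_elim
    case (elim T)
    then have "T ^ b \<noteq> 0" by simp
    then have "T ^ a / T ^ b - q = (T ^ a - q * T ^ b) / T ^ b" "T ^ a / T ^ b - 1 = (T ^ a - T ^ b) / T ^ b"
      by (simp_all add: diff_divide_distrib)
    then show ?case using \<open>T ^ b \<noteq> 0\<close> by simp
  qed
  ultimately show ?thesis using False by (auto intro: Lim_transform_eventually)
qed

text \<open>The columns count the parts of size at least i, and such counts are blind to
  reordering.\<close>

lemma partition_eq_if_permuted: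
  assumes "c \<in> partitions" "d \<in> partitions" "plength c \<le> n" "plength d \<le> n"
    and "bij_betw \<sigma> {1..n} {1..n}" and "\<And>i. i \<in> {1..n} \<Longrightarrow> c i = d (\<sigma> i)"
  shows "c = d"
proof -
  have "conjugate c i = conjugate d i" if "i \<ge> 1" for i
  proof -
    have 1: "{j. 1 \<le> j \<and> i \<le> e j} = {j\<in>{1..n}. i \<le> e j}" if "e \<in> partitions" "plength e \<le> n" for e
      using conjugate_set_finite[OF that(1) \<open>i \<ge> 1\<close>] that(2) by auto
    have "bij_betw \<sigma> {j\<in>{1..n}. i \<le> c j} {j\<in>{1..n}. i \<le> d j}"
    proof -
      have "\<sigma> ` {j\<in>{1..n}. i \<le> c j} = {j\<in>{1..n}. i \<le> d j}"
      proof (intro equalityI subsetI)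
        fix k assume "k \<in> \<sigma> ` {j\<in>{1..n}. i \<le> c j}"
        then obtain j where j: "j \<in> {1..n}" "i \<le> c j" "k = \<sigma> j" by blast
        then show "k \<in> {j\<in>{1..n}. i \<le> d j}"
          using assms(6)[OF j(1)] bij_betwE[OF assms(5)] by simp
      next
        fix k assume k: "k \<in> {j\<in>{1..n}. i \<le> d j}"
        then have "k \<in> \<sigma> ` {1..n}" using assms(5) unfolding bij_betw_def by blast
        then obtain j where j: "j \<in> {1..n}" "k = \<sigma> j" by blast
        then show "k \<in> \<sigma> ` {j\<in>{1..n}. i \<le> c j}" using assms(6)[OF j(1)] k by auto
      qed
      then show ?thesis using assms(5) unfolding bij_betw_def by (auto intro: inj_on_subset)
    qed
    then show ?thesis
      using that bij_betw_same_card unfolding conjugate_def 1[OF assms(1,3)] 1[OF assms(2,4)] by auto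
  qed
  then have "conjugate c = conjugate d" by (auto simp: fun_eq_iff conjugate_def)
  then show ?thesis by (metis assms(1,2) conjugate_conjugate)
qed

text \<open>Independence is read off from the fastest growing monomial along the curve
  \<open>x\<^sub>i = T ^ (M ^ (n - i))\<close>, \<open>T \<rightarrow> \<infinity>\<close>: for \<open>M\<close> exceeding all parts, distinct exponent vectors
  give distinct powers of \<open>T\<close>.\<close>

lemma HL_P_independent:
  assumes q: "0 < q" "q < 1" and A: "finite A" "A \<subseteq> partitions"
    and zero: "\<And>n x. inj_on x {1..n} \<Longrightarrow> (\<Sum>la\<in>A. g la * HL_P q la n x) = 0"
  shows "\<forall>la\<in>A. g la = 0"
proof (rule ccontr)
  assume nz: "\<not> (\<forall>la\<in>A. g la = 0)"
  define B where "B = {la \<in> A. g la \<noteq> 0}"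
  have B: "finite B" "B \<noteq> {}" "B \<subseteq> partitions" using A nz by (auto simp: B_def)
  \<comment> \<open>Enough variables that no member of B is cut off by the length condition in
    \<open>HL_P\<close>.\<close>
  define n where "n = Max (plength ` B)"
  \<comment> \<open>Every part is a digit in base M; adding 2 also ensures M > 1 when all parts are
    0, so that the exponents y i stay distinct.\<close>
  define M where "M = Max ((\<lambda>la. la 1) ` B) + 2"
  have n: "plength la \<le> n" if "la \<in> B" for la using that B by (simp add: n_def)
  have M: "la i < M" if "la \<in> B" for la i
  proof -
    have "la i \<le> la 1"
      using partition_antimono[of la 1 i] partition_0[of la] that B by (cases "i = 0") auto
    moreover have "la 1 \<le> Max ((\<lambda>la. la 1) ` B)" using that B by (intro Max_ge) auto
    ultimately show ?thesis by (simp add: M_def)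
  qed
  have M2: "M \<ge> 2" by (simp add: M_def)
  define y where "y i = M ^ (n - i)" for i
  have y_inj: "y i = y j \<longleftrightarrow> i = j" if "i \<in> {1..n}" "j \<in> {1..n}" for i j
    using M2 that by (auto simp: y_def power_inject_exp)
  let ?W = "{w. w permutes {1..n}}"
  have finW: "finite ?W" by (simp add: finite_permutations)
  define N where "N la w = (\<Sum>i=1..n. la i * y (w i))" for la w
  define m where "m = Max ((\<lambda>(la, w). N la w) ` (B \<times> ?W))"
  have finBW: "finite (B \<times> ?W)" "B \<times> ?W \<noteq> {}" using B finW permutes_id by blast+
  have Nm: "N la w \<le> m" if "la \<in> B" "w \<in> ?W" for la w
    unfolding m_def by (rule Max_ge) (use finBW that in auto)
  obtain la0 w0 where la0: "la0 \<in> B" "w0 \<in> ?W" "N la0 w0 = m"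
  proof -
    have "m \<in> (\<lambda>(la, w). N la w) ` (B \<times> ?W)" unfolding m_def by (rule Max_in) (use finBW in auto)
    then show thesis using that by auto
  qed
  \<comment> \<open>The base-M digits of N la w are the parts of la in the order prescribed by w, so
    they determine la, though not w when parts repeat.\<close>
  have uniq: "la = la0" if "la \<in> B" "w \<in> ?W" "N la w = m" for la w
  proof -
    have Neq: "N ka v = (\<Sum>j<n. ka (inv v (n - j)) * M ^ j)" if "v \<in> ?W" for ka v
    proof -
      have v: "v permutes {1..n}" using that by simp
      have "N ka v = (\<Sum>i=1..n. ka (inv v (v i)) * y (v i))"
        unfolding N_def using permutes_inverses(2)[OF v] by simp
      also have "\<dots> = (\<Sum>k=1..n. ka (inv v k) * y k)"
        by (rule sum.permute[OF v, of "\<lambda>k. ka (inv v k) * y k", unfolded o_def, symmetric])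
      also have "\<dots> = (\<Sum>j<n. ka (inv v (n - j)) * M ^ j)"
        by (rule sum.reindex_bij_witness[of _ "\<lambda>j. n - j" "\<lambda>k. n - k"]) (auto simp: y_def)
      finally show ?thesis .
    qed
    have dig: "la (inv w (n - j)) = la0 (inv w0 (n - j))" if "j < n" for j
      using digit_expansion_unique[of n "\<lambda>j. la (inv w (n - j))" M "\<lambda>j. la0 (inv w0 (n - j))" j]
        Neq[of w la] Neq[of w0 la0] \<open>la \<in> B\<close> \<open>w \<in> ?W\<close> \<open>N la w = m\<close> la0 M that by simp
    have w: "w permutes {1..n}" "w0 permutes {1..n}" using that la0 by auto
    have eq: "la i = la0 (inv w0 (w i))" if "i \<in> {1..n}" for i
    proof -
      have wi: "w i \<in> {1..n}" using permutes_in_image[OF w(1)] that by blast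
      then show ?thesis using dig[of "n - w i"] permutes_inverses(2)[OF w(1)] by simp
    qed
    have "bij_betw (\<lambda>i. inv w0 (w i)) {1..n} {1..n}"
      using permutes_imp_bij[OF permutes_compose[OF w(1) permutes_inv[OF w(2)]]] by (simp add: o_def)
    then show ?thesis
      by (rule partition_eq_if_permuted[of la la0 n, rotated 4]) (use eq B that la0 n in auto)
  qed
  define x where "x T i = T ^ y i" for T :: real and i
  define h where "h T w = (\<Prod>j=1..n. \<Prod>i=1..<j. (x T (w i) - q * x T (w j)) / (x T (w i) - x T (w j)))" for T w
  define L where "L w = (\<Prod>j=1..n. \<Prod>i=1..<j. if y (w j) < y (w i) then 1 else q)" for w
  have hL: "((\<lambda>T. h T w) \<longlongrightarrow> L w) at_top" if "w \<in> ?W" for w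
    unfolding h_def L_def x_def
  proof (intro tendsto_prod tendsto_ratio)
    fix j i assume ij: "j \<in> {1..n}" "i \<in> {1..<j}"
    have w: "w permutes {1..n}" using that by simp
    have "w i \<in> {1..n}" "w j \<in> {1..n}" using permutes_in_image[OF w] ij by auto
    moreover have "w i \<noteq> w j" using permutes_inj[OF w] ij by (metis atLeastLessThan_iff injD less_irrefl)
    ultimately show "y (w i) \<noteq> y (w j)" using y_inj by simp
  qed
  \<comment> \<open>Several permutations can attain the top exponent. Their limits are all positive,
    so their contributions cannot cancel.\<close>
  have Lpos: "L w > 0" for w unfolding L_def using q by (intro prod_pos) auto
  have HL: "HL_P q la n (x T) / T ^ m = 1 / HL_v q n la * (\<Sum>w\<in>?W. T ^ N la w / T ^ m * h T w)"
    if "la \<in> B" for la T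
  proof -
    have "(\<Prod>i=1..n. x T (w i) ^ la i) = T ^ N la w" for w
      by (simp add: x_def N_def power_sum power_mult[symmetric] mult.commute)
    then show ?thesis using n[OF that]
      by (simp add: HL_P_def h_def sum_divide_distrib[symmetric])
  qed
  have lim: "((\<lambda>T. \<Sum>la\<in>B. g la * (1 / HL_v q n la * (\<Sum>w\<in>?W. T ^ N la w / T ^ m * h T w)))
      \<longlongrightarrow> (\<Sum>la\<in>B. g la * (1 / HL_v q n la * (\<Sum>w\<in>?W. (if N la w = m then 1 else 0) * L w)))) at_top"
  proof (intro tendsto_sum tendsto_mult tendsto_const hL)
    fix la w assume *: "la \<in> B" "w \<in> ?W"
    show "((\<lambda>T::real. T ^ N la w / T ^ m) \<longlongrightarrow> (if N la w = m then 1 else 0)) at_top"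
    proof (cases "N la w = m")
      case True
      have "\<forall>\<^sub>F T::real in at_top. 1 = T ^ N la w / T ^ m"
        using eventually_gt_at_top[of 0] by eventually_elim (simp add: True)
      then show ?thesis using True by (auto intro: Lim_transform_eventually[OF tendsto_const])
    next
      case False
      then show ?thesis using tendsto_power_quotient_0[of "N la w" m] Nm[OF *] by simp
    qed
  qed
  have "\<forall>\<^sub>F T in at_top. (\<Sum>la\<in>B. g la * (1 / HL_v q n la * (\<Sum>w\<in>?W. T ^ N la w / T ^ m * h T w))) = 0"
    using eventually_gt_at_top[of 1]
  proof eventually_elim
    case (elim T)
    have "inj_on (x T) {1..n}"
      using elim by (auto simp: inj_on_def x_def power_inject_exp y_inj)
    from zero[OF this] have "(\<Sum>la\<in>B. g la * HL_P q la n (x T)) = 0"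
      using A(1) by (subst sum.mono_neutral_left[of A B]) (auto simp: B_def)
    then have "(\<Sum>la\<in>B. g la * HL_P q la n (x T)) / T ^ m = 0" by simp
    then have "(\<Sum>la\<in>B. g la * (HL_P q la n (x T) / T ^ m)) = 0" by (simp add: sum_divide_distrib)
    then show ?case using HL by simp
  qed
  then have "(\<Sum>la\<in>B. g la * (1 / HL_v q n la * (\<Sum>w\<in>?W. (if N la w = m then 1 else 0) * L w))) = 0"
    using lim tendsto_unique[OF _ lim tendsto_eventually] by simp
  also have "(\<Sum>la\<in>B. g la * (1 / HL_v q n la * (\<Sum>w\<in>?W. (if N la w = m then 1 else 0) * L w)))
     = (\<Sum>la\<in>{la0}. g la * (1 / HL_v q n la * (\<Sum>w\<in>?W. (if N la w = m then 1 else 0) * L w)))"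
  proof (rule sum.mono_neutral_right)
    show "\<forall>la\<in>B - {la0}. g la * (1 / HL_v q n la * (\<Sum>w\<in>?W. (if N la w = m then 1 else 0) * L w)) = 0"
    proof
      fix la assume la: "la \<in> B - {la0}"
      then have "(\<Sum>w\<in>?W. (if N la w = m then 1 else 0) * L w) = 0"
        using uniq by (intro sum.neutral) auto
      then show "g la * (1 / HL_v q n la * (\<Sum>w\<in>?W. (if N la w = m then 1 else 0) * L w)) = 0" by simp
    qed
  qed (use B la0 in auto)
  finally have "g la0 * (1 / HL_v q n la0 * (\<Sum>w\<in>?W. (if N la0 w = m then 1 else 0) * L w)) = 0" by simp
  moreover have "(\<Sum>w\<in>?W. (if N la0 w = m then 1 else 0) * L w) > 0"
    by (rule sum_pos2[OF finW la0(2)]) (use Lpos la0 less_imp_le[OF Lpos] in auto)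
  moreover have "HL_v q n la0 > 0"
    using HL_v_pos[of "conjugate la0" q n] q la0(1) B conjugate_conjugate conjugate_in_partitions by (metis subsetD)
  moreover have "g la0 \<noteq> 0" using la0 by (simp add: B_def)
  ultimately show False by simp
qed


section \<open>Structure constants\<close>

text \<open>F stands for a homogeneous symmetric function of degree d, known only through its
  values. The coefficients are chosen before n and x, which is what makes the expansion an identity
  in infinitely many variables.\<close>

definition HL_multiplier :: "real \<Rightarrow> nat \<Rightarrow> (nat \<Rightarrow> (nat \<Rightarrow> real) \<Rightarrow> real) \<Rightarrow> bool" where
  "HL_multiplier q d F \<longleftrightarrow> (\<forall>c\<in>partitions. \<exists>f. \<forall>n x. inj_on x {1..n} \<longrightarrow>
     F n x * HL_P q (conjugate c) n x = (\<Sum>a\<in>partitions_of (psize c + d). f a * HL_P q (conjugate a) n x))"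

lemma HL_multiplier_cong:
  assumes "HL_multiplier q d F" "\<And>n x. inj_on x {1..n} \<Longrightarrow> F n x = F' n x"
  shows "HL_multiplier q d F'"
  using assms unfolding HL_multiplier_def by simp

lemma HL_multiplier_mult:
  assumes F: "HL_multiplier q d F" and G: "HL_multiplier q d' G"
  shows "HL_multiplier q (d + d') (\<lambda>n x. F n x * G n x)"
  unfolding HL_multiplier_def
proof
  fix c assume c: "c \<in> partitions"
  obtain f where f: "\<And>n x. inj_on x {1..n} \<Longrightarrow> G n x * HL_P q (conjugate c) n x
      = (\<Sum>a\<in>partitions_of (psize c + d'). f a * HL_P q (conjugate a) n x)"
    using G c unfolding HL_multiplier_def by blast
  obtain h where "\<forall>a\<in>partitions. \<forall>n x. inj_on x {1..n} \<longrightarrow> F n x * HL_P q (conjugate a) n x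
      = (\<Sum>b\<in>partitions_of (psize a + d). h a b * HL_P q (conjugate b) n x)"
    using bchoice[OF F[unfolded HL_multiplier_def]] by blast
  then have h: "F n x * HL_P q (conjugate a) n x
      = (\<Sum>b\<in>partitions_of (psize a + d). h a b * HL_P q (conjugate b) n x)"
    if "a \<in> partitions" "inj_on x {1..n}" for a n x using that by blast
  let ?A = "partitions_of (psize c + d')" and ?B = "partitions_of (psize c + (d + d'))"
  have "F n x * G n x * HL_P q (conjugate c) n x = (\<Sum>b\<in>?B. (\<Sum>a\<in>?A. f a * h a b) * HL_P q (conjugate b) n x)"
    if x: "inj_on x {1..n}" for n x
  proof -
    have "F n x * G n x * HL_P q (conjugate c) n x = (\<Sum>a\<in>?A. f a * (F n x * HL_P q (conjugate a) n x))"
      using f[OF x] by (simp add: mult_ac sum_distrib_left)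
    also have "\<dots> = (\<Sum>a\<in>?A. f a * (\<Sum>b\<in>?B. h a b * HL_P q (conjugate b) n x))"
    proof (intro sum.cong refl)
      fix a assume "a \<in> ?A"
      then have a: "a \<in> partitions" "psize a + d = psize c + (d + d')" by (auto simp: partitions_of_def)
      show "f a * (F n x * HL_P q (conjugate a) n x) = f a * (\<Sum>b\<in>?B. h a b * HL_P q (conjugate b) n x)"
        unfolding h[OF a(1) x] a(2) ..
    qed
    also have "\<dots> = (\<Sum>a\<in>?A. \<Sum>b\<in>?B. f a * h a b * HL_P q (conjugate b) n x)"
      by (simp add: sum_distrib_left mult_ac)
    also have "\<dots> = (\<Sum>b\<in>?B. (\<Sum>a\<in>?A. f a * h a b) * HL_P q (conjugate b) n x)"
      by (subst sum.swap) (simp add: sum_distrib_right)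
    finally show ?thesis .
  qed
  then show "\<exists>f. \<forall>n x. inj_on x {1..n} \<longrightarrow> F n x * G n x * HL_P q (conjugate c) n x
      = (\<Sum>a\<in>?B. f a * HL_P q (conjugate a) n x)"
    by (intro exI[of _ "\<lambda>b. \<Sum>a\<in>?A. f a * h a b"]) blast
qed

lemma HL_multiplier_diff:
  assumes F: "HL_multiplier q d F" and G: "\<And>i. i \<in> J \<Longrightarrow> HL_multiplier q d (G i)"
  shows "HL_multiplier q d (\<lambda>n x. F n x - (\<Sum>i\<in>J. k i * G i n x))"
  unfolding HL_multiplier_def
proof
  fix c assume c: "c \<in> partitions"
  obtain f where f: "\<And>n x. inj_on x {1..n} \<Longrightarrow> F n x * HL_P q (conjugate c) n x
      = (\<Sum>a\<in>partitions_of (psize c + d). f a * HL_P q (conjugate a) n x)"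
    using F c unfolding HL_multiplier_def by blast
  have "\<forall>i\<in>J. \<exists>h. \<forall>n x. inj_on x {1..n} \<longrightarrow> G i n x * HL_P q (conjugate c) n x
      = (\<Sum>b\<in>partitions_of (psize c + d). h b * HL_P q (conjugate b) n x)"
    using G c unfolding HL_multiplier_def by blast
  from bchoice[OF this] obtain h where "\<forall>i\<in>J. \<forall>n x. inj_on x {1..n} \<longrightarrow> G i n x * HL_P q (conjugate c) n x
      = (\<Sum>b\<in>partitions_of (psize c + d). h i b * HL_P q (conjugate b) n x)"
    by blast
  then have h: "G i n x * HL_P q (conjugate c) n x
      = (\<Sum>b\<in>partitions_of (psize c + d). h i b * HL_P q (conjugate b) n x)"
    if "i \<in> J" "inj_on x {1..n}" for i n x using that by blast
  let ?A = "partitions_of (psize c + d)"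
  have "(F n x - (\<Sum>i\<in>J. k i * G i n x)) * HL_P q (conjugate c) n x
      = (\<Sum>a\<in>?A. (f a - (\<Sum>i\<in>J. k i * h i a)) * HL_P q (conjugate a) n x)"
    if x: "inj_on x {1..n}" for n x
  proof -
    have "(\<Sum>i\<in>J. k i * G i n x) * HL_P q (conjugate c) n x = (\<Sum>i\<in>J. k i * (G i n x * HL_P q (conjugate c) n x))"
      unfolding sum_distrib_right by (simp add: mult.assoc)
    also have "\<dots> = (\<Sum>i\<in>J. k i * (\<Sum>b\<in>?A. h i b * HL_P q (conjugate b) n x))"
      using h[OF _ x] by simp
    also have "\<dots> = (\<Sum>i\<in>J. \<Sum>b\<in>?A. k i * h i b * HL_P q (conjugate b) n x)"
      by (simp add: sum_distrib_left mult_ac)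
    also have "\<dots> = (\<Sum>b\<in>?A. (\<Sum>i\<in>J. k i * h i b) * HL_P q (conjugate b) n x)"
      by (subst sum.swap) (simp add: sum_distrib_right)
    finally have "(\<Sum>i\<in>J. k i * G i n x) * HL_P q (conjugate c) n x
      = (\<Sum>b\<in>?A. (\<Sum>i\<in>J. k i * h i b) * HL_P q (conjugate b) n x)" .
    then show ?thesis using f[OF x] by (simp add: left_diff_distrib sum_subtractf)
  qed
  then show "\<exists>f. \<forall>n x. inj_on x {1..n} \<longrightarrow> (F n x - (\<Sum>i\<in>J. k i * G i n x)) * HL_P q (conjugate c) n x
      = (\<Sum>a\<in>?A. f a * HL_P q (conjugate a) n x)"
    by (intro exI[of _ "\<lambda>a. f a - (\<Sum>i\<in>J. k i * h i a)"]) blast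
qed

lemma HL_multiplier_1: "HL_multiplier q 0 (\<lambda>n x. 1)"
  unfolding HL_multiplier_def
proof
  fix c assume c: "c \<in> partitions"
  let ?f = "\<lambda>a. if c = a then 1 else 0 :: real"
  have "1 * HL_P q (conjugate c) n x = (\<Sum>a\<in>partitions_of (psize c + 0). ?f a * HL_P q (conjugate a) n x)" for n x
  proof -
    have "(\<Sum>a\<in>partitions_of (psize c + 0). ?f a * HL_P q (conjugate a) n x)
       = (\<Sum>a\<in>partitions_of (psize c). if c = a then HL_P q (conjugate a) n x else 0)"
      by (intro sum.cong) auto
    then show ?thesis using c finite_partitions_of[of "psize c"] by (simp add: partitions_of_def)
  qed
  then show "\<exists>f. \<forall>n x. inj_on x {1..n} \<longrightarrow> 1 * HL_P q (conjugate c) n x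
      = (\<Sum>a\<in>partitions_of (psize c + 0). f a * HL_P q (conjugate a) n x)"
    by (intro exI[of _ ?f]) blast
qed

lemma HL_multiplier_e:
  assumes "0 < q" "q < 1"
  shows "HL_multiplier q k (HL_e k)"
  unfolding HL_multiplier_def
proof
  fix c assume c: "c \<in> partitions"
  let ?f = "\<lambda>b. if vstrip b c then pieri_e q b c else 0"
  have "HL_e k n x * HL_P q (conjugate c) n x = (\<Sum>b\<in>partitions_of (psize c + k). ?f b * HL_P q (conjugate b) n x)"
    if "inj_on x {1..n}" for n x
    unfolding pieri[OF assms c that]
    by (rule sum.mono_neutral_cong_left) (auto simp: finite_partitions_of)
  then show "\<exists>f. \<forall>n x. inj_on x {1..n} \<longrightarrow> HL_e k n x * HL_P q (conjugate c) n x
     = (\<Sum>b\<in>partitions_of (psize c + k). f b * HL_P q (conjugate b) n x)"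
    by (intro exI[of _ ?f]) blast
qed

text \<open>Pieri's rule for \<open>e\<^sub>m\<close>, where \<open>m\<close> is the last column of \<open>b\<close>, expresses \<open>P\<^sub>b\<close> through smaller
  partitions.\<close>

lemma HL_multiplier_P:
  assumes q: "0 < q" "q < 1" and b: "b \<in> partitions"
  shows "HL_multiplier q (psize b) (HL_P q (conjugate b))"
  using b
\<comment> \<open>Lexicographic in size, number of columns and height of the last column: deleting
  the last column lowers the size, while the competing terms of Pieri's rule keep it and are smaller
  in the other two.\<close>
proof (induction b rule: wf_induct_rule[OF wf_measures[of "[psize, plength, \<lambda>b. b (plength b)]"]])
  case (1 b)
  note b = \<open>b \<in> partitions\<close>
  define k where "k = plength b"
  show ?case
  proof (cases "k = 0")
    case True
    have "b i = 0" for i using partition_pos_iff[OF b, of i] True by (auto simp: k_def)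
    then have z: "b = empty_partition" by (simp add: empty_partition_def fun_eq_iff)
    have "psize b = 0" unfolding z using partitions_of_0 by (auto simp: partitions_of_def)
    then show ?thesis
      unfolding z using HL_multiplier_cong[OF HL_multiplier_1] HL_P_empty_partition[OF _ q] by simp
  next
    case False
    define m where "m = b k"
    define c where "c = b(k := 0)"
    have bk: "b i = 0" if "i > k" for i using partition_eq_0[OF b] that by (simp add: k_def)
    have m0: "m > 0" using partition_pos_iff[OF b, of k] False by (simp add: m_def k_def)
    have c: "c \<in> partitions"
    proof -
      have "finite {i. c i \<noteq> 0}"
      proof (rule finite_subset[of _ "{..k}"])
        have "c i = 0" if "k < i" for i using bk[OF that] by (simp add: c_def)
        then show "{i. c i \<noteq> 0} \<subseteq> {..k}" by (metis (mono_tags, lifting) atMost_iff linorder_not_less mem_Collect_eq subsetI)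
      qed simp
      moreover have "c (Suc i) \<le> c i" if "i \<ge> 1" for i
        using partition_antimono[OF b that, of "Suc i"] bk[of "Suc i"] by (auto simp: c_def)
      ultimately show ?thesis using partition_0[OF b] by (auto simp: partitions_def c_def)
    qed
    have pc: "plength c \<le> k"
      by (rule partition_plength_le[OF c]) (use bk in \<open>auto simp: c_def\<close>)
    obtain k' where k': "k = Suc k'" using False by (cases k) auto
    have size: "psize b = psize c + m"
    proof -
      have "(\<Sum>i=1..k'. c i) = (\<Sum>i=1..k'. b i)" by (rule sum.cong) (auto simp: c_def k')
      then have "(\<Sum>i=1..k. b i) = (\<Sum>i=1..k. c i) + m" by (simp add: k' c_def m_def)
      then show ?thesis using psize_eq_sum[OF b, of k] psize_eq_sum[OF c pc] by (simp add: k_def)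
    qed
    have vb: "vstrip b c"
      unfolding vstrip_def
    proof (intro allI impI)
      fix i :: nat assume "i \<ge> 1"
      then show "c i \<le> b i \<and> b (Suc i) \<le> c i"
        using partition_antimono[OF b, of i "Suc i"] bk[of "Suc i"] by (auto simp: c_def)
    qed
    \<comment> \<open>Off column k the strip is empty, and column k is taken whole with nothing
      after it, so each q-binomial has lower entry 0 or equal entries.\<close>
    have coeff: "pieri_e q b c = 1"
      unfolding pieri_e_def
      by (rule prod.neutral) (use q bk[of "Suc k"] in \<open>auto simp: c_def k_def\<close>)
    let ?S = "{b' \<in> partitions_of (psize b). vstrip b' c}"
    have fin: "finite ?S" using finite_partitions_of by simp
    have small: "(b', b) \<in> measures [psize, plength, \<lambda>b. b (plength b)]" "b' \<in> partitions" "psize b' = psize b"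
      if "b' \<in> ?S - {b}" for b'
    proof -
      have b': "b' \<in> partitions" "psize b' = psize b" "vstrip b' c" "b' \<noteq> b" using that by (auto simp: partitions_of_def)
      show "b' \<in> partitions" "psize b' = psize b" by fact+
      have z': "b' i = 0" if "i > k" for i
      proof -
        have "b' (Suc (i - 1)) \<le> c (i - 1)" using b'(3)[unfolded vstrip_def, rule_format, of "i - 1"] that False by simp
        moreover have "c (i - 1) = 0" using that bk[of "i - 1"] by (auto simp: c_def)
        ultimately show ?thesis using that by simp
      qed
      have pk: "plength b' \<le> k" by (rule partition_plength_le[OF b'(1) z'])
      have ge: "b i \<le> b' i" if "i \<in> {1..k'}" for i
        using b'(3) that by (auto simp: vstrip_def c_def k')
      have sums: "(\<Sum>i=1..k'. b' i) + b' k = (\<Sum>i=1..k'. b i) + b k"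
        using psize_eq_sum[OF b'(1) pk] psize_eq_sum[OF b, of k] b'(2) by (simp add: k_def[symmetric] k')
      have "(\<Sum>i=1..k'. b i) \<le> (\<Sum>i=1..k'. b' i)" by (rule sum_mono) (rule ge)
      \<comment> \<open>The columns before k can only grow and the total is fixed, so column k
        shrinks unless \<open>b'\<close> is b.\<close>
      have "b' k < b k"
      proof (rule ccontr)
        assume "\<not> b' k < b k"
        then have e: "b' k = b k" "(\<Sum>i=1..k'. b' i) = (\<Sum>i=1..k'. b i)"
          using sums \<open>(\<Sum>i=1..k'. b i) \<le> (\<Sum>i=1..k'. b' i)\<close> by auto
        have "b' i = b i" if "i \<in> {1..k'}" for i
        proof (rule ccontr)
          assume "b' i \<noteq> b i"
          then have "b i < b' i" using ge[OF that] by simp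
          then have "(\<Sum>i=1..k'. b i) < (\<Sum>i=1..k'. b' i)"
            using ge that by (intro sum_strict_mono_ex1) auto
          then show False using e by simp
        qed
        then have "b' i = b i" for i
          using e(1) z'[of i] bk[of i] partition_0[OF b] partition_0[OF b'(1)]
          by (cases "i = 0"; cases "i = k"; cases "i > k") (auto simp: k')
        then show False using b'(4) by auto
      qed
      then show "(b', b) \<in> measures [psize, plength, \<lambda>b. b (plength b)]"
        using b'(2) pk by (auto simp: k_def[symmetric] le_less)
    qed
    have "HL_multiplier q (psize b) (\<lambda>n x. HL_e m n x * HL_P q (conjugate c) n x
        - (\<Sum>b'\<in>?S - {b}. pieri_e q b' c * HL_P q (conjugate b') n x))"
    proof (rule HL_multiplier_diff)
      have "HL_multiplier q (psize c) (HL_P q (conjugate c))"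
        by (rule 1(1)) (use size m0 c in auto)
      from HL_multiplier_mult[OF HL_multiplier_e[OF q] this, of m]
      show "HL_multiplier q (psize b) (\<lambda>n x. HL_e m n x * HL_P q (conjugate c) n x)"
        by (simp add: size add.commute)
      show "HL_multiplier q (psize b) (HL_P q (conjugate b'))" if "b' \<in> ?S - {b}" for b'
        using 1(1)[OF small(1,2)[OF that]] small(3)[OF that] by simp
    qed
    then show ?thesis
    proof (rule HL_multiplier_cong)
      fix n and x :: "nat \<Rightarrow> real" assume x: "inj_on x {1..n}"
      have "HL_e m n x * HL_P q (conjugate c) n x = (\<Sum>b'\<in>?S. pieri_e q b' c * HL_P q (conjugate b') n x)"
        unfolding pieri[OF q c x] size ..
      also have "\<dots> = HL_P q (conjugate b) n x + (\<Sum>b'\<in>?S - {b}. pieri_e q b' c * HL_P q (conjugate b') n x)"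
        by (subst sum.remove[OF fin, of b]) (use vb b coeff in \<open>auto simp: partitions_of_def\<close>)
      finally show "HL_e m n x * HL_P q (conjugate c) n x
        - (\<Sum>b'\<in>?S - {b}. pieri_e q b' c * HL_P q (conjugate b') n x) = HL_P q (conjugate b) n x" by simp
    qed
  qed
qed

lemma HL_b_conjugate:
  "c \<in> partitions \<Longrightarrow> HL_b q (conjugate c) = (\<Prod>i=1..plength c. qpoch q q (c i - c (Suc i)))"
  by (simp add: HL_b_def conjugate_1 mult_conjugate)

lemma HL_b_pos: "0 < q \<Longrightarrow> q < 1 \<Longrightarrow> HL_b q la > 0"
  unfolding HL_b_def by (intro prod_pos ballI qpoch_pos)

lemma sum_partitions_of_conjugate: "(\<Sum>a\<in>partitions_of N. f (conjugate a)) = (\<Sum>la\<in>partitions_of N. f la)"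
  by (rule sum.reindex_bij_betw[OF bij_conjugate_of])

text \<open>This unfolds the definite description: the product expansion, rescaled from P to Q,
  provides a candidate, and independence of the P_lambda excludes any other.\<close>

lemma HL_g_props:
  assumes q: "0 < q" "q < 1" and mu: "mu \<in> partitions" and nu: "nu \<in> partitions"
  shows "HL_g q mu nu la \<noteq> 0 \<Longrightarrow> la \<in> partitions_of (psize mu + psize nu)"
    and "inj_on x {1..n} \<Longrightarrow> HL_Q q mu n x * HL_Q q nu n x
      = (\<Sum>la\<in>partitions_of (psize mu + psize nu). HL_g q mu nu la * HL_Q q la n x)"
proof -
  let ?N = "psize mu + psize nu"
  let ?prop = "\<lambda>g. {la. g la \<noteq> 0} \<subseteq> partitions \<and> finite {la. g la \<noteq> 0} \<and>
     (\<forall>n x. inj_on x {1..n} \<longrightarrow>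
        HL_Q q mu n x * HL_Q q nu n x = (\<Sum>la | g la \<noteq> 0. g la * HL_Q q la n x))"
  define c d where "c = conjugate mu" and "d = conjugate nu"
  have cd: "c \<in> partitions" "d \<in> partitions" "conjugate c = mu" "conjugate d = nu" "psize c = psize mu" "psize d = psize nu"
    using mu nu by (simp_all add: c_def d_def conjugate_conjugate conjugate_in_partitions psize_conjugate)
  have bn: "HL_b q la \<noteq> 0" for la using HL_b_pos[OF q, of la] by simp
  obtain f where "\<forall>n x. inj_on x {1..n} \<longrightarrow> HL_P q nu n x * HL_P q mu n x
      = (\<Sum>a\<in>partitions_of ?N. f a * HL_P q (conjugate a) n x)"
    using bspec[OF HL_multiplier_P[OF q cd(2), unfolded HL_multiplier_def] cd(1)] unfolding cd by blast
  then have f: "HL_P q mu n x * HL_P q nu n x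
      = (\<Sum>a\<in>partitions_of ?N. f a * HL_P q (conjugate a) n x)" if "inj_on x {1..n}" for n x
    using that by (simp add: mult.commute)
  define g where "g la = (if la \<in> partitions_of ?N then f (conjugate la) * HL_b q mu * HL_b q nu / HL_b q la else 0)" for la
  have supp: "{la. g la \<noteq> 0} \<subseteq> partitions_of ?N" by (auto simp: g_def)
  have g1: "HL_Q q mu n x * HL_Q q nu n x = (\<Sum>la\<in>partitions_of ?N. g la * HL_Q q la n x)"
    if x: "inj_on x {1..n}" for n x
  proof -
    have "HL_Q q mu n x * HL_Q q nu n x = HL_b q mu * HL_b q nu * (HL_P q mu n x * HL_P q nu n x)"
      by (simp add: HL_Q_def)
    also have "HL_P q mu n x * HL_P q nu n x = (\<Sum>a\<in>partitions_of ?N. f (conjugate (conjugate a)) * HL_P q (conjugate a) n x)"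
      unfolding f[OF x] by (intro sum.cong refl) (auto simp: partitions_of_def conjugate_conjugate)
    also have "\<dots> = (\<Sum>la\<in>partitions_of ?N. f (conjugate la) * HL_P q la n x)"
      by (rule sum_partitions_of_conjugate)
    also have "HL_b q mu * HL_b q nu * \<dots> = (\<Sum>la\<in>partitions_of ?N. g la * HL_Q q la n x)"
      unfolding sum_distrib_left
    proof (intro sum.cong refl)
      fix la assume "la \<in> partitions_of ?N"
      then show "HL_b q mu * HL_b q nu * (f (conjugate la) * HL_P q la n x) = g la * HL_Q q la n x"
        using bn[of la] by (simp add: g_def HL_Q_def)
    qed
    finally show ?thesis .
  qed
  have g2: "(\<Sum>la | g la \<noteq> 0. g la * HL_Q q la n x) = (\<Sum>la\<in>partitions_of ?N. g la * HL_Q q la n x)" for n x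
    by (rule sum.mono_neutral_left) (use supp in \<open>auto simp: finite_partitions_of\<close>)
  have gprop: "?prop g"
    using supp g1 g2 finite_subset[OF supp finite_partitions_of] by (auto simp: partitions_of_def)
  have "g' = g" if g': "?prop g'" for g'
  proof -
    define A where "A = {la. g la \<noteq> 0} \<union> {la. g' la \<noteq> 0}"
    have A: "finite A" "A \<subseteq> partitions" using gprop g' by (auto simp: A_def)
    have "\<forall>la\<in>A. (g la - g' la) * HL_b q la = 0"
    proof (rule HL_P_independent[OF q A])
      fix n and x :: "nat \<Rightarrow> real" assume x: "inj_on x {1..n}"
      have 1: "(\<Sum>la\<in>A. h la * HL_Q q la n x) = (\<Sum>la | h la \<noteq> 0. h la * HL_Q q la n x)"
        if "{la. h la \<noteq> 0} \<subseteq> A" for h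
        by (rule sum.mono_neutral_right) (use A that in auto)
      have "(\<Sum>la\<in>A. (g la - g' la) * HL_b q la * HL_P q la n x)
         = (\<Sum>la\<in>A. g la * HL_Q q la n x) - (\<Sum>la\<in>A. g' la * HL_Q q la n x)"
        by (simp add: HL_Q_def left_diff_distrib sum_subtractf mult.assoc)
      also have "(\<Sum>la\<in>A. g la * HL_Q q la n x) = HL_Q q mu n x * HL_Q q nu n x"
        unfolding g1[OF x] g2[symmetric] by (rule 1) (auto simp: A_def)
      also have "(\<Sum>la\<in>A. g' la * HL_Q q la n x) = HL_Q q mu n x * HL_Q q nu n x"
        using g' x by (subst 1) (auto simp: A_def)
      also have "HL_Q q mu n x * HL_Q q nu n x - HL_Q q mu n x * HL_Q q nu n x = 0" by simp
      finally show "(\<Sum>la\<in>A. (g la - g' la) * HL_b q la * HL_P q la n x) = 0" .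
    qed
    then have eq: "g la = g' la" if "la \<in> A" for la using bn that by simp
    show ?thesis
    proof
      fix la show "g' la = g la"
      proof (cases "la \<in> A")
        case True
        then show ?thesis using eq by simp
      qed (simp add: A_def)
    qed
  qed
  then have "HL_g q mu nu = g"
    unfolding HL_g_def using gprop by (intro the_equality) auto
  then show "HL_g q mu nu la \<noteq> 0 \<Longrightarrow> la \<in> partitions_of ?N"
    "inj_on x {1..n} \<Longrightarrow> HL_Q q mu n x * HL_Q q nu n x = (\<Sum>la\<in>partitions_of ?N. HL_g q mu nu la * HL_Q q la n x)"
    using supp g1 by auto
qed

text \<open>Two expansions of Q_mu h_k are compared: the direct one by \<open>skew_coeff\<close>,
  and the one through the structure constants after writing h_k as the sum of q^(n(nu)) Q_nu /
  b_nu.\<close>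

lemma HL_g_skew_coeff:
  assumes q: "0 < q" "q < 1" and c: "c \<in> partitions" and a: "a \<in> partitions_of (psize c + k)"
  shows "(\<Sum>d\<in>partitions_of k. skew_coeff q d empty_partition * (HL_g q (conjugate c) (conjugate d) (conjugate a) / HL_b q (conjugate d)))
    = skew_coeff q a c * HL_b q (conjugate c) / HL_b q (conjugate a)"
proof -
  have bn: "HL_b q la \<noteq> 0" for la using HL_b_pos[OF q, of la] by simp
  let ?N = "psize c + k"
  let ?g = "\<lambda>d. HL_g q (conjugate c) (conjugate d)"
  let ?h = "\<lambda>la. (\<Sum>d\<in>partitions_of k. skew_coeff q d empty_partition * (?g d la / HL_b q (conjugate d))) * HL_b q la
      - skew_coeff q (conjugate la) c * HL_b q (conjugate c)"
  have "\<forall>la\<in>partitions_of ?N. ?h la = 0"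
  proof (rule HL_P_independent[OF q finite_partitions_of])
    fix n and x :: "nat \<Rightarrow> real" assume x: "inj_on x {1..n}"
    have psz: "psize empty_partition = 0" using partitions_of_0 by (auto simp: partitions_of_def)
    have "HL_b q (conjugate c) * skew_sum q k c n x = HL_Q q (conjugate c) n x * skew_sum q k empty_partition n x"
      unfolding skew_sum_eq_mult[OF q c x, of k] by (simp add: HL_Q_def)
    also have "\<dots> = (\<Sum>d\<in>partitions_of k. skew_coeff q d empty_partition / HL_b q (conjugate d)
        * (HL_Q q (conjugate c) n x * HL_Q q (conjugate d) n x))"
      unfolding skew_sum_def psz add_0 sum_distrib_left
      by (intro sum.cong refl) (use bn in \<open>simp add: HL_Q_def\<close>)
    also have "\<dots> = (\<Sum>d\<in>partitions_of k. \<Sum>la\<in>partitions_of ?N.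
        skew_coeff q d empty_partition * (?g d la / HL_b q (conjugate d)) * HL_b q la * HL_P q la n x)"
    proof (intro sum.cong refl)
      fix d assume "d \<in> partitions_of k"
      then have d: "d \<in> partitions" "psize d = k" by (auto simp: partitions_of_def)
      have "HL_Q q (conjugate c) n x * HL_Q q (conjugate d) n x = (\<Sum>la\<in>partitions_of ?N. ?g d la * HL_Q q la n x)"
        using HL_g_props(2)[OF q conjugate_in_partitions[OF c] conjugate_in_partitions[OF d(1)] x]
        by (simp add: psize_conjugate c d)
      then show "skew_coeff q d empty_partition / HL_b q (conjugate d) * (HL_Q q (conjugate c) n x * HL_Q q (conjugate d) n x)
          = (\<Sum>la\<in>partitions_of ?N. skew_coeff q d empty_partition * (?g d la / HL_b q (conjugate d)) * HL_b q la * HL_P q la n x)"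
        by (simp add: sum_distrib_left HL_Q_def mult_ac)
    qed
    also have "\<dots> = (\<Sum>la\<in>partitions_of ?N. (\<Sum>d\<in>partitions_of k. skew_coeff q d empty_partition * (?g d la / HL_b q (conjugate d))) * HL_b q la * HL_P q la n x)"
      by (subst sum.swap) (simp add: sum_distrib_right)
    finally have 1: "HL_b q (conjugate c) * skew_sum q k c n x = \<dots>" .
    have "HL_b q (conjugate c) * skew_sum q k c n x = (\<Sum>a\<in>partitions_of ?N. skew_coeff q (conjugate (conjugate a)) c * HL_b q (conjugate c) * HL_P q (conjugate a) n x)"
      unfolding skew_sum_def sum_distrib_left
      by (intro sum.cong refl) (auto simp: partitions_of_def conjugate_conjugate)
    also have "\<dots> = (\<Sum>la\<in>partitions_of ?N. skew_coeff q (conjugate la) c * HL_b q (conjugate c) * HL_P q la n x)"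
      by (rule sum_partitions_of_conjugate)
    finally show "(\<Sum>la\<in>partitions_of ?N. ?h la * HL_P q la n x) = 0"
      using 1 by (simp add: left_diff_distrib sum_subtractf)
  qed (auto simp: partitions_of_def)
  moreover have "conjugate a \<in> partitions_of ?N" using a by (rule partitions_of_conjugate)
  moreover have "conjugate (conjugate a) = a" using a by (simp add: partitions_of_def conjugate_conjugate)
  ultimately show ?thesis using bn[of "conjugate a"] by (simp add: field_simps)
qed


section \<open>Principal specialisation and the number of surjections\<close>

lemma HL_P_cong:
  assumes "\<And>i. i \<in> {1..n} \<Longrightarrow> x i = x' i"
  shows "HL_P q la n x = HL_P q la n x'"
proof -
  have "x (w i) = x' (w i)" if "w permutes {1..n}" "i \<in> {1..n}" for w i
    using assms permutes_in_image[OF that(1)] that(2) by blast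
  then show ?thesis
    unfolding HL_P_def by (intro if_cong refl arg_cong2[where f = "(*)"] sum.cong prod.cong) auto
qed

text \<open>If no two consecutive values occurred in the wrong order, the inverse would be
  increasing, hence the identity. On a geometric sequence of ratio q such a pair makes the numerator
  x (w i) - q x (w j) vanish.\<close>

lemma permutes_descent:
  assumes w: "w permutes {1..n}" and "w \<noteq> id"
  obtains i j where "1 \<le> i" "i < j" "j \<le> n" "w i = Suc (w j)"
proof -
  define v where "v = inv w"
  have v: "v permutes {1..n}" unfolding v_def by (rule permutes_inv[OF w])
  have "\<exists>k. 1 \<le> k \<and> k < n \<and> v (Suc k) < v k"
  proof (rule ccontr)
    assume no: "\<not> ?thesis"
    have "k \<le> n \<Longrightarrow> k \<le> v k" if "1 \<le> k" for k
      using that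
    proof (induction k rule: dec_induct)
      case base
      then show ?case using permutes_in_image[OF v, of 1] by simp
    next
      case (step k)
      have "v k \<noteq> v (Suc k)" using permutes_inj[OF v] by (metis injD n_not_Suc_n)
      then have "v k < v (Suc k)" using no step by (meson Suc_le_lessD linorder_neqE_nat)
      then show ?case using step by simp
    qed
    then have "v = id" by (intro permutes_natset_ge[OF v]) auto
    then show False using \<open>w \<noteq> id\<close> permutes_inv_inv[OF w] by (simp add: v_def)
  qed
  then obtain k where k: "1 \<le> k" "k < n" "v (Suc k) < v k" by blast
  have wv: "w (v i) = i" for i unfolding v_def by (rule permutes_inverses(1)[OF w])
  have "v k \<in> {1..n}" "v (Suc k) \<in> {1..n}"
    using permutes_in_image[OF v, of k] permutes_in_image[OF v, of "Suc k"] k by simp_all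
  then show thesis using that[of "v (Suc k)" "v k"] k wv by simp
qed

text \<open>The scale z covers both specialisations in \<open>Sur\<close>: z = 1 gives q, q^2, ...
  and z = 1/q gives 1, q, .... The last quotient is the only effect of having finitely many
  variables.\<close>

lemma HL_P_geometric:
  assumes q: "0 < q" "q < 1" and c: "c \<in> partitions" and n: "c 1 \<le> n" and z: "z \<noteq> 0"
  shows "HL_P q (conjugate c) n (\<lambda>i. z * q ^ i) =
    (\<Prod>j=1..plength c. z ^ c j * q ^ (Suc (c j) choose 2)) / HL_b q (conjugate c)
      * (qpoch q q n / qpoch q q (n - c 1))"
proof -
  let ?la = "conjugate c"
  let ?x = "\<lambda>i. z * q ^ i"
  let ?t = "\<lambda>w. (\<Prod>i=1..n. ?x (w i) ^ ?la i) * (\<Prod>j=1..n. \<Prod>i=1..<j. (?x (w i) - q * ?x (w j)) / (?x (w i) - ?x (w j)))"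
  have zero: "?t w = 0" if w: "w permutes {1..n}" "w \<noteq> id" for w
  proof -
    obtain i j where ij: "1 \<le> i" "i < j" "j \<le> n" "w i = Suc (w j)" using permutes_descent[OF w] .
    then have z: "(?x (w i) - q * ?x (w j)) / (?x (w i) - ?x (w j)) = 0" by simp
    have mem: "i \<in> {1..<j}" "j \<in> {1..n}" using ij by auto
    have "(\<Prod>i=1..<j. (?x (w i) - q * ?x (w j)) / (?x (w i) - ?x (w j))) = 0"
      by (rule prod_zero[OF finite_atLeastLessThan], rule bexI[of _ i], rule z, rule mem)
    then have "(\<Prod>j=1..n. \<Prod>i=1..<j. (?x (w i) - q * ?x (w j)) / (?x (w i) - ?x (w j))) = 0"
      by (intro prod_zero[OF finite_atLeastAtMost] bexI[of _ j] mem)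
    then show ?thesis by simp
  qed
  have "(\<Sum>w | w permutes {1..n}. ?t w) = (\<Sum>w\<in>{id}. ?t w)"
    by (rule sum.mono_neutral_right) (use zero permutes_id in \<open>auto simp: finite_permutations\<close>)
  then have sum: "(\<Sum>w | w permutes {1..n}. ?t w) = ?t id" by simp
  \<comment> \<open>In terms of s = j - i a factor is (1 - q^(s+1)) / (1 - q^s), so the product
    telescopes.\<close>
  have inner: "(\<Prod>i=1..<j. (?x i - q * ?x j) / (?x i - ?x j)) = (1 - q ^ j) / (1 - q)" if "j \<ge> 1" for j
  proof -
    have pw: "q ^ s \<noteq> 1" if "s > 0" for s
      using power_strict_decreasing[OF that, of q] q by simp
    have "(\<Prod>i=1..<j. (?x i - q * ?x j) / (?x i - ?x j)) = (\<Prod>s=1..<j. (1 - q ^ Suc s) / (1 - q ^ s))"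
    proof (rule prod.reindex_bij_witness[of _ "\<lambda>s. j - s" "\<lambda>i. j - i"])
      fix i assume "i \<in> {1..<j}"
      then obtain s where s: "j = i + s" "s > 0" by (metis atLeastLessThan_iff less_imp_add_positive)
      have "?x i - q * ?x j = z * q ^ i * (1 - q ^ Suc s)" "?x i - ?x j = z * q ^ i * (1 - q ^ s)"
        by (simp_all add: s(1) power_add algebra_simps)
      then show "(1 - q ^ Suc (j - i)) / (1 - q ^ (j - i)) = (?x i - q * ?x j) / (?x i - ?x j)"
        using s z q by simp
    qed auto
    also have "\<dots> = (1 - q ^ j) / (1 - q)"
      using that
    proof (induction j rule: dec_induct)
      case (step j)
      then show ?case using pw[of j] q by simp
    qed (use q in simp)
    finally show ?thesis .
  qed
  have "(\<Prod>j=1..n. \<Prod>i=1..<j. (?x i - q * ?x j) / (?x i - ?x j)) = (\<Prod>j=1..n. (1 - q ^ j) / (1 - q))"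
    by (intro prod.cong refl) (use inner in auto)
  also have "\<dots> = qpoch_normalized q n"
    by (induction n) (simp_all add: qpoch_normalized_def qpoch_Suc)
  finally have V: "(\<Prod>j=1..n. \<Prod>i=1..<j. (?x i - q * ?x j) / (?x i - ?x j)) = qpoch_normalized q n" .
  have mono: "(\<Prod>i=1..n. ?x i ^ ?la i) = (\<Prod>j=1..plength c. z ^ c j * q ^ (Suc (c j) choose 2))"
  proof -
    have "(\<Prod>i=1..n. ?x i ^ ?la i) = (\<Prod>i=1..n. \<Prod>j=1..plength c. if i \<le> c j then ?x i else 1)"
    proof (intro prod.cong refl)
      fix i assume i: "i \<in> {1..n}"
      have "{j. 1 \<le> j \<and> i \<le> c j} = {j \<in> {1..plength c}. i \<le> c j}"
        using conjugate_set_finite[OF c, of i] i by auto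
      then show "?x i ^ ?la i = (\<Prod>j=1..plength c. if i \<le> c j then ?x i else 1)"
        using i by (simp add: conjugate_def prod.If_cases Int_def)
    qed
    also have "\<dots> = (\<Prod>j=1..plength c. \<Prod>i=1..n. if i \<le> c j then ?x i else 1)" by (rule prod.swap)
    also have "\<dots> = (\<Prod>j=1..plength c. z ^ c j * q ^ (Suc (c j) choose 2))"
    proof (intro prod.cong refl)
      fix j assume j: "j \<in> {1..plength c}"
      have "{i \<in> {1..n}. i \<le> c j} = {1..c j}"
        using partition_antimono[OF c, of 1 j] j n by auto
      then have "(\<Prod>i=1..n. if i \<le> c j then ?x i else 1) = (\<Prod>i=1..c j. ?x i)"
        by (simp add: prod.If_cases Int_def)
      also have "\<dots> = z ^ c j * q ^ (Suc (c j) choose 2)"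
      proof (induction "c j")
        case 0 then show ?case by (simp add: numeral_2_eq_2)
      next
        case (Suc m)
        have "(\<Prod>i=1..m. ?x i) = z ^ m * q ^ (Suc m choose 2)" for m
          by (induction m) (simp_all add: numeral_2_eq_2 power_add)
        then show ?case by simp
      qed
      finally show "(\<Prod>i=1..n. if i \<le> c j then ?x i else 1) = \<dots>" .
    qed
    finally show ?thesis .
  qed
  have b: "(\<Prod>i=1..plength c. qpoch_normalized q (c i - c (Suc i))) = HL_b q ?la / (1 - q) ^ c 1"
  proof -
    have "(\<Prod>i=1..L. qpoch_normalized q (c i - c (Suc i))) = (\<Prod>i=1..L. qpoch q q (c i - c (Suc i))) / (1 - q) ^ (c 1 - c (Suc L))
       \<and> c (Suc L) \<le> c 1" for L
    proof (induction L)
      case (Suc L)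
      have le: "c (Suc (Suc L)) \<le> c (Suc L)" using partition_antimono[OF c, of "Suc L"] by simp
      then have "(1 - q) ^ (c 1 - c (Suc L)) * (1 - q) ^ (c (Suc L) - c (Suc (Suc L))) = (1 - q) ^ (c 1 - c (Suc (Suc L)))"
        using Suc by (simp add: power_add[symmetric])
      then show ?case using Suc le by (simp add: qpoch_normalized_def)
    qed simp
    from this[of "plength c"] show ?thesis
      using partition_eq_0[OF c, of "Suc (plength c)"] by (simp add: HL_b_conjugate[OF c])
  qed
  have "HL_P q ?la n ?x = 1 / HL_v q n ?la * (\<Sum>w | w permutes {1..n}. ?t w)"
    using n by (simp add: HL_P_def plength_conjugate[OF c])
  also have "\<dots> = qpoch_normalized q n / HL_v q n ?la * (\<Prod>j=1..plength c. z ^ c j * q ^ (Suc (c j) choose 2))"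
    unfolding sum id_apply V mono by simp
  also have "qpoch_normalized q n / HL_v q n ?la = qpoch q q n / qpoch q q (n - c 1) / HL_b q ?la"
  proof -
    have "(1 - q) ^ n = (1 - q) ^ (n - c 1) * (1 - q) ^ c 1"
      using n by (simp add: power_add[symmetric])
    then show ?thesis
      unfolding HL_v_conjugate[OF c order.refl] b using q qpoch_pos[OF q, of "n - c 1"] HL_b_pos[OF q, of ?la]
      by (simp add: qpoch_normalized_def field_simps)
  qed
  finally show ?thesis by (simp add: field_simps)
qed

lemma HL_P_inf_geometric:
  assumes q: "0 < q" "q < 1" and c: "c \<in> partitions" and z: "z \<noteq> 0"
  shows "HL_P_inf q (conjugate c) (\<lambda>i. z * q ^ i) =
    (\<Prod>j=1..plength c. z ^ c j * q ^ (Suc (c j) choose 2)) / HL_b q (conjugate c)"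
proof -
  let ?A = "(\<Prod>j=1..plength c. z ^ c j * q ^ (Suc (c j) choose 2)) / HL_b q (conjugate c)"
  have quot: "qpoch q q (m + l) / qpoch q q m = (\<Prod>s=1..l. 1 - q ^ (m + s))" for m l
  proof (induction l)
    case 0
    then show ?case using qpoch_pos[OF q, of m] by simp
  next
    case (Suc l)
    have "qpoch q q (m + Suc l) / qpoch q q m = qpoch q q (m + l) / qpoch q q m * (1 - q * q ^ (m + l))"
      by (simp add: qpoch_Suc)
    then show ?case unfolding Suc by simp
  qed
  have "(\<lambda>m. \<Prod>s=1..c 1. 1 - q ^ (m + s)) \<longlonglongrightarrow> (\<Prod>s=1..c 1. 1 - 0)"
  proof (intro tendsto_prod tendsto_diff tendsto_const)
    fix s show "(\<lambda>m. q ^ (m + s)) \<longlonglongrightarrow> 0"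
      using LIMSEQ_power_zero[of q] q by (intro LIMSEQ_ignore_initial_segment) auto
  qed
  then have "(\<lambda>m. ?A * (qpoch q q (m + c 1) / qpoch q q m)) \<longlonglongrightarrow> ?A * 1"
    unfolding quot by (intro tendsto_mult tendsto_const) simp
  moreover have "HL_P q (conjugate c) (m + c 1) (\<lambda>i. z * q ^ i) = ?A * (qpoch q q (m + c 1) / qpoch q q m)" for m
    using HL_P_geometric[OF q c _ z, of "m + c 1"] by simp
  ultimately have "(\<lambda>m. HL_P q (conjugate c) (m + c 1) (\<lambda>i. z * q ^ i)) \<longlonglongrightarrow> ?A" by simp
  then have "(\<lambda>n. HL_P q (conjugate c) n (\<lambda>i. z * q ^ i)) \<longlonglongrightarrow> ?A" by (rule LIMSEQ_offset)
  then show ?thesis unfolding HL_P_inf_def by (rule limI)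
qed

text \<open>At (q, q^2, ...) the function P_nu equals q^(|nu|) / b_nu times the
  \<open>skew_coeff\<close> of nu over the empty partition, so the sum over nu is exactly the one in
  \<open>HL_g_skew_coeff\<close>.\<close>

lemma HL_P_skew_inf_geometric:
  assumes q: "0 < q" "q < 1" and c: "c \<in> partitions" and a: "a \<in> partitions"
  shows "HL_P_skew_inf q (conjugate a) (conjugate c) (\<lambda>i. q ^ i)
    = q ^ (psize a - psize c) * skew_coeff q a c * HL_b q (conjugate c) / HL_b q (conjugate a)"
proof -
  let ?g = "\<lambda>nu. HL_g q (conjugate c) nu (conjugate a)"
  let ?P = "\<lambda>nu. HL_P_inf q nu (\<lambda>i. q ^ i)"
  have deg: "psize a = psize c + psize nu" if "nu \<in> partitions" "?g nu \<noteq> 0" for nu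
    using HL_g_props(1)[OF q conjugate_in_partitions[OF c] that] c a
    by (simp add: partitions_of_def psize_conjugate)
  show ?thesis
  proof (cases "psize c \<le> psize a")
    case False
    then have "{nu. nu \<in> partitions \<and> ?g nu \<noteq> 0} = {}" using deg by fastforce
    moreover have "\<not> (\<forall>i. c i \<le> a i)" using psize_mono[OF c a] False by blast
    then have "skew_coeff q a c = 0" unfolding skew_coeff_def by (rule if_not_P)
    ultimately show ?thesis unfolding HL_P_skew_inf_def by (simp only: sum.empty)
  next
    case True
    define k where "k = psize a - psize c"
    have k: "psize a = psize c + k" using True by (simp add: k_def)
    have "HL_P_skew_inf q (conjugate a) (conjugate c) (\<lambda>i. q ^ i) = (\<Sum>nu\<in>partitions_of k. ?g nu * ?P nu)"
      unfolding HL_P_skew_inf_def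
    proof (rule sum.mono_neutral_left)
      show "{nu. nu \<in> partitions \<and> ?g nu \<noteq> 0} \<subseteq> partitions_of k"
        using deg k by (fastforce simp: partitions_of_def)
      show "\<forall>nu\<in>partitions_of k - {nu. nu \<in> partitions \<and> ?g nu \<noteq> 0}. ?g nu * ?P nu = 0"
        by (auto simp: partitions_of_def)
    qed (rule finite_partitions_of)
    also have "\<dots> = (\<Sum>d\<in>partitions_of k. ?g (conjugate d) * ?P (conjugate d))"
      by (rule sum_partitions_of_conjugate[symmetric])
    also have "\<dots> = (\<Sum>d\<in>partitions_of k. q ^ k * (skew_coeff q d empty_partition * (?g (conjugate d) / HL_b q (conjugate d))))"
    proof (intro sum.cong refl)
      fix d assume "d \<in> partitions_of k"
      then have d: "d \<in> partitions" "psize d = k" by (auto simp: partitions_of_def)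
      have "?P (conjugate d) = (\<Prod>j=1..plength d. q ^ (Suc (d j) choose 2)) / HL_b q (conjugate d)"
        using HL_P_inf_geometric[OF q d(1), of 1] by simp
      also have "(\<Prod>j=1..plength d. q ^ (Suc (d j) choose 2)) = (\<Prod>j=1..plength d. q ^ d j * q ^ (d j choose 2))"
        by (simp add: numeral_2_eq_2 power_add)
      also have "\<dots> = q ^ k * (\<Prod>j=1..plength d. q ^ (d j choose 2))"
        using psize_eq_sum[OF d(1) order.refl] d(2) by (simp add: prod.distrib power_sum)
      also have "(\<Prod>j=1..plength d. q ^ (d j choose 2)) = skew_coeff q d empty_partition"
        using q by (simp add: skew_coeff_def empty_partition_def)
      finally show "?g (conjugate d) * ?P (conjugate d) = q ^ k * (skew_coeff q d empty_partition * (?g (conjugate d) / HL_b q (conjugate d)))"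
        by simp
    qed
    also have "\<dots> = q ^ k * (skew_coeff q a c * HL_b q (conjugate c) / HL_b q (conjugate a))"
      unfolding sum_distrib_left[symmetric]
      by (subst HL_g_skew_coeff[OF q c]) (use a k in \<open>auto simp: partitions_of_def\<close>)
    finally show ?thesis by (simp add: k_def)
  qed
qed

text \<open>Exponents of q in one column of \<open>Sur\<close>, with a = c + d: the denominator
  contributes the left side and the numerator d + binom(d, 2), which leaves q^(-a c) = p^(a
  c).\<close>

lemma choose_2_identity: "(Suc (c + d) choose 2) + (c choose 2) = (c + d) * c + (d + (d choose 2))"
proof -
  have t: "2 * (m choose 2) = m * (m - 1)" for m
  proof -
    have "even (m * (m - 1))" by (cases m) auto
    then show ?thesis by (simp add: choose_two)
  qed
  have "2 * ((Suc (c + d) choose 2) + (c choose 2)) = 2 * ((c + d) * c + (d + (d choose 2)))"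
    unfolding distrib_left t by (cases c; cases d) (simp_all add: algebra_simps)
  then show ?thesis by simp
qed

text \<open>For prime p the powers of p multiply to the number of all homomorphisms, and the
  q-Pochhammer quotients give the proportion of surjective ones.\<close>

lemma Sur_conjugate:
  assumes p: "p > 1" and c: "c \<in> partitions" and a: "a \<in> partitions"
  defines "q \<equiv> 1 / p"
  shows "Sur p (conjugate a) (conjugate c) = (if \<forall>i. c i \<le> a i then
     \<Prod>i=1..plength a. p ^ (a i * c i) * qpoch q q (a i - c (Suc i)) / qpoch q q (a i - c i) else 0)"
proof -
  have q: "0 < q" "q < 1" using p by (auto simp: q_def)
  have b: "HL_b q la > 0" for la by (rule HL_b_pos[OF q])
  have "HL_Q_inf q (conjugate c) (\<lambda>i. q ^ (i - 1)) = HL_b q (conjugate c) * HL_P_inf q (conjugate c) (\<lambda>i. (1 / q) * q ^ i)"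
  proof -
    have "HL_P q (conjugate c) n (\<lambda>i. q ^ (i - 1)) = HL_P q (conjugate c) n (\<lambda>i. (1 / q) * q ^ i)" for n
    proof (rule HL_P_cong)
      fix i assume "i \<in> {1..n}"
      then show "q ^ (i - 1) = (1 / q) * q ^ i" using q by (cases i) auto
    qed
    then show ?thesis by (simp add: HL_Q_inf_def HL_P_inf_def)
  qed
  also have "\<dots> = (\<Prod>j=1..plength c. (1 / q) ^ c j * q ^ (Suc (c j) choose 2))"
    using HL_P_inf_geometric[OF q c, of "1 / q"] b[of "conjugate c"] q by simp
  also have "\<dots> = (\<Prod>j=1..plength c. q ^ (c j choose 2))"
    by (intro prod.cong refl) (use q in \<open>simp add: numeral_2_eq_2 power_add power_divide\<close>)
  finally have Q: "HL_Q_inf q (conjugate c) (\<lambda>i. q ^ (i - 1)) = (\<Prod>j=1..plength c. q ^ (c j choose 2))" .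
  have P: "HL_P_inf q (conjugate a) (\<lambda>i. q ^ i) = (\<Prod>j=1..plength a. q ^ (Suc (a j) choose 2)) / HL_b q (conjugate a)"
    using HL_P_inf_geometric[OF q a, of 1] by simp
  have "Sur p (conjugate a) (conjugate c) = q ^ (psize a - psize c) * skew_coeff q a c * HL_b q (conjugate c)
      / ((\<Prod>j=1..plength a. q ^ (Suc (a j) choose 2)) * (\<Prod>j=1..plength c. q ^ (c j choose 2)))"
    unfolding Sur_def Let_def q_def[symmetric] HL_P_skew_inf_geometric[OF q c a] P Q
    using b[of "conjugate a"] by (simp add: field_simps)
  also have "\<dots> = (if \<forall>i. c i \<le> a i then
     \<Prod>i=1..plength a. p ^ (a i * c i) * qpoch q q (a i - c (Suc i)) / qpoch q q (a i - c i) else 0)"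
  proof (cases "\<forall>i. c i \<le> a i")
    case False
    then have "skew_coeff q a c = 0" unfolding skew_coeff_def by (rule if_not_P)
    then show ?thesis unfolding if_not_P[OF False] by simp
  next
    case True
    define L where "L = plength a"
    have c0: "c i = 0" if "i > L" for i using True partition_eq_0[OF a, of i] that by (metis L_def le_zero_eq)
    have pc: "plength c \<le> L" by (rule partition_plength_le[OF c c0])
    have ext: "(\<Prod>i=1..plength c. f i) = (\<Prod>i=1..L. f i)" if "\<And>i. i > plength c \<Longrightarrow> f i = 1" for f :: "nat \<Rightarrow> real"
      by (rule prod.mono_neutral_left) (use pc that in auto)
    have "psize a - psize c = (\<Sum>i=1..L. a i - c i)"
      using psize_eq_sum[OF a, of L] psize_eq_sum[OF c pc] True by (simp add: L_def sum_subtractf_nat)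
    then have 1: "q ^ (psize a - psize c) = (\<Prod>i=1..L. q ^ (a i - c i))" by (simp add: power_sum)
    have 2: "skew_coeff q a c = (\<Prod>i=1..L. q ^ ((a i - c i) choose 2) * qbin q (a i - c (Suc i)) (c i - c (Suc i)))"
      using True by (simp add: skew_coeff_def L_def)
    have 3: "HL_b q (conjugate c) = (\<Prod>i=1..L. qpoch q q (c i - c (Suc i)))"
      unfolding HL_b_conjugate[OF c] by (rule ext) (simp add: partition_eq_0[OF c])
    have 4: "(\<Prod>j=1..plength c. q ^ (c j choose 2)) = (\<Prod>j=1..L. q ^ (c j choose 2))"
      by (rule ext) (simp add: partition_eq_0[OF c] numeral_2_eq_2)
    have "q ^ (psize a - psize c) * skew_coeff q a c * HL_b q (conjugate c)
      / ((\<Prod>j=1..plength a. q ^ (Suc (a j) choose 2)) * (\<Prod>j=1..plength c. q ^ (c j choose 2)))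
      = (\<Prod>i=1..L. p ^ (a i * c i) * qpoch q q (a i - c (Suc i)) / qpoch q q (a i - c i))"
      unfolding 1 2 3 4 L_def[symmetric] prod.distrib[symmetric] prod_dividef[symmetric]
    proof (intro prod.cong refl)
      fix i assume i: "i \<in> {1..L}"
      have le: "c (Suc i) \<le> c i" using partition_antimono[OF c, of i "Suc i"] i by simp
      have lea: "c i \<le> a i" using True by blast
      have nz: "qpoch q q m \<noteq> 0" for m using qpoch_pos[OF q, of m] by simp
      have "a i - c (Suc i) - (c i - c (Suc i)) = a i - c i" using le lea by simp
      then have bin: "qbin q (a i - c (Suc i)) (c i - c (Suc i)) * qpoch q q (c i - c (Suc i))
          = qpoch q q (a i - c (Suc i)) / qpoch q q (a i - c i)"
        using nz lea by (simp add: qbin_def diff_le_mono)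
      obtain d where d: "a i = c i + d" using lea le_Suc_ex by blast
      have "q ^ (Suc (a i) choose 2) * q ^ (c i choose 2) = q ^ (a i * c i) * (q ^ d * q ^ (d choose 2))"
        unfolding power_add[symmetric] d choose_2_identity ..
      moreover have "q ^ (a i * c i) * p ^ (a i * c i) = 1"
        using p by (simp add: q_def power_mult_distrib[symmetric])
      moreover have "e / (A * B) * X = P * X" if "A * B = r * e" "r * P = 1" "e \<noteq> 0" for e A B X P r :: real
      proof -
        have "P = 1 / r" using that(2) by (metis divide_eq_eq mult.commute mult_zero_left zero_neq_one)
        then show ?thesis unfolding that(1) using that(3) by simp
      qed
      ultimately have "(q ^ d * q ^ (d choose 2)) / (q ^ (Suc (a i) choose 2) * q ^ (c i choose 2)) * X = p ^ (a i * c i) * X" for X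
        using q by simp
      note X = this[of "qbin q (a i - c (Suc i)) (c i - c (Suc i)) * qpoch q q (c i - c (Suc i))"]
      have r: "p ^ (a i * c i) * qpoch q q (a i - c (Suc i)) / qpoch q q (a i - c i)
          = p ^ (a i * c i) * (qbin q (a i - c (Suc i)) (c i - c (Suc i)) * qpoch q q (c i - c (Suc i)))"
        unfolding bin by simp
      show "q ^ (a i - c i) * (q ^ ((a i - c i) choose 2) * qbin q (a i - c (Suc i)) (c i - c (Suc i))) * qpoch q q (c i - c (Suc i))
          / (q ^ (Suc (a i) choose 2) * q ^ (c i choose 2))
        = p ^ (a i * c i) * qpoch q q (a i - c (Suc i)) / qpoch q q (a i - c i)"
        unfolding r using X by (simp add: d mult_ac)
    qed
    then show ?thesis using True by (simp add: L_def)
  qed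
  finally show ?thesis .
qed


section \<open>q-series identities\<close>

text \<open>The coefficients of Euler's series in z for the product of 1 + z q^j over j >=
  1.\<close>

definition euler_coeff :: "real \<Rightarrow> nat \<Rightarrow> real" where
  "euler_coeff q d = q ^ (Suc d choose 2) / qpoch q q d"

text \<open>Its generating function in u is (1 + u) / (u^2; q^2)_inf = 1 / ((u; q)_inf (-q u;
  q)_inf).\<close>

definition parity_coeff :: "real \<Rightarrow> nat \<Rightarrow> real" where
  "parity_coeff q m = 1 / qpoch (q\<^sup>2) (q\<^sup>2) (m div 2)"

text \<open>Sums out one column: e is its height above the corresponding column of c, N the height
  of the preceding column above the same level, and (q; q)_N the numerator left over there. It is an
  average because the weights add up to 1, see \<open>col_avg_pos_base\<close>.\<close>

definition col_avg :: "real \<Rightarrow> (nat \<Rightarrow> real) \<Rightarrow> nat \<Rightarrow> real" where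
  "col_avg q \<phi> N = qpoch q q N * (\<Sum>e\<le>N. euler_coeff q e * \<phi> e * parity_coeff q (N - e))"

lemma euler_coeff_pos: "0 < q \<Longrightarrow> q < 1 \<Longrightarrow> euler_coeff q d > 0"
  by (simp add: euler_coeff_def qpoch_pos)

lemma parity_coeff_pos: "0 < q \<Longrightarrow> q < 1 \<Longrightarrow> parity_coeff q d > 0"
  using qpoch_pos[of "q\<^sup>2"] by (simp add: parity_coeff_def power_less_one_iff)

lemma euler_coeff_0 [simp]: "euler_coeff q 0 = 1"
  by (simp add: euler_coeff_def numeral_2_eq_2)

lemma parity_coeff_0 [simp]: "parity_coeff q 0 = 1"
  by (simp add: parity_coeff_def)

lemma parity_coeff_1 [simp]: "parity_coeff q (Suc 0) = 1"
  by (simp add: parity_coeff_def)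

lemma euler_coeff_Suc:
  assumes "0 < q" "q < 1"
  shows "euler_coeff q (Suc n) * (1 - q ^ Suc n) = q ^ Suc n * euler_coeff q n"
proof -
  have "1 - q * q ^ n \<noteq> 0" "qpoch q q n \<noteq> 0"
    using qpoch_pos[OF assms, of "Suc n"] qpoch_pos[OF assms, of n] by (auto simp: qpoch_Suc)
  moreover have "(Suc (Suc n) choose 2) = Suc n + (Suc n choose 2)" by (simp add: numeral_2_eq_2)
  ultimately show ?thesis by (simp add: euler_coeff_def qpoch_Suc power_add)
qed

lemma parity_coeff_Suc_Suc:
  assumes "0 < q" "q < 1"
  shows "parity_coeff q (Suc (Suc n)) * (1 - q ^ (2 * (Suc (Suc n) div 2))) = parity_coeff q n"
proof -
  have "0 < q\<^sup>2" "q\<^sup>2 < 1" using assms by (auto simp: power_less_one_iff)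
  then have "1 - q\<^sup>2 * (q\<^sup>2) ^ (n div 2) \<noteq> 0"
    using qpoch_pos[of "q\<^sup>2" "Suc (n div 2)"] by (auto simp: qpoch_Suc)
  moreover have "q ^ (2 * (Suc (Suc n) div 2)) = q\<^sup>2 * (q\<^sup>2) ^ (n div 2)"
    by (simp add: power_mult power_add power2_eq_square)
  ultimately show ?thesis by (simp add: parity_coeff_def qpoch_Suc)
qed

text \<open>The coefficients of D(u) (1 - u) (1 + q u) = D(q u), with D the generating function. The
  parity of n decides which two neighbouring coefficients coincide.\<close>

lemma parity_coeff_rec:
  assumes "0 < q" "q < 1"
  shows "parity_coeff q (Suc (Suc n)) - (1 - q) * parity_coeff q (Suc n) - q * parity_coeff q n = q ^ Suc (Suc n) * parity_coeff q (Suc (Suc n))"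
proof (cases "even n")
  case True
  then have "Suc n div 2 = n div 2" by simp
  then have "parity_coeff q (Suc n) = parity_coeff q n" by (simp add: parity_coeff_def)
  moreover have "2 * (Suc (Suc n) div 2) = Suc (Suc n)" using True by simp
  ultimately show ?thesis using parity_coeff_Suc_Suc[OF assms, of n] by (simp add: algebra_simps)
next
  case False
  then have e: "2 * (Suc (Suc n) div 2) = Suc n" by (metis even_Suc dvd_mult_div_cancel div2_Suc_Suc odd_Suc_div_two odd_two_times_div_two_succ mult_Suc_right add_2_eq_Suc Suc_eq_plus1)
  have "Suc (Suc n) div 2 = Suc n div 2" using False by (auto elim!: oddE)
  then have 1: "parity_coeff q (Suc (Suc n)) = parity_coeff q (Suc n)" by (simp add: parity_coeff_def)
  have h: "parity_coeff q (Suc (Suc n)) * (1 - q ^ Suc n) = parity_coeff q n" using parity_coeff_Suc_Suc[OF assms, of n] unfolding e .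
  have "q * parity_coeff q n = q * parity_coeff q (Suc (Suc n)) - q ^ Suc (Suc n) * parity_coeff q (Suc (Suc n))"
    unfolding h[symmetric] by (simp add: algebra_simps)
  then show ?thesis unfolding 1[symmetric] by (simp add: algebra_simps)
qed

definition fps_scale :: "real \<Rightarrow> real fps \<Rightarrow> real fps" where
  "fps_scale q f = Abs_fps (\<lambda>n. q ^ n * fps_nth f n)"

lemma fps_scale_mult: "fps_scale q (f * g) = fps_scale q f * fps_scale q g"
proof (rule fps_ext)
  fix n
  have "(\<Sum>i=0..n. q ^ n * (fps_nth f i * fps_nth g (n - i))) = (\<Sum>i=0..n. q ^ i * fps_nth f i * (q ^ (n - i) * fps_nth g (n - i)))"
  proof (intro sum.cong refl)
    fix i assume "i \<in> {0..n}"
    then have "q ^ n = q ^ i * q ^ (n - i)" by (simp add: power_add[symmetric])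
    then show "q ^ n * (fps_nth f i * fps_nth g (n - i)) = q ^ i * fps_nth f i * (q ^ (n - i) * fps_nth g (n - i))"
      by simp
  qed
  then show "fps_nth (fps_scale q (f * g)) n = fps_nth (fps_scale q f * fps_scale q g) n"
    by (simp add: fps_scale_def fps_mult_nth sum_distrib_left)
qed

text \<open>The recursion is the functional equation
  \<open>T(u) (1 - u) (1 + q u) = (1 + z q u) T(q u)\<close> of the generating function of \<open>T\<close>.\<close>

lemma conv_rec:
  assumes q: "0 < q" "q < 1"
  defines "T \<equiv> \<lambda>z N. \<Sum>e\<le>N. euler_coeff q e * z ^ e * parity_coeff q (N - e)"
  shows "T z 0 = 1" "T z (Suc 0) * (1 - q) = 1 - q + z * q"
    "T z (Suc (Suc n)) * (1 - q ^ Suc (Suc n)) = (1 - q + z * q ^ Suc (Suc n)) * T z (Suc n) + q * T z n"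
proof -
  show "T z 0 = 1" by (simp add: T_def)
  show "T z (Suc 0) * (1 - q) = 1 - q + z * q"
  proof -
    have "T z (Suc 0) * (1 - q) = 1 - q + z * (euler_coeff q (Suc 0) * (1 - q ^ Suc 0))"
      by (simp add: T_def algebra_simps)
    then show ?thesis unfolding euler_coeff_Suc[OF q] by simp
  qed
  define D E where "D = Abs_fps (parity_coeff q)" and "E = Abs_fps (\<lambda>e. euler_coeff q e * z ^ e)"
  let ?S = "fps_scale q"
  have Dn: "fps_nth D n = parity_coeff q n" and En: "fps_nth E n = euler_coeff q n * z ^ n" for n by (simp_all add: D_def E_def)
  have Tn: "fps_nth (E * D) N = T z N" for N
    by (simp add: fps_mult_nth T_def Dn En atMost_atLeast0)
  have D: "D * ((1 - fps_X) * (1 + fps_const q * fps_X)) = ?S D"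
  proof (rule fps_ext)
    fix n
    have "D * ((1 - fps_X) * (1 + fps_const q * fps_X)) = D - fps_const (1 - q) * (fps_X * D) - fps_const q * (fps_X * (fps_X * D))"
      by (simp add: algebra_simps fps_const_sub[symmetric] del: fps_const_sub)
    then show "fps_nth (D * ((1 - fps_X) * (1 + fps_const q * fps_X))) n = fps_nth (?S D) n"
    proof (cases n)
      case (Suc m)
      then show ?thesis using \<open>D * _ = _\<close> parity_coeff_rec[OF q, of "m - 1"]
        by (cases m) (simp_all add: fps_scale_def Dn)
    qed (simp add: fps_scale_def Dn)
  qed
  have E: "E = (1 + fps_const (z * q) * fps_X) * ?S E"
  proof (rule fps_ext)
    fix n
    have "(1 + fps_const (z * q) * fps_X) * ?S E = ?S E + fps_const (z * q) * (fps_X * ?S E)"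
      by (simp add: algebra_simps)
    then show "fps_nth E n = fps_nth ((1 + fps_const (z * q) * fps_X) * ?S E) n"
    proof (cases n)
      case (Suc m)
      have "euler_coeff q (Suc m) = q ^ Suc m * euler_coeff q (Suc m) + q ^ Suc m * euler_coeff q m"
        using euler_coeff_Suc[OF q, of m] by (simp add: algebra_simps)
      then have "euler_coeff q (Suc m) * z ^ Suc m = (q ^ Suc m * euler_coeff q (Suc m) + q ^ Suc m * euler_coeff q m) * z ^ Suc m" by simp
      also have "\<dots> = q ^ Suc m * (euler_coeff q (Suc m) * z ^ Suc m) + z * q * (q ^ m * (euler_coeff q m * z ^ m))"
        by (simp add: algebra_simps)
      finally show ?thesis using Suc \<open>_ = ?S E + _\<close> by (simp add: fps_scale_def En)
    qed (simp add: fps_scale_def En)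
  qed
  have "(E * D) * ((1 - fps_X) * (1 + fps_const q * fps_X)) = E * ?S D"
    by (simp only: mult.assoc D)
  also have "\<dots> = (1 + fps_const (z * q) * fps_X) * ?S (E * D)"
    by (subst E) (simp only: fps_scale_mult mult_ac)
  finally have "(E * D) - fps_const (1 - q) * (fps_X * (E * D)) - fps_const q * (fps_X * (fps_X * (E * D)))
     = ?S (E * D) + fps_const (z * q) * (fps_X * ?S (E * D))"
    by (simp add: algebra_simps fps_const_sub[symmetric] del: fps_const_sub)
  from arg_cong[OF this, of "\<lambda>f. fps_nth f (Suc (Suc n))"]
  have "T z (Suc (Suc n)) - (1 - q) * T z (Suc n) - q * T z n
     = q ^ Suc (Suc n) * T z (Suc (Suc n)) + z * q * (q ^ Suc n * T z (Suc n))"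
    by (simp add: Tn fps_scale_def)
  then show "T z (Suc (Suc n)) * (1 - q ^ Suc (Suc n)) = (1 - q + z * q ^ Suc (Suc n)) * T z (Suc n) + q * T z n"
    by (simp add: algebra_simps)
qed

text \<open>The leading coefficients of the recursion are nonzero, so a closed form need only be
  verified.\<close>

lemma conv_unique:
  assumes q: "0 < q" "q < 1" and u: "u 0 = 1" "u (Suc 0) * (1 - q) = 1 - q + z * q"
    "\<And>n. u (Suc (Suc n)) * (1 - q ^ Suc (Suc n)) = (1 - q + z * q ^ Suc (Suc n)) * u (Suc n) + q * u n"
  shows "(\<Sum>e\<le>N. euler_coeff q e * z ^ e * parity_coeff q (N - e)) = u N"
proof (induction N rule: induct_nat_012)
  case 0
  then show ?case using u by simp
next
  case 1
  have "(\<Sum>e\<le>Suc 0. euler_coeff q e * z ^ e * parity_coeff q (Suc 0 - e)) * (1 - q) = u (Suc 0) * (1 - q)"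
    unfolding conv_rec(2)[OF q] u(2) ..
  then show ?case using q by (metis mult_right_cancel right_minus_eq less_irrefl)
next
  case (ge2 n)
  have "(\<Sum>e\<le>Suc (Suc n). euler_coeff q e * z ^ e * parity_coeff q (Suc (Suc n) - e)) * (1 - q ^ Suc (Suc n)) = u (Suc (Suc n)) * (1 - q ^ Suc (Suc n))"
    unfolding conv_rec(3)[OF q] ge2 u(3) ..
  moreover have "q ^ Suc (Suc n) < 1" using q by (intro power_Suc_less_one) auto
  ultimately show ?case by (metis mult_right_cancel right_minus_eq less_irrefl)
qed

text \<open>For z = 1 Euler's product cancels (-q u; q)_inf in the denominator and leaves 1 / (u;
  q)_inf, with coefficients 1 / (q; q)_N.\<close>

lemma col_avg_pos_base:
  assumes q: "0 < q" "q < 1"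
  shows "col_avg q (\<lambda>_. 1) N = 1"
proof -
  have p: "qpoch q q n \<noteq> 0" for n using qpoch_pos[OF q, of n] by simp
  have "(\<Sum>e\<le>N. euler_coeff q e * 1 ^ e * parity_coeff q (N - e)) = 1 / qpoch q q N"
  proof (rule conv_unique[OF q])
    fix n
    have "1 - q * q ^ n \<noteq> 0" "1 - q * (q * q ^ n) \<noteq> 0" using p[of "Suc n"] p[of "Suc (Suc n)"] by (auto simp: qpoch_Suc)
    then show "1 / qpoch q q (Suc (Suc n)) * (1 - q ^ Suc (Suc n)) = (1 - q + 1 * q ^ Suc (Suc n)) * (1 / qpoch q q (Suc n)) + q * (1 / qpoch q q n)"
      using p[of n] by (simp add: qpoch_Suc divide_simps) (simp add: algebra_simps)
  qed (use q in \<open>simp_all add: qpoch_Suc\<close>)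
  then show ?thesis using p by (simp add: col_avg_def)
qed

text \<open>For z = -1/q Euler's product is (u; q)_inf and cancels the other factor, leaving 1 / (-q
  u; q)_inf.\<close>

lemma col_avg_neg_base:
  assumes q: "0 < q" "q < 1"
  shows "col_avg q (\<lambda>e. (- (1 / q)) ^ e) N = (- q) ^ N"
proof -
  have p: "qpoch q q n \<noteq> 0" for n using qpoch_pos[OF q, of n] by simp
  have "(\<Sum>e\<le>N. euler_coeff q e * (- (1 / q)) ^ e * parity_coeff q (N - e)) = (- q) ^ N / qpoch q q N"
  proof (rule conv_unique[OF q])
    fix n
    have "1 - q * q ^ n \<noteq> 0" "1 - q * (q * q ^ n) \<noteq> 0" using p[of "Suc n"] p[of "Suc (Suc n)"] by (auto simp: qpoch_Suc)
    then show "(- q) ^ Suc (Suc n) / qpoch q q (Suc (Suc n)) * (1 - q ^ Suc (Suc n))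
      = (1 - q + - (1 / q) * q ^ Suc (Suc n)) * ((- q) ^ Suc n / qpoch q q (Suc n)) + q * ((- q) ^ n / qpoch q q n)"
      using p[of n] q by (simp add: qpoch_Suc divide_simps) (simp add: algebra_simps)
  qed (use q in \<open>simp_all add: qpoch_Suc\<close>)
  then show ?thesis using p by (simp add: col_avg_def)
qed

lemma euler_coeff_power_shift:
  assumes q: "0 < q" "q < 1"
  shows "euler_coeff q (Suc e) * (z / q) ^ Suc e = euler_coeff q (Suc e) * z ^ Suc e + z * (euler_coeff q e * z ^ e)"
proof -
  have "euler_coeff q (Suc e) / q ^ Suc e = euler_coeff q (Suc e) + euler_coeff q e"
    using euler_coeff_Suc[OF q, of e] q by (simp add: field_simps)
  then have "euler_coeff q (Suc e) / q ^ Suc e * z ^ Suc e = (euler_coeff q (Suc e) + euler_coeff q e) * z ^ Suc e" by simp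
  then show ?thesis by (simp add: power_divide algebra_simps)
qed

text \<open>Replacing z by z / q multiplies Euler's product by 1 + z u, so coefficient N + 1 gains z
  times coefficient N; the factor 1 - q^(N+1) adjusts the normalisation.\<close>

lemma col_avg_step:
  assumes q: "0 < q" "q < 1"
  shows "col_avg q (\<lambda>e. (z / q) ^ e) (Suc N) = col_avg q (\<lambda>e. z ^ e) (Suc N) + z * (1 - q ^ Suc N) * col_avg q (\<lambda>e. z ^ e) N"
proof -
  have "(\<Sum>e\<le>Suc N. euler_coeff q e * (z / q) ^ e * parity_coeff q (Suc N - e))
     = parity_coeff q (Suc N) + (\<Sum>e\<le>N. euler_coeff q (Suc e) * (z / q) ^ Suc e * parity_coeff q (N - e))"
    by (subst sum.atMost_Suc_shift) simp
  also have "\<dots> = parity_coeff q (Suc N) + (\<Sum>e\<le>N. euler_coeff q (Suc e) * z ^ Suc e * parity_coeff q (N - e)) + z * (\<Sum>e\<le>N. euler_coeff q e * z ^ e * parity_coeff q (N - e))"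
    unfolding euler_coeff_power_shift[OF q] by (simp add: algebra_simps sum.distrib sum_distrib_left)
  also have "parity_coeff q (Suc N) + (\<Sum>e\<le>N. euler_coeff q (Suc e) * z ^ Suc e * parity_coeff q (N - e)) = (\<Sum>e\<le>Suc N. euler_coeff q e * z ^ e * parity_coeff q (Suc N - e))"
    by (subst sum.atMost_Suc_shift) simp
  finally show ?thesis by (simp add: col_avg_def qpoch_Suc algebra_simps)
qed

text \<open>Only the set of ratios is tracked: Euler's identity will annihilate each geometric
  sequence whatever its coefficient.\<close>

definition geo_span :: "real set \<Rightarrow> (nat \<Rightarrow> real) \<Rightarrow> bool" where
  "geo_span B \<phi> \<longleftrightarrow> (\<exists>a. \<forall>N. \<phi> N = (\<Sum>b\<in>B. a b * b ^ N))"

lemma geo_span_base: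
  assumes "finite B" "b \<in> B"
  shows "geo_span B (\<lambda>N. a * b ^ N)"
  unfolding geo_span_def
proof (intro exI[of _ "\<lambda>c. if b = c then a else 0"] allI)
  fix N
  have "(\<Sum>c\<in>B. (if b = c then a else 0) * c ^ N) = (\<Sum>c\<in>B. if b = c then a * c ^ N else 0)"
    by (intro sum.cong) auto
  then show "a * b ^ N = (\<Sum>c\<in>B. (if b = c then a else 0) * c ^ N)" using assms by simp
qed

lemma geo_span_add:
  assumes "geo_span B \<phi>" "geo_span B \<psi>"
  shows "geo_span B (\<lambda>N. \<phi> N + \<psi> N)"
proof -
  obtain a b where "\<And>N. \<phi> N = (\<Sum>c\<in>B. a c * c ^ N)" "\<And>N. \<psi> N = (\<Sum>c\<in>B. b c * c ^ N)"
    using assms unfolding geo_span_def by blast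
  then show ?thesis unfolding geo_span_def
    by (intro exI[of _ "\<lambda>c. a c + b c"]) (simp add: distrib_right sum.distrib)
qed

lemma geo_span_sum:
  assumes "\<And>i. i \<in> I \<Longrightarrow> geo_span B (\<phi> i)"
  shows "geo_span B (\<lambda>N. \<Sum>i\<in>I. \<phi> i N)"
proof -
  have 0: "geo_span B (\<lambda>N. 0)" unfolding geo_span_def by (intro exI[of _ "\<lambda>_. 0"]) simp
  show ?thesis
    using assms by (induction I rule: infinite_finite_induct) (auto simp: 0 geo_span_add)
qed

lemma geo_span_cmult:
  assumes "geo_span B \<phi>"
  shows "geo_span B (\<lambda>N. k * \<phi> N)"
proof -
  obtain a where "\<And>N. \<phi> N = (\<Sum>c\<in>B. a c * c ^ N)" using assms unfolding geo_span_def by blast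
  then show ?thesis unfolding geo_span_def
    by (intro exI[of _ "\<lambda>c. k * a c"]) (simp add: sum_distrib_left mult.assoc)
qed

lemma geo_span_mono:
  assumes "geo_span B \<phi>" "B \<subseteq> C" "finite C"
  shows "geo_span C \<phi>"
proof -
  obtain a where a: "\<And>N. \<phi> N = (\<Sum>c\<in>B. a c * c ^ N)" using assms unfolding geo_span_def by blast
  have "geo_span C (\<lambda>N. \<Sum>c\<in>B. a c * c ^ N)"
    by (intro geo_span_sum geo_span_base) (use assms in auto)
  moreover have "\<phi> = (\<lambda>N. \<Sum>c\<in>B. a c * c ^ N)" using a by auto
  ultimately show ?thesis by simp
qed

text \<open>The step formula turns a term b^N into multiples of b^N and (b q)^N, so one further
  power of q joins the ratios. At N = 0 the two new terms cancel, in accordance with the value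
  there.\<close>

lemma col_avg_span_step:
  assumes q: "0 < q" "q < 1" and \<sigma>: "\<sigma> \<noteq> 0"
    and span: "geo_span ((\<lambda>j. \<sigma> * q ^ j) ` {..k}) (col_avg q (\<lambda>e. z ^ e))"
  shows "geo_span ((\<lambda>j. \<sigma> * q ^ j) ` {..Suc k}) (col_avg q (\<lambda>e. (z / q) ^ e))"
proof -
  let ?B = "(\<lambda>j. \<sigma> * q ^ j) ` {..k}" and ?C = "(\<lambda>j. \<sigma> * q ^ j) ` {..Suc k}"
  obtain a where a: "\<And>N. col_avg q (\<lambda>e. z ^ e) N = (\<Sum>b\<in>?B. a b * b ^ N)"
    using span unfolding geo_span_def by blast
  have nz: "b \<noteq> 0" if "b \<in> ?B" for b using that \<sigma> q by auto
  have eq: "col_avg q (\<lambda>e. (z / q) ^ e) N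
      = col_avg q (\<lambda>e. z ^ e) N + (\<Sum>b\<in>?B. z * a b / b * b ^ N + (- (z * a b / b)) * (b * q) ^ N)" for N
  proof (cases N)
    case 0
    then show ?thesis by (simp add: col_avg_def)
  next
    case (Suc M)
    have "z * (1 - q ^ Suc M) * col_avg q (\<lambda>e. z ^ e) M
        = (\<Sum>b\<in>?B. z * a b / b * b ^ Suc M + (- (z * a b / b)) * (b * q) ^ Suc M)"
      unfolding a sum_distrib_left
      by (intro sum.cong refl) (use nz in \<open>simp add: field_simps\<close>)
    then show ?thesis unfolding Suc col_avg_step[OF q] by simp
  qed
  have "geo_span ?C (\<lambda>N. col_avg q (\<lambda>e. z ^ e) N + (\<Sum>b\<in>?B. z * a b / b * b ^ N + (- (z * a b / b)) * (b * q) ^ N))"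
  proof (intro geo_span_add geo_span_sum)
    show "geo_span ?C (col_avg q (\<lambda>e. z ^ e))" by (rule geo_span_mono[OF span]) auto
    fix b assume b: "b \<in> ?B"
    then obtain j where j: "j \<le> k" "b = \<sigma> * q ^ j" by auto
    then have "b * q = \<sigma> * q ^ Suc j" by simp
    then have "b * q \<in> ?C" using j by (intro image_eqI[of _ _ "Suc j"]) auto
    moreover have "b \<in> ?C" using j by (intro image_eqI[of _ _ j]) auto
    ultimately show "geo_span ?C (\<lambda>N. z * a b / b * b ^ N)" "geo_span ?C (\<lambda>N. (- (z * a b / b)) * (b * q) ^ N)"
      by (intro geo_span_base; simp)+
  qed
  then show ?thesis using eq by (metis (no_types, lifting) ext)
qed

text \<open>The induction grows out of a single geometric sequence, at z = 1 for the positive sign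
  and z = -1/q for the negative one. With the negative sign z = -1 is no starting point: the
  generating function would keep a factor 1 / (1 - u).\<close>

lemma col_avg_power_span:
  assumes q: "0 < q" "q < 1" and \<sigma>: "\<sigma> = 1 \<or> \<sigma> = -1" and k: "1 \<le> k"
  shows "geo_span ((\<lambda>j. \<sigma> * q ^ j) ` {..k}) (col_avg q (\<lambda>e. (\<sigma> * (1 / q) ^ k) ^ e))"
  using k
proof (induction k rule: dec_induct)
  case base
  show ?case
  proof (cases "\<sigma> = 1")
    case True
    have "col_avg q (\<lambda>e. 1 ^ e) = (\<lambda>N. 1 * 1 ^ N)"
      by (rule ext) (simp add: col_avg_pos_base[OF q])
    then have "geo_span ((\<lambda>j. \<sigma> * q ^ j) ` {..0}) (col_avg q (\<lambda>e. 1 ^ e))"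
      using geo_span_base[of "{1}" 1 1] True by (simp del: mult_1 mult_1_left power_one)
    from col_avg_span_step[OF q _ this] show ?thesis using True by simp
  next
    case False
    then have \<sigma>: "\<sigma> = -1" using \<sigma> by simp
    have "col_avg q (\<lambda>e. (\<sigma> * (1 / q) ^ 1) ^ e) = (\<lambda>N. 1 * (- q) ^ N)"
      by (rule ext) (simp add: col_avg_neg_base[OF q] \<sigma>)
    moreover have "geo_span ((\<lambda>j. \<sigma> * q ^ j) ` {..1}) (\<lambda>N. 1 * (- q) ^ N)"
      by (rule geo_span_base) (auto simp: \<sigma> intro!: image_eqI[of _ _ 1])
    ultimately show ?thesis by simp
  qed
next
  case (step k)
  have "\<sigma> * (1 / q) ^ k / q = \<sigma> * (1 / q) ^ Suc k" by simp
  then show ?case using col_avg_span_step[OF q _ step.IH] \<sigma> by fastforce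
qed

lemma col_avg_sum: "col_avg q (\<lambda>e. \<Sum>b\<in>B. a b * f b e) N = (\<Sum>b\<in>B. a b * col_avg q (f b) N)"
proof -
  have "(\<Sum>e\<le>N. euler_coeff q e * (\<Sum>b\<in>B. a b * f b e) * parity_coeff q (N - e)) = (\<Sum>e\<le>N. \<Sum>b\<in>B. a b * (euler_coeff q e * f b e * parity_coeff q (N - e)))"
    by (simp add: sum_distrib_left sum_distrib_right mult_ac)
  also have "\<dots> = (\<Sum>b\<in>B. a b * (\<Sum>e\<le>N. euler_coeff q e * f b e * parity_coeff q (N - e)))"
    by (subst sum.swap) (simp add: sum_distrib_left)
  finally show ?thesis by (simp add: col_avg_def sum_distrib_left mult_ac)
qed

lemma col_avg_span:
  assumes q: "0 < q" "q < 1" and \<sigma>: "\<sigma> = 1 \<or> \<sigma> = -1"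
    and \<phi>: "geo_span ((\<lambda>k. \<sigma> * (1 / q) ^ k) ` {1..K}) \<phi>"
  shows "geo_span ((\<lambda>j. \<sigma> * q ^ j) ` {..K}) (col_avg q \<phi>)"
proof -
  let ?B = "(\<lambda>k. \<sigma> * (1 / q) ^ k) ` {1..K}"
  obtain a where a: "\<And>N. \<phi> N = (\<Sum>b\<in>?B. a b * b ^ N)" using \<phi> unfolding geo_span_def by blast
  then have "\<phi> = (\<lambda>N. \<Sum>b\<in>?B. a b * b ^ N)" by auto
  then have eq: "col_avg q \<phi> = (\<lambda>N. \<Sum>b\<in>?B. a b * col_avg q (\<lambda>e. b ^ e) N)"
    using col_avg_sum[of q a "\<lambda>b e. b ^ e" ?B] by auto
  show ?thesis unfolding eq
  proof (intro geo_span_sum geo_span_cmult)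
    fix b assume "b \<in> ?B"
    then obtain k where k: "1 \<le> k" "k \<le> K" "b = \<sigma> * (1 / q) ^ k" by auto
    show "geo_span ((\<lambda>j. \<sigma> * q ^ j) ` {..K}) (col_avg q (\<lambda>e. b ^ e))"
      unfolding k(3) by (rule geo_span_mono[OF col_avg_power_span[OF q \<sigma> k(1)]]) (use k in auto)
  qed
qed

section \<open>Euler's series, its zeros, and a uniform bound\<close>

lemma summable_euler_coeff:
  assumes q: "0 < q" "q < 1"
  shows "summable (\<lambda>d. euler_coeff q d * z ^ d)"
proof -
  have "(\<lambda>n. \<bar>z\<bar> * q ^ Suc n / (1 - q)) \<longlonglongrightarrow> \<bar>z\<bar> * 0 / (1 - q)"
    using LIMSEQ_power_zero[of q] q by (intro tendsto_intros LIMSEQ_Suc) auto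
  then have "\<forall>\<^sub>F n in sequentially. \<bar>z\<bar> * q ^ Suc n / (1 - q) < 1 / 2"
    by (intro order_tendstoD(2)) auto
  then obtain N where N: "\<And>n. n \<ge> N \<Longrightarrow> \<bar>z\<bar> * q ^ Suc n / (1 - q) < 1 / 2"
    unfolding eventually_sequentially by blast
  show ?thesis
  proof (rule summable_ratio_test[of "1/2" N])
    fix n assume n: "n \<ge> N"
    have le: "q ^ Suc n \<le> q" using q by (simp add: mult_le_cancel_left1 power_le_one)
    then have pos: "1 - q ^ Suc n > 0" using q by linarith
    have "euler_coeff q (Suc n) = q ^ Suc n / (1 - q ^ Suc n) * euler_coeff q n"
      using euler_coeff_Suc[OF q, of n] pos by (simp add: field_simps)
    then have eq: "norm (euler_coeff q (Suc n) * z ^ Suc n) = \<bar>z\<bar> * q ^ Suc n / (1 - q ^ Suc n) * norm (euler_coeff q n * z ^ n)"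
      using q pos by (simp add: abs_mult power_abs)
    have "\<bar>z\<bar> * q ^ Suc n / (1 - q ^ Suc n) \<le> \<bar>z\<bar> * q ^ Suc n / (1 - q)"
      using q le by (intro divide_left_mono mult_pos_pos mult_nonneg_nonneg pos) auto
    also have "\<dots> \<le> 1 / 2" using N[OF n] by simp
    finally show "norm (euler_coeff q (Suc n) * z ^ Suc n) \<le> 1 / 2 * norm (euler_coeff q n * z ^ n)"
      unfolding eq by (rule mult_right_mono) simp
  qed simp
qed

text \<open>Euler's product acquires the factor with j = 0. Working on the series avoids forming the
  infinite product.\<close>

lemma suminf_euler_coeff_step:
  assumes q: "0 < q" "q < 1"
  shows "(\<Sum>d. euler_coeff q d * (z / q) ^ d) = (1 + z) * (\<Sum>d. euler_coeff q d * z ^ d)"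
proof -
  let ?f = "\<lambda>z d. euler_coeff q d * z ^ d"
  have s: "summable (?f z)" for z by (rule summable_euler_coeff[OF q])
  have s': "summable (\<lambda>d. ?f z (Suc d))" for z using s[of z] by (subst summable_Suc_iff)
  have "suminf (?f (z / q)) = 1 + (\<Sum>d. ?f (z / q) (Suc d))"
    using suminf_split_head[OF s, of "z / q"] by simp
  also have "(\<Sum>d. ?f (z / q) (Suc d)) = (\<Sum>d. ?f z (Suc d) + z * ?f z d)"
    using euler_coeff_power_shift[OF q, of _ z] by (intro suminf_cong) simp
  also have "\<dots> = (\<Sum>d. ?f z (Suc d)) + z * suminf (?f z)"
    using s[of z] s'[of z] by (subst suminf_add[symmetric]) (auto simp: suminf_mult summable_mult)
  also have "1 + ((\<Sum>d. ?f z (Suc d)) + z * suminf (?f z)) = (1 + z) * suminf (?f z)"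
    using suminf_split_head[OF s, of z] by (simp add: algebra_simps)
  finally show ?thesis .
qed

text \<open>At k = 1 the factor 1 + z of the step is 0, and the zero persists for all larger
  k.\<close>

lemma suminf_euler_coeff_eq_0:
  assumes q: "0 < q" "q < 1" and "1 \<le> k"
  shows "(\<Sum>d. euler_coeff q d * (- ((1 / q) ^ k)) ^ d) = 0"
  using assms(3)
proof (induction k rule: dec_induct)
  case base
  show ?case using suminf_euler_coeff_step[OF q, of "-1"] by simp
next
  case (step k)
  then show ?case using suminf_euler_coeff_step[OF q, of "- ((1 / q) ^ k)"] by (simp add: power_divide mult.commute)
qed

text \<open>With t = m div 2, (q; q)_N is at most (q; q)_(2t), and dropping the odd powers of q
  leaves (q^2; q^2)_t. This bounds the weights of \<open>col_avg\<close> by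
  \<open>euler_coeff\<close> independently of N, the source of uniformity in c.\<close>

lemma qpoch_le_qpoch_square:
  assumes q: "0 < q" "q < 1" and m: "m \<le> N"
  shows "qpoch q q N * parity_coeff q m \<le> 1"
proof -
  have q2: "0 < q\<^sup>2" "q\<^sup>2 < 1" using q by (auto simp: power_less_one_iff)
  have bd: "0 \<le> 1 - q * q ^ n" "1 - q * q ^ n \<le> 1" for n
    using q power_Suc_less_one[of q n] by auto
  have decr: "qpoch q q j \<le> qpoch q q i" if "i \<le> j" for i j
    using that
  proof (induction j rule: dec_induct)
    case (step j)
    have "qpoch q q (Suc j) \<le> qpoch q q j"
      unfolding qpoch_Suc using bd qpoch_pos[OF q, of j] by (intro mult_left_le) auto
    then show ?case using step by simp
  qed simp
  have sq: "qpoch q q (2 * t) \<le> qpoch (q\<^sup>2) (q\<^sup>2) t" for t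
  proof (induction t)
    case (Suc t)
    have e: "q\<^sup>2 * (q\<^sup>2) ^ t = q * q ^ Suc (2 * t)" unfolding power_mult[symmetric] by (simp add: power2_eq_square)
    have "qpoch q q (2 * Suc t) = qpoch q q (2 * t) * (1 - q * q ^ (2 * t)) * (1 - q * q ^ Suc (2 * t))"
      by (simp add: qpoch_Suc)
    also have "\<dots> \<le> qpoch q q (2 * t) * (1 - q * q ^ Suc (2 * t))"
      using bd[of "2 * t"] bd[of "Suc (2 * t)"] qpoch_pos[OF q, of "2 * t"] by (intro mult_right_mono mult_left_le) auto
    also have "\<dots> \<le> qpoch (q\<^sup>2) (q\<^sup>2) t * (1 - q * q ^ Suc (2 * t))"
      using Suc bd[of "Suc (2 * t)"] by (intro mult_right_mono) auto
    finally show ?case unfolding e[symmetric] qpoch_Suc .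
  qed simp
  have "qpoch q q N \<le> qpoch q q (2 * (m div 2))" by (rule decr) (use m in auto)
  also have "\<dots> \<le> qpoch (q\<^sup>2) (q\<^sup>2) (m div 2)" by (rule sq)
  finally show ?thesis using qpoch_pos[OF q2] by (simp add: parity_coeff_def divide_le_eq_1)
qed


section \<open>Summation column by column\<close>

text \<open>The share of column i in the tilted measure times \<open>Sur\<close>, after the powers
  of p that depend on c alone are removed. The tilt z i is p^(kappa i), possibly with a sign; for
  fixed c, neighbouring columns of a interact only through \<open>parity_coeff\<close>.\<close>

definition col_weight :: "real \<Rightarrow> (nat \<Rightarrow> real) \<Rightarrow> (nat \<Rightarrow> nat) \<Rightarrow> (nat \<Rightarrow> nat) \<Rightarrow> nat \<Rightarrow> real" where
  "col_weight q z c a i = z i ^ (a i - c i) * q ^ (Suc (a i - c i) choose 2) *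
     (qpoch q q (a i - c (Suc i)) / qpoch q q (a i - c i)) * parity_coeff q (a i - a (Suc i))"

definition excess_weight :: "real \<Rightarrow> (nat \<Rightarrow> real) \<Rightarrow> (nat \<Rightarrow> nat) \<Rightarrow> (nat \<Rightarrow> nat) \<Rightarrow> real" where
  "excess_weight q z c a = (if \<forall>i. c i \<le> a i then \<Prod>i=1..plength a. col_weight q z c a i else 0)"

lemma excess_weight_eq:
  assumes "a \<in> partitions" "plength a \<le> L"
  shows "excess_weight q z c a = (if \<forall>i. c i \<le> a i then \<Prod>i=1..L. col_weight q z c a i else 0)"
proof (cases "\<forall>i. c i \<le> a i")
  case True
  have "col_weight q z c a i = 1" if "i > plength a" for i
  proof -
    have "a i = 0" "a (Suc i) = 0" using partition_eq_0[OF assms(1)] that by auto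
    moreover have "c i = 0" "c (Suc i) = 0" using True calculation by (metis le_zero_eq)+
    ultimately show ?thesis by (simp add: col_weight_def numeral_2_eq_2)
  qed
  then have "(\<Prod>i=1..plength a. col_weight q z c a i) = (\<Prod>i=1..L. col_weight q z c a i)"
    using assms(2) by (intro prod.mono_neutral_left) auto
  then show ?thesis using True by (simp add: excess_weight_def)
next
  case False
  show ?thesis unfolding excess_weight_def if_not_P[OF False] ..
qed

lemma excess_weight_nonneg:
  assumes "0 < q" "q < 1" "\<And>i. z i \<ge> 0"
  shows "excess_weight q z c a \<ge> 0"
  unfolding excess_weight_def col_weight_def
  using assms qpoch_pos[OF assms(1,2), THEN less_imp_le] parity_coeff_pos[OF assms(1,2), THEN less_imp_le]
  by (auto intro!: prod_nonneg mult_nonneg_nonneg divide_nonneg_nonneg)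

lemma excess_weight_abs:
  assumes "0 < q" "q < 1"
  shows "\<bar>excess_weight q z c a\<bar> = excess_weight q (\<lambda>i. \<bar>z i\<bar>) c a"
proof -
  have "\<bar>col_weight q z c a i\<bar> = col_weight q (\<lambda>i. \<bar>z i\<bar>) c a i" for i
    unfolding col_weight_def abs_mult power_abs abs_divide
    using assms qpoch_pos[OF assms, THEN less_imp_le] parity_coeff_pos[OF assms, THEN less_imp_le]
    by (simp only: abs_of_nonneg less_imp_le)
  then show ?thesis by (simp add: excess_weight_def abs_prod)
qed

section \<open>Splitting off the first column\<close>

definition partition_cons :: "nat \<Rightarrow> (nat \<Rightarrow> nat) \<Rightarrow> nat \<Rightarrow> nat" where
  "partition_cons v a i = (if i = 0 then 0 else if i = 1 then v else a (i - 1))"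

definition partition_tl :: "(nat \<Rightarrow> nat) \<Rightarrow> nat \<Rightarrow> nat" where
  "partition_tl a i = (if i = 0 then 0 else a (Suc i))"

lemma partition_tl_in_partitions:
  assumes "a \<in> partitions"
  shows "partition_tl a \<in> partitions"
proof -
  have "{i. partition_tl a i \<noteq> 0} \<subseteq> {..plength a}"
  proof
    fix i assume "i \<in> {i. partition_tl a i \<noteq> 0}"
    then have "a (Suc i) \<noteq> 0" by (auto simp: partition_tl_def split: if_splits)
    then show "i \<in> {..plength a}" using partition_pos_iff[OF assms, of "Suc i"] by simp
  qed
  then have "finite {i. partition_tl a i \<noteq> 0}" using finite_subset by blast
  moreover have "partition_tl a (Suc i) \<le> partition_tl a i" if "i \<ge> 1" for i
    using partition_antimono[OF assms, of "Suc i" "Suc (Suc i)"] that by (simp add: partition_tl_def)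
  ultimately show ?thesis by (simp add: partitions_def partition_tl_def)
qed

lemma partition_cons_in_partitions:
  assumes "a \<in> partitions" "a 1 \<le> v"
  shows "partition_cons v a \<in> partitions"
proof -
  have "{i. partition_cons v a i \<noteq> 0} \<subseteq> {..Suc (plength a)}"
  proof
    fix i assume i: "i \<in> {i. partition_cons v a i \<noteq> 0}"
    show "i \<in> {..Suc (plength a)}"
    proof (rule ccontr)
      assume "i \<notin> {..Suc (plength a)}"
      then have "i > 1" "plength a < i - 1" by auto
      then show False using i partition_eq_0[OF assms(1), of "i - 1"] by (simp add: partition_cons_def)
    qed
  qed
  then have "finite {i. partition_cons v a i \<noteq> 0}" using finite_subset by blast
  moreover have "partition_cons v a (Suc i) \<le> partition_cons v a i" if "i \<ge> 1" for i
    using partition_antimono[OF assms(1), of "i - 1" i] assms(2) that by (auto simp: partition_cons_def)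
  ultimately show ?thesis by (simp add: partitions_def partition_cons_def)
qed

lemma partition_cons_partition_tl:
  assumes "a \<in> partitions"
  shows "partition_cons (a 1) (partition_tl a) = a"
  using partition_0[OF assms] by (auto simp: partition_cons_def partition_tl_def fun_eq_iff)

lemma partition_tl_partition_cons: "a \<in> partitions \<Longrightarrow> partition_tl (partition_cons v a) = a"
  using partition_0[of a] by (auto simp: partition_cons_def partition_tl_def fun_eq_iff)

lemma plength_partition_tl: "a \<in> partitions \<Longrightarrow> plength (partition_tl a) = plength a - 1"
proof -
  assume a: "a \<in> partitions"
  have "{i. partition_tl a i \<noteq> 0} = {1..plength a - 1}"
  proof (intro equalityI subsetI)
    fix i assume "i \<in> {i. partition_tl a i \<noteq> 0}"
    then show "i \<in> {1..plength a - 1}"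
      using partition_pos_iff[OF a, of "Suc i"] by (cases "i = 0") (auto simp: partition_tl_def)
  next
    fix i assume "i \<in> {1..plength a - 1}"
    then show "i \<in> {i. partition_tl a i \<noteq> 0}"
      using partition_pos_iff[OF a, of "Suc i"] by (auto simp: partition_tl_def)
  qed
  then show ?thesis by (simp add: plength_def)
qed

lemma excess_weight_partition_cons:
  assumes c: "c \<in> partitions" and a: "a \<in> partitions" "a 1 \<le> c 1 + d"
  shows "excess_weight q z c (partition_cons (c 1 + d) a) = z 1 ^ d * euler_coeff q d * qpoch q q (c 1 - c 2 + d) *
     (parity_coeff q (c 1 + d - a 1) * excess_weight q (\<lambda>i. z (Suc i)) (partition_tl c) a)"
proof -
  let ?b = "partition_cons (c 1 + d) a"
  have b: "?b \<in> partitions" by (rule partition_cons_in_partitions[OF a])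
  have "plength ?b - 1 = plength a" using plength_partition_tl[OF b] partition_tl_partition_cons[OF a(1)] by simp
  then have L: "plength ?b \<le> Suc (plength a)" by simp
  have iff: "(\<forall>i. c i \<le> ?b i) \<longleftrightarrow> (\<forall>i. partition_tl c i \<le> a i)"
  proof
    assume h: "\<forall>i. c i \<le> ?b i"
    show "\<forall>i. partition_tl c i \<le> a i"
    proof
      fix i show "partition_tl c i \<le> a i" using h[rule_format, of "Suc i"] by (auto simp: partition_tl_def partition_cons_def)
    qed
  next
    assume h: "\<forall>i. partition_tl c i \<le> a i"
    show "\<forall>i. c i \<le> ?b i"
    proof
      fix i show "c i \<le> ?b i"
        using h[rule_format, of "i - 1"] partition_0[OF c] by (cases "i = 0"; cases "i = 1") (auto simp: partition_tl_def partition_cons_def)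
    qed
  qed
  have "(\<Prod>i=1..Suc (plength a). col_weight q z c ?b i) = (\<Prod>i<Suc (plength a). col_weight q z c ?b (Suc i))"
    unfolding One_nat_def prod.atLeast1_atMost_eq ..
  also have "\<dots> = col_weight q z c ?b 1 * (\<Prod>i<plength a. col_weight q z c ?b (Suc (Suc i)))"
    by (subst prod.lessThan_Suc_shift) simp
  also have "(\<Prod>i<plength a. col_weight q z c ?b (Suc (Suc i))) = (\<Prod>i<plength a. col_weight q (\<lambda>i. z (Suc i)) (partition_tl c) a (Suc i))"
    by (intro prod.cong refl) (simp add: col_weight_def partition_tl_def partition_cons_def)
  also have "\<dots> = (\<Prod>i=1..plength a. col_weight q (\<lambda>i. z (Suc i)) (partition_tl c) a i)"
    unfolding One_nat_def prod.atLeast1_atMost_eq ..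
  also have "col_weight q z c ?b 1 = z 1 ^ d * euler_coeff q d * qpoch q q (c 1 - c 2 + d) * parity_coeff q (c 1 + d - a 1)"
    using partition_antimono[OF c, of 1 2]
    by (simp add: col_weight_def euler_coeff_def partition_cons_def numeral_2_eq_2)
  finally show ?thesis unfolding excess_weight_eq[OF b L] iff by (simp add: excess_weight_def)
qed

text \<open>Slices by the excess of the first column, which is all that a column placed in front of
  a can see.\<close>

definition partitions_excess :: "(nat \<Rightarrow> nat) \<Rightarrow> nat \<Rightarrow> (nat \<Rightarrow> nat) set" where
  "partitions_excess c d = {a \<in> partitions. a 1 = c 1 + d}"

text \<open>One step of the recursion over columns. Slice sums are written relative to
  \<open>euler_coeff\<close>, their untilted value, so that the step is: average phi over the second
  column, then multiply by the tilt of the first.\<close>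

lemma excess_weight_has_sum_peel:
  assumes c: "c \<in> partitions"
    and tail: "\<And>e. (excess_weight q (\<lambda>i. z (Suc i)) (partition_tl c) has_sum euler_coeff q e * \<phi> e) (partitions_excess (partition_tl c) e)"
  shows "(excess_weight q z c has_sum euler_coeff q d * (z 1 ^ d * col_avg q \<phi> (c 1 - c 2 + d))) (partitions_excess c d)"
proof -
  let ?z = "\<lambda>i. z (Suc i)"
  let ?N = "c 1 - c 2 + d"
  let ?A = "{a \<in> partitions. a 1 \<le> c 1 + d}"
  have c2: "c 2 \<le> c 1" using partition_antimono[OF c, of 1 2] by simp
  have p1: "partition_tl c 1 = c 2" by (simp add: partition_tl_def numeral_2_eq_2)
  let ?U = "\<Union>e\<in>{..?N}. partitions_excess (partition_tl c) e"
  have "((\<lambda>a. parity_coeff q (c 1 + d - a 1) * excess_weight q ?z (partition_tl c) a) has_sum (\<Sum>e\<le>?N. parity_coeff q (?N - e) * (euler_coeff q e * \<phi> e))) ?U"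
  proof (rule sum_has_sum)
    fix e assume e: "e \<in> {..?N}"
    have "((\<lambda>a. parity_coeff q (?N - e) * excess_weight q ?z (partition_tl c) a) has_sum parity_coeff q (?N - e) * (euler_coeff q e * \<phi> e)) (partitions_excess (partition_tl c) e)"
      by (intro has_sum_cmult_right tail)
    moreover have eq: "parity_coeff q (?N - e) * excess_weight q ?z (partition_tl c) a = parity_coeff q (c 1 + d - a 1) * excess_weight q ?z (partition_tl c) a"
      if "a \<in> partitions_excess (partition_tl c) e" for a
    proof -
      have "?N - e = c 1 + d - a 1" using that c2 p1 by (simp add: partitions_excess_def)
      then show ?thesis by simp
    qed
    ultimately show "((\<lambda>a. parity_coeff q (c 1 + d - a 1) * excess_weight q ?z (partition_tl c) a) has_sum parity_coeff q (?N - e) * (euler_coeff q e * \<phi> e)) (partitions_excess (partition_tl c) e)"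
      by (simp only: has_sum_cong[OF eq])
  qed (auto simp: partitions_excess_def)
  \<comment> \<open>If a starts below the level c 2 its weight is 0, so the finitely many slices
    with e at most N exhaust the sum.\<close>
  moreover have "excess_weight q ?z (partition_tl c) a = 0" if "a \<in> ?A - ?U" for a
  proof -
    have "a 1 < c 2"
    proof (rule ccontr)
      assume "\<not> a 1 < c 2"
      then have "a \<in> partitions_excess (partition_tl c) (a 1 - c 2)" "a 1 - c 2 \<le> ?N" using that c2 p1 by (auto simp: partitions_excess_def)
      then show False using that by auto
    qed
    then have "\<not> (\<forall>i. partition_tl c i \<le> a i)" using p1 by (metis not_le)
    then show ?thesis unfolding excess_weight_def by (rule if_not_P)
  qed
  moreover have "?U \<subseteq> ?A" using c2 p1 by (auto simp: partitions_excess_def)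
  ultimately have "((\<lambda>a. parity_coeff q (c 1 + d - a 1) * excess_weight q ?z (partition_tl c) a) has_sum (\<Sum>e\<le>?N. parity_coeff q (?N - e) * (euler_coeff q e * \<phi> e))) ?A"
    by (subst has_sum_cong_neutral[of ?U ?A]) auto
  from has_sum_cmult_right[OF this, of "z 1 ^ d * euler_coeff q d * qpoch q q ?N"]
  have "((\<lambda>a. excess_weight q z c (partition_cons (c 1 + d) a)) has_sum
      z 1 ^ d * euler_coeff q d * qpoch q q ?N * (\<Sum>e\<le>?N. parity_coeff q (?N - e) * (euler_coeff q e * \<phi> e))) ?A"
  proof (subst has_sum_cong)
    fix a assume "a \<in> ?A"
    then show "excess_weight q z c (partition_cons (c 1 + d) a) = z 1 ^ d * euler_coeff q d * qpoch q q ?N * (parity_coeff q (c 1 + d - a 1) * excess_weight q ?z (partition_tl c) a)"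
      by (intro excess_weight_partition_cons[OF c]) auto
  qed
  moreover have "bij_betw (partition_cons (c 1 + d)) ?A (partitions_excess c d)"
  proof (rule bij_betwI[where g = partition_tl])
    show "partition_cons (c 1 + d) \<in> ?A \<rightarrow> partitions_excess c d"
      using partition_cons_in_partitions by (auto simp: partitions_excess_def partition_cons_def)
    show "partition_tl \<in> partitions_excess c d \<rightarrow> ?A"
    proof
      fix a assume "a \<in> partitions_excess c d"
      then show "partition_tl a \<in> ?A"
        using partition_tl_in_partitions[of a] partition_antimono[of a 1 "Suc 1"] by (auto simp: partitions_excess_def partition_tl_def)
    qed
    show "partition_tl (partition_cons (c 1 + d) a) = a" if "a \<in> ?A" for a using that partition_tl_partition_cons by auto
    show "partition_cons (c 1 + d) (partition_tl a) = a" if "a \<in> partitions_excess c d" for a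
      using that partition_cons_partition_tl[of a] by (simp add: partitions_excess_def)
  qed
  ultimately have "(excess_weight q z c has_sum
      z 1 ^ d * euler_coeff q d * qpoch q q ?N * (\<Sum>e\<le>?N. parity_coeff q (?N - e) * (euler_coeff q e * \<phi> e))) (partitions_excess c d)"
    by (subst has_sum_reindex_bij_betw[symmetric]) auto
  then show ?thesis by (simp add: col_avg_def mult_ac)
qed

section \<open>The untilted sum over all columns\<close>

lemma partition_tl_empty_partition [simp]: "partition_tl empty_partition = empty_partition"
  by (auto simp: partition_tl_def empty_partition_def)

lemma excess_weight_empty_partition_empty_partition: "excess_weight q z empty_partition empty_partition = 1"
  by (simp add: excess_weight_def plength_def empty_partition_def)

lemma partitions_excess_empty_partition_0: "partitions_excess empty_partition 0 = {empty_partition}"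
proof -
  have "a = empty_partition" if "a \<in> partitions" "a 1 = 0" for a
  proof
    fix i show "a i = empty_partition i"
      using partition_antimono[OF that(1), of 1 i] partition_0[OF that(1)] that(2)
      by (cases "i = 0") (auto simp: empty_partition_def)
  qed
  then show ?thesis by (auto simp: partitions_excess_def) (auto simp: empty_partition_def)
qed

lemma col_avg_mono:
  assumes "0 < q" "q < 1" "\<And>e. \<phi> e \<le> \<psi> e"
  shows "col_avg q \<phi> N \<le> col_avg q \<psi> N"
  unfolding col_avg_def
  using assms euler_coeff_pos[OF assms(1,2), THEN less_imp_le] parity_coeff_pos[OF assms(1,2), THEN less_imp_le]
    qpoch_pos[OF assms(1,2), THEN less_imp_le]
  by (intro mult_left_mono sum_mono mult_right_mono) auto

text \<open>Putting \<open>z i = 0\<close> for \<open>i > L\<close> truncates the sum to partitions with at most \<open>L\<close> columns.\<close>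

lemma excess_weight_truncated:
  assumes q: "0 < q" "q < 1"
  shows "\<exists>\<phi>. (\<forall>d. \<phi> d \<le> 1) \<and> (\<forall>d. (excess_weight q (\<lambda>i. if i \<le> L then 1 else 0) empty_partition has_sum euler_coeff q d * \<phi> d) (partitions_excess empty_partition d))"
proof (induction L)
  case 0
  let ?z = "\<lambda>i::nat. if i \<le> 0 then 1 else 0 :: real"
  have "(excess_weight q ?z empty_partition has_sum euler_coeff q d * 0 ^ d) (partitions_excess empty_partition d)" for d
  proof (cases "d = 0")
    case True
    then show ?thesis by (simp add: partitions_excess_empty_partition_0 excess_weight_empty_partition_empty_partition has_sum_finite_iff)
  next
    case False
    have "excess_weight q ?z empty_partition a = 0" if "a \<in> partitions_excess empty_partition d" for a
    proof -
      have a: "a \<in> partitions" "a 1 = d" using that by (auto simp: partitions_excess_def empty_partition_def)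
      have "1 \<in> {1..plength a}" using partition_pos_iff[OF a(1), of 1] a(2) False by auto
      moreover have "col_weight q ?z empty_partition a 1 = 0"
        using a False by (simp add: col_weight_def empty_partition_def)
      ultimately have "(\<Prod>i=1..plength a. col_weight q ?z empty_partition a i) = 0"
        by (meson finite_atLeastAtMost prod_zero)
      then show ?thesis by (simp add: excess_weight_def)
    qed
    then have "(excess_weight q ?z empty_partition has_sum 0) (partitions_excess empty_partition d)" by (rule has_sum_0)
    then show ?thesis using False by (simp only: power_0_left if_False mult_zero_right)
  qed
  then show ?case by (intro exI[of _ "\<lambda>d. 0 ^ d"]) (auto simp: power_0_left)
next
  case (Suc L)
  then obtain \<phi> where \<phi>: "\<And>d. \<phi> d \<le> 1"
    "\<And>d. (excess_weight q (\<lambda>i. if i \<le> L then 1 else 0) empty_partition has_sum euler_coeff q d * \<phi> d) (partitions_excess empty_partition d)" by blast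
  let ?z = "\<lambda>i. if i \<le> Suc L then 1 else 0 :: real"
  have "(excess_weight q ?z empty_partition has_sum euler_coeff q d * (?z 1 ^ d * col_avg q \<phi> (empty_partition 1 - empty_partition 2 + d))) (partitions_excess empty_partition d)" for d
    by (rule excess_weight_has_sum_peel[OF empty_partition_in]) (use \<phi>(2) in simp)
  then have "(excess_weight q ?z empty_partition has_sum euler_coeff q d * col_avg q \<phi> d) (partitions_excess empty_partition d)" for d
    by (simp add: empty_partition_def)
  moreover have "col_avg q \<phi> d \<le> 1" for d
    using col_avg_mono[OF q, of \<phi> "\<lambda>_. 1" d] \<phi>(1) col_avg_pos_base[OF q] by simp
  ultimately show ?case by (intro exI[of _ "col_avg q \<phi>"]) auto
qed

text \<open>A finite set of partitions involves boundedly many columns, so its sum is part of a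
  truncated one, which is at most \<open>euler_coeff\<close>.\<close>

lemma excess_weight_empty_partition_summable:
  assumes q: "0 < q" "q < 1"
  shows "excess_weight q (\<lambda>_. 1) empty_partition summable_on partitions_excess empty_partition d"
proof (rule nonneg_bdd_above_summable_on)
  show "excess_weight q (\<lambda>_. 1) empty_partition a \<ge> 0" for a by (rule excess_weight_nonneg[OF q]) simp
  show "bdd_above (sum (excess_weight q (\<lambda>_. 1) empty_partition) ` {F. F \<subseteq> partitions_excess empty_partition d \<and> finite F})"
  proof (rule bdd_aboveI2)
    fix F assume F: "F \<in> {F. F \<subseteq> partitions_excess empty_partition d \<and> finite F}"
    define L where "L = Max (insert 0 (plength ` F))"
    let ?z = "\<lambda>i. if i \<le> L then 1 else 0 :: real"
    have L: "plength a \<le> L" if "a \<in> F" for a using that F by (simp add: L_def)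
    obtain \<phi> where \<phi>: "\<And>d. \<phi> d \<le> 1" "\<And>d. (excess_weight q ?z empty_partition has_sum euler_coeff q d * \<phi> d) (partitions_excess empty_partition d)"
      using excess_weight_truncated[OF q, of L] by blast
    have "sum (excess_weight q (\<lambda>_. 1) empty_partition) F = sum (excess_weight q ?z empty_partition) F"
    proof (intro sum.cong refl)
      fix a assume a: "a \<in> F"
      have "(\<Prod>i=1..plength a. col_weight q (\<lambda>_. 1) empty_partition a i) = (\<Prod>i=1..plength a. col_weight q ?z empty_partition a i)"
        by (intro prod.cong refl) (use L[OF a] in \<open>simp add: col_weight_def\<close>)
      then show "excess_weight q (\<lambda>_. 1) empty_partition a = excess_weight q ?z empty_partition a" by (simp add: excess_weight_def)
    qed
    also have "\<dots> \<le> euler_coeff q d * \<phi> d"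
      by (rule finite_sum_le_has_sum[OF \<phi>(2)]) (use F in \<open>auto intro!: excess_weight_nonneg q\<close>)
    also have "\<dots> \<le> euler_coeff q d" using \<phi>(1)[of d] euler_coeff_pos[OF q, of d] by (intro mult_left_le) auto
    finally show "sum (excess_weight q (\<lambda>_. 1) empty_partition) F \<le> euler_coeff q d" .
  qed
qed

text \<open>Removing the first column reproduces the same problem, so phi is a fixed point of
  \<open>col_avg\<close>, as is the constant 1. Both are 1 at 0, and induction on d makes them
  equal: the term e = d enters the average with weight q^(binom(d+1, 2)) < 1.\<close>

lemma excess_weight_empty_partition_has_sum:
  assumes q: "0 < q" "q < 1"
  shows "(excess_weight q (\<lambda>_. 1) empty_partition has_sum euler_coeff q d) (partitions_excess empty_partition d)"
proof -
  define \<phi> where "\<phi> d = infsum (excess_weight q (\<lambda>_. 1) empty_partition) (partitions_excess empty_partition d) / euler_coeff q d" for d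
  have euler_coeff: "euler_coeff q d > 0" for d by (rule euler_coeff_pos[OF q])
  have hs: "(excess_weight q (\<lambda>_. 1) empty_partition has_sum euler_coeff q d * \<phi> d) (partitions_excess empty_partition d)" for d
    using has_sum_infsum[OF excess_weight_empty_partition_summable[OF q, of d]] euler_coeff[of d] by (simp add: \<phi>_def)
  have "(excess_weight q (\<lambda>_. 1) empty_partition has_sum euler_coeff q d * (1 ^ d * col_avg q \<phi> (empty_partition 1 - empty_partition 2 + d))) (partitions_excess empty_partition d)" for d
    by (rule excess_weight_has_sum_peel[OF empty_partition_in]) (use hs in simp)
  then have "(excess_weight q (\<lambda>_. 1) empty_partition has_sum euler_coeff q d * col_avg q \<phi> d) (partitions_excess empty_partition d)" for d
    by (simp add: empty_partition_def)
  then have fixp: "\<phi> d = col_avg q \<phi> d" for d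
    using has_sum_unique[OF hs[of d]] euler_coeff[of d] by fastforce
  have "\<phi> d = 1" for d
  proof (induction d rule: less_induct)
    case (less d)
    show ?case
    proof (cases "d = 0")
      case True
      have "(excess_weight q (\<lambda>_. 1) empty_partition has_sum 1) (partitions_excess empty_partition 0)"
        by (simp add: partitions_excess_empty_partition_0 excess_weight_empty_partition_empty_partition has_sum_finite_iff)
      then show ?thesis using True has_sum_unique[OF hs[of 0]] by simp
    next
      case False
      have "\<phi> d - 1 = col_avg q \<phi> d - col_avg q (\<lambda>_. 1) d" using fixp col_avg_pos_base[OF q] by simp
      also have "\<dots> = qpoch q q d * (\<Sum>e\<le>d. euler_coeff q e * (\<phi> e - 1) * parity_coeff q (d - e))"
        by (simp add: col_avg_def right_diff_distrib left_diff_distrib sum_subtractf)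
      also have "(\<Sum>e\<le>d. euler_coeff q e * (\<phi> e - 1) * parity_coeff q (d - e)) = (\<Sum>e\<in>{d}. euler_coeff q e * (\<phi> e - 1) * parity_coeff q (d - e))"
        by (rule sum.mono_neutral_right) (use less in auto)
      also have "qpoch q q d * \<dots> = q ^ (Suc d choose 2) * (\<phi> d - 1)"
        using qpoch_pos[OF q, of d] by (simp add: euler_coeff_def)
      finally have "(\<phi> d - 1) * (1 - q ^ (Suc d choose 2)) = 0" by (simp add: algebra_simps)
      moreover have "0 < (Suc d choose 2)" using False by (simp add: zero_less_binomial_iff)
      then have "q ^ (Suc d choose 2) < 1" using q power_strict_decreasing[of 0 "Suc d choose 2" q] by simp
      ultimately show ?thesis by simp
    qed
  qed
  then show ?thesis using hs[of d] by simp
qed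

lemma excess_weight_one_has_sum:
  assumes q: "0 < q" "q < 1" and c: "c \<in> partitions"
  shows "(excess_weight q (\<lambda>_. 1) c has_sum euler_coeff q d) (partitions_excess c d)"
  using c
proof (induction "plength c" arbitrary: c d)
  case 0
  then have "c i = 0" for i using partition_pos_iff[OF 0(2), of i] by auto
  then have "c = empty_partition" by (simp add: empty_partition_def fun_eq_iff)
  then show ?case using excess_weight_empty_partition_has_sum[OF q] by simp
next
  case (Suc n)
  have "(excess_weight q (\<lambda>_. 1) c has_sum euler_coeff q d * (1 ^ d * col_avg q (\<lambda>_. 1) (c 1 - c 2 + d))) (partitions_excess c d)"
  proof (rule excess_weight_has_sum_peel[OF Suc.prems])
    show "(excess_weight q (\<lambda>_. 1) (partition_tl c) has_sum euler_coeff q e * 1) (partitions_excess (partition_tl c) e)" for e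
      using Suc(1)[of "partition_tl c" e] Suc(2) plength_partition_tl[OF Suc.prems] partition_tl_in_partitions[OF Suc.prems] by simp
  qed
  then show ?case using col_avg_pos_base[OF q] by simp
qed

text \<open>B must not depend on c. Peeling a tilted column costs at most the factor \<Theta>,
  Euler's series at the tilt of the following column, because the weights of the average are bounded
  by \<open>euler_coeff\<close>.\<close>

lemma excess_weight_bound:
  assumes q: "0 < q" "q < 1" and z: "\<And>i. z i > 0" "\<And>i. i > r \<Longrightarrow> z i = 1"
  shows "\<exists>B\<ge>0. \<forall>c\<in>partitions. \<exists>\<phi>. \<forall>d. 0 \<le> \<phi> d \<and> \<phi> d \<le> B * z 1 ^ d \<and> (excess_weight q z c has_sum euler_coeff q d * \<phi> d) (partitions_excess c d)"
  using z
proof (induction r arbitrary: z)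
  case 0
  then have e: "z (Suc 0) = 1" by simp
  have W: "excess_weight q z c a = excess_weight q (\<lambda>_. 1) c a" for c a
  proof -
    have "col_weight q z c a i = col_weight q (\<lambda>_. 1) c a i" if "i \<ge> 1" for i
      using 0(2)[of i] that by (simp add: col_weight_def)
    then show ?thesis by (simp add: excess_weight_def)
  qed
  then have W: "excess_weight q z = excess_weight q (\<lambda>_. 1)" by (simp add: fun_eq_iff)
  show ?case
  proof (intro exI[of _ 1] conjI ballI)
    fix c assume "c \<in> partitions"
    then show "\<exists>\<phi>. \<forall>d. 0 \<le> \<phi> d \<and> \<phi> d \<le> 1 * z 1 ^ d \<and> (excess_weight q z c has_sum euler_coeff q d * \<phi> d) (partitions_excess c d)"
      unfolding W using excess_weight_one_has_sum[OF q] by (intro exI[of _ "\<lambda>_. 1"]) (simp add: e)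
  qed simp
next
  case (Suc r)
  let ?z = "\<lambda>i. z (Suc i)"
  have "\<exists>B\<ge>0. \<forall>c\<in>partitions.
      \<exists>\<phi>. \<forall>d. 0 \<le> \<phi> d \<and> \<phi> d \<le> B * ?z 1 ^ d \<and> (excess_weight q ?z c has_sum euler_coeff q d * \<phi> d) (partitions_excess c d)"
    by (rule Suc.IH) (use Suc.prems in auto)
  then obtain B where "B \<ge> 0 \<and> (\<forall>c\<in>partitions.
      \<exists>\<phi>. \<forall>d. 0 \<le> \<phi> d \<and> \<phi> d \<le> B * ?z 1 ^ d \<and> (excess_weight q ?z c has_sum euler_coeff q d * \<phi> d) (partitions_excess c d))"
    by (rule exE)
  note B = conjunct1[OF this] bspec[OF conjunct2[OF this]]
  define \<Theta> where "\<Theta> = (\<Sum>e. euler_coeff q e * ?z 1 ^ e)"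
  have z2: "?z 1 > 0" using Suc.prems by simp
  have \<Theta>: "(\<Sum>e\<in>F. euler_coeff q e * ?z 1 ^ e) \<le> \<Theta>" if "finite F" for F
    unfolding \<Theta>_def
    by (rule sum_le_suminf[OF summable_euler_coeff[OF q] that]) (use euler_coeff_pos[OF q] z2 in \<open>auto intro: less_imp_le\<close>)
  have \<Theta>0: "\<Theta> \<ge> 0" using \<Theta>[of "{}"] by simp
  show ?case
  proof (intro exI[of _ "B * \<Theta>"] conjI ballI)
    show "0 \<le> B * \<Theta>" using B \<Theta>0 by simp
    fix c assume c: "c \<in> partitions"
    obtain \<phi> where \<phi>: "\<And>d. 0 \<le> \<phi> d" "\<And>d. \<phi> d \<le> B * ?z 1 ^ d"
       "\<And>d. (excess_weight q ?z (partition_tl c) has_sum euler_coeff q d * \<phi> d) (partitions_excess (partition_tl c) d)"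
      using B(2)[OF partition_tl_in_partitions[OF c]] by blast
    have avg: "0 \<le> col_avg q \<phi> N \<and> col_avg q \<phi> N \<le> B * \<Theta>" for N
    proof
      show "0 \<le> col_avg q \<phi> N"
        using col_avg_mono[OF q, of "\<lambda>_. 0" \<phi> N] \<phi>(1) by (simp add: col_avg_def)
      have "col_avg q \<phi> N = (\<Sum>e\<le>N. euler_coeff q e * \<phi> e * (qpoch q q N * parity_coeff q (N - e)))"
        by (simp add: col_avg_def sum_distrib_left mult_ac)
      also have "\<dots> \<le> (\<Sum>e\<le>N. euler_coeff q e * \<phi> e * 1)"
        using qpoch_le_qpoch_square[OF q] \<phi>(1) euler_coeff_pos[OF q, THEN less_imp_le]
        by (intro sum_mono mult_left_mono) auto
      also have "\<dots> \<le> (\<Sum>e\<le>N. B * (euler_coeff q e * ?z 1 ^ e))"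
      proof (intro sum_mono)
        fix e
        show "euler_coeff q e * \<phi> e * 1 \<le> B * (euler_coeff q e * ?z 1 ^ e)"
          using mult_left_mono[OF \<phi>(2)[of e] less_imp_le[OF euler_coeff_pos[OF q, of e]]] by (simp add: mult_ac)
      qed
      also have "\<dots> \<le> B * \<Theta>"
        unfolding sum_distrib_left[symmetric] using \<Theta>[of "{..N}"] B by (intro mult_left_mono) auto
      finally show "col_avg q \<phi> N \<le> B * \<Theta>" .
    qed
    have z1: "z 1 > 0" using Suc.prems by simp
    show "\<exists>\<phi>. \<forall>d. 0 \<le> \<phi> d \<and> \<phi> d \<le> B * \<Theta> * z 1 ^ d \<and> (excess_weight q z c has_sum euler_coeff q d * \<phi> d) (partitions_excess c d)"
    proof (intro exI[of _ "\<lambda>d. z 1 ^ d * col_avg q \<phi> (c 1 - c 2 + d)"] allI conjI)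
      fix d
      show "0 \<le> z 1 ^ d * col_avg q \<phi> (c 1 - c 2 + d)" using avg z1 by simp
      show "z 1 ^ d * col_avg q \<phi> (c 1 - c 2 + d) \<le> B * \<Theta> * z 1 ^ d"
        using mult_left_mono[of _ "B * \<Theta>" "z 1 ^ d"] avg z1 by (simp add: mult_ac)
      show "(excess_weight q z c has_sum euler_coeff q d * (z 1 ^ d * col_avg q \<phi> (c 1 - c 2 + d))) (partitions_excess c d)"
        by (rule excess_weight_has_sum_peel[OF c \<phi>(3)])
    qed
  qed
qed

lemma has_sum_partitions_iff_Sigma:
  assumes c: "c \<in> partitions"
  shows "(excess_weight q z c has_sum s) partitions \<longleftrightarrow> ((\<lambda>(d, a). excess_weight q z c a) has_sum s) (Sigma UNIV (partitions_excess c))"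
proof -
  let ?U = "{a \<in> partitions. c 1 \<le> a 1}"
  have "excess_weight q z c a = 0" if "a \<in> partitions - ?U" for a
  proof -
    have "\<not> (\<forall>i. c i \<le> a i)" using that by auto
    then show ?thesis unfolding excess_weight_def by (rule if_not_P)
  qed
  then have "(excess_weight q z c has_sum s) partitions \<longleftrightarrow> (excess_weight q z c has_sum s) ?U"
    by (intro has_sum_cong_neutral) auto
  also have "\<dots> \<longleftrightarrow> ((\<lambda>x. excess_weight q z c (snd x)) has_sum s) (Sigma UNIV (partitions_excess c))"
  proof (rule has_sum_reindex_bij_betw[symmetric])
    show "bij_betw snd (Sigma UNIV (partitions_excess c)) ?U"
      by (rule bij_betwI[where g = "\<lambda>a. (a 1 - c 1, a)"]) (auto simp: partitions_excess_def)
  qed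
  finally show ?thesis by (simp add: case_prod_unfold)
qed

lemma excess_weight_total:
  assumes q: "0 < q" "q < 1" and z: "\<And>i. z i > 0" "\<And>i. i > r \<Longrightarrow> z i = 1"
  shows "\<exists>B. \<forall>c\<in>partitions. excess_weight q z c summable_on partitions \<and> infsum (excess_weight q z c) partitions \<le> B"
proof -
  obtain B where "B \<ge> 0 \<and> (\<forall>c\<in>partitions.
      \<exists>\<phi>. \<forall>d. 0 \<le> \<phi> d \<and> \<phi> d \<le> B * z 1 ^ d \<and> (excess_weight q z c has_sum euler_coeff q d * \<phi> d) (partitions_excess c d))"
    using excess_weight_bound[OF q z] by (rule exE)
  note B = conjunct1[OF this] bspec[OF conjunct2[OF this]]
  have z1: "z 1 > 0" using z by simp
  have euler_coeff: "euler_coeff q d \<ge> 0" for d using euler_coeff_pos[OF q, of d] by simp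
  have sumB: "summable (\<lambda>d. B * (euler_coeff q d * z 1 ^ d))" by (intro summable_mult summable_euler_coeff q)
  show ?thesis
  proof (intro exI[of _ "\<Sum>d. B * (euler_coeff q d * z 1 ^ d)"] ballI)
    fix c assume c: "c \<in> partitions"
    obtain \<phi> where \<phi>: "\<And>d. 0 \<le> \<phi> d" "\<And>d. \<phi> d \<le> B * z 1 ^ d"
      "\<And>d. (excess_weight q z c has_sum euler_coeff q d * \<phi> d) (partitions_excess c d)"
      using B(2)[OF c] by blast
    have le: "euler_coeff q d * \<phi> d \<le> B * (euler_coeff q d * z 1 ^ d)" for d
      using mult_left_mono[OF \<phi>(2)[of d] euler_coeff[of d]] by (simp add: mult_ac)
    have nn: "0 \<le> euler_coeff q d * \<phi> d" for d using euler_coeff \<phi>(1) by simp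
    have sm: "summable (\<lambda>d. euler_coeff q d * \<phi> d)"
      by (rule summable_comparison_test'[OF sumB, of 0]) (use le nn in auto)
    have hs: "((\<lambda>d. euler_coeff q d * \<phi> d) has_sum (\<Sum>d. euler_coeff q d * \<phi> d)) UNIV"
      by (rule norm_summable_imp_has_sum) (use sm nn in \<open>auto simp: summable_sums\<close>)
    have "(\<lambda>(d, a). excess_weight q z c a) summable_on Sigma UNIV (partitions_excess c)"
      by (rule summable_on_SigmaI[where g = "\<lambda>d. euler_coeff q d * \<phi> d"])
         (use \<phi>(3) hs in \<open>auto simp: summable_on_def intro!: excess_weight_nonneg q less_imp_le[OF z(1)]\<close>)
    then have "((\<lambda>(d, a). excess_weight q z c a) has_sum (\<Sum>d. euler_coeff q d * \<phi> d)) (Sigma UNIV (partitions_excess c))"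
      by (intro has_sum_SigmaI[where g = "\<lambda>d. euler_coeff q d * \<phi> d"]) (use \<phi>(3) hs in auto)
    then have "(excess_weight q z c has_sum (\<Sum>d. euler_coeff q d * \<phi> d)) partitions"
      using has_sum_partitions_iff_Sigma[OF c] by blast
    moreover have "(\<Sum>d. euler_coeff q d * \<phi> d) \<le> (\<Sum>d. B * (euler_coeff q d * z 1 ^ d))"
      by (rule suminf_le[OF le sm sumB])
    ultimately show "excess_weight q z c summable_on partitions \<and> infsum (excess_weight q z c) partitions \<le> (\<Sum>d. B * (euler_coeff q d * z 1 ^ d))"
      by (auto simp: summable_on_def infsumI)
  qed
qed

text \<open>Here the strict decrease of kappa is used. Averaging turns the ratios sigma p^k, k = 1,
  ..., kappa 2, into sigma q^j with j at most kappa 2, and the tilt of the first column multiplies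
  them by p^(kappa 1) and a sign. As kappa 2 < kappa 1, the new exponents kappa 1 - j are positive
  again.\<close>

lemma excess_weight_signed:
  assumes q: "0 < q" "q < 1" and r: "1 \<le> r"
    and \<kappa>: "\<And>i. 1 \<le> i \<Longrightarrow> i \<le> r \<Longrightarrow> \<kappa> i \<ge> 1" "\<And>i. 1 \<le> i \<Longrightarrow> i < r \<Longrightarrow> \<kappa> (Suc i) < \<kappa> i"
    and \<epsilon>: "\<And>i. \<epsilon> i = 1 \<or> \<epsilon> i = (-1::real)"
    and z: "\<And>i. 1 \<le> i \<Longrightarrow> i \<le> r \<Longrightarrow> z i = \<epsilon> i * (1 / q) ^ \<kappa> i" "\<And>i. i > r \<Longrightarrow> z i = 1"
    and c: "c \<in> partitions"
  shows "\<exists>\<phi>. geo_span ((\<lambda>k. (\<Prod>i=1..r. \<epsilon> i) * (1 / q) ^ k) ` {1..\<kappa> 1}) \<phi> \<and>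
    (\<forall>d. (excess_weight q z c has_sum euler_coeff q d * \<phi> d) (partitions_excess c d))"
  using r \<kappa> \<epsilon> z c
proof (induction r arbitrary: \<kappa> \<epsilon> z c rule: dec_induct)
  case base
  have tail: "(excess_weight q (\<lambda>i. z (Suc i)) (partition_tl c) has_sum euler_coeff q e * 1) (partitions_excess (partition_tl c) e)" for e
  proof -
    have "excess_weight q (\<lambda>i. z (Suc i)) (partition_tl c) = excess_weight q (\<lambda>_. 1) (partition_tl c)"
      using base.prems(5) by (auto simp: excess_weight_def col_weight_def fun_eq_iff)
    then show ?thesis using excess_weight_one_has_sum[OF q partition_tl_in_partitions[OF base.prems(6)]] by simp
  qed
  have "(excess_weight q z c has_sum euler_coeff q d * (1 * z 1 ^ d)) (partitions_excess c d)" for d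
    using excess_weight_has_sum_peel[OF base.prems(6) tail, of d] col_avg_pos_base[OF q] by simp
  moreover have "geo_span ((\<lambda>k. (\<Prod>i=1..1. \<epsilon> i) * (1 / q) ^ k) ` {1..\<kappa> 1}) (\<lambda>d. 1 * z 1 ^ d)"
    by (rule geo_span_base) (use base.prems(1)[of 1] base.prems(4)[of 1] in auto)
  ultimately show ?case by blast
next
  case (step r)
  let ?\<sigma> = "\<Prod>i=1..r. \<epsilon> (Suc i)"
  have \<sigma>: "?\<sigma> = 1 \<or> ?\<sigma> = -1"
  proof -
    have "(\<Prod>i=1..m. \<epsilon> (Suc i)) = 1 \<or> (\<Prod>i=1..m. \<epsilon> (Suc i)) = -1" for m
      using step.prems(3) by (induction m) (auto, (metis minus_mult_minus mult.right_neutral mult_minus_right)+)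
    then show ?thesis .
  qed
  obtain \<phi> where \<phi>: "geo_span ((\<lambda>k. ?\<sigma> * (1 / q) ^ k) ` {1..\<kappa> (Suc 1)}) \<phi>"
    "\<And>d. (excess_weight q (\<lambda>i. z (Suc i)) (partition_tl c) has_sum euler_coeff q d * \<phi> d) (partitions_excess (partition_tl c) d)"
    using step.IH[of "\<lambda>i. \<kappa> (Suc i)" "\<lambda>i. \<epsilon> (Suc i)" "\<lambda>i. z (Suc i)" "partition_tl c"]
      step.prems(1-5) partition_tl_in_partitions[OF step.prems(6)] by auto
  let ?N = "\<lambda>d. c 1 - c 2 + d"
  have hs: "(excess_weight q z c has_sum euler_coeff q d * (z 1 ^ d * col_avg q \<phi> (?N d))) (partitions_excess c d)" for d
    by (rule excess_weight_has_sum_peel[OF step.prems(6) \<phi>(2)])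
  let ?J = "(\<lambda>j. ?\<sigma> * q ^ j) ` {..\<kappa> (Suc 1)}"
  let ?B = "(\<lambda>k. (\<Prod>i=1..Suc r. \<epsilon> i) * (1 / q) ^ k) ` {1..\<kappa> 1}"
  obtain a where a: "\<And>N. col_avg q \<phi> N = (\<Sum>b\<in>?J. a b * b ^ N)"
    using col_avg_span[OF q \<sigma> \<phi>(1)] unfolding geo_span_def by blast
  have z1: "z 1 = \<epsilon> 1 * (1 / q) ^ \<kappa> 1" using step.prems(4)[of 1] step.hyps by simp
  have \<kappa>1: "\<kappa> (Suc 1) < \<kappa> 1" using step.prems(2)[of 1] step.hyps by simp
  have \<epsilon>1: "(\<Prod>i=1..Suc r. \<epsilon> i) = \<epsilon> 1 * ?\<sigma>"
  proof -
    have "(\<Prod>i=1..Suc r. \<epsilon> i) = (\<Prod>i<Suc r. \<epsilon> (Suc i))" unfolding One_nat_def prod.atLeast1_atMost_eq ..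
    also have "\<dots> = \<epsilon> 1 * (\<Prod>i<r. \<epsilon> (Suc (Suc i)))" by (subst prod.lessThan_Suc_shift) simp
    also have "(\<Prod>i<r. \<epsilon> (Suc (Suc i))) = ?\<sigma>" unfolding One_nat_def prod.atLeast1_atMost_eq ..
    finally show ?thesis .
  qed
  \<comment> \<open>The shift of the argument by c 1 - c 2 changes the coefficients but not the
    ratios.\<close>
  have "z 1 ^ d * col_avg q \<phi> (?N d) = (\<Sum>b\<in>?J. (a b * b ^ (c 1 - c 2)) * (z 1 * b) ^ d)" for d
    unfolding a sum_distrib_left by (intro sum.cong refl) (simp add: power_add power_mult_distrib)
  moreover have "geo_span ?B (\<lambda>d. \<Sum>b\<in>?J. (a b * b ^ (c 1 - c 2)) * (z 1 * b) ^ d)"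
  proof (intro geo_span_sum geo_span_base)
    fix b assume "b \<in> ?J"
    then obtain j where j: "j \<le> \<kappa> (Suc 1)" "b = ?\<sigma> * q ^ j" by auto
    have "(1 / q) ^ \<kappa> 1 = (1 / q) ^ (\<kappa> 1 - j) * (1 / q) ^ j"
      using j \<kappa>1 by (simp add: power_add[symmetric])
    then have "(1 / q) ^ \<kappa> 1 * q ^ j = (1 / q) ^ (\<kappa> 1 - j)" using q by (simp add: power_one_over)
    then have "z 1 * b = (\<Prod>i=1..Suc r. \<epsilon> i) * (1 / q) ^ (\<kappa> 1 - j)"
      unfolding z1 j(2) \<epsilon>1 by (metis mult.assoc mult.left_commute)
    moreover have "\<kappa> 1 - j \<in> {1..\<kappa> 1}" using j \<kappa>1 by auto
    ultimately show "z 1 * b \<in> ?B" by (rule image_eqI)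
  qed simp
  ultimately show ?case using hs by (metis (no_types, lifting) ext)
qed

lemma has_sum_sum:
  fixes f :: "'i \<Rightarrow> 'a \<Rightarrow> real"
  assumes "\<And>i. i \<in> I \<Longrightarrow> (f i has_sum s i) A"
  shows "((\<lambda>x. \<Sum>i\<in>I. f i x) has_sum (\<Sum>i\<in>I. s i)) A"
  using assms
proof (induction I rule: infinite_finite_induct)
  case (insert i I)
  then show ?case by (simp add: has_sum_add)
qed simp_all

text \<open>Summing over the excess of the first column annihilates every ratio. Slice sums
  determine the total only once summability is known; this comes from the unsigned weights with
  tilts |z i|.\<close>

lemma excess_weight_signed_total:
  assumes q: "0 < q" "q < 1" and r: "1 \<le> r"
    and \<kappa>: "\<And>i. 1 \<le> i \<Longrightarrow> i \<le> r \<Longrightarrow> \<kappa> i \<ge> 1" "\<And>i. 1 \<le> i \<Longrightarrow> i < r \<Longrightarrow> \<kappa> (Suc i) < \<kappa> i"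
    and \<epsilon>: "\<And>i. \<epsilon> i = 1 \<or> \<epsilon> i = (-1::real)" "(\<Prod>i=1..r. \<epsilon> i) = -1"
    and z: "\<And>i. 1 \<le> i \<Longrightarrow> i \<le> r \<Longrightarrow> z i = \<epsilon> i * (1 / q) ^ \<kappa> i" "\<And>i. i > r \<Longrightarrow> z i = 1" "z 0 = 1"
    and c: "c \<in> partitions"
  shows "(excess_weight q z c has_sum 0) partitions"
proof -
  have "\<exists>\<phi>. geo_span ((\<lambda>k. (\<Prod>i=1..r. \<epsilon> i) * (1 / q) ^ k) ` {1..\<kappa> 1}) \<phi> \<and>
    (\<forall>d. (excess_weight q z c has_sum euler_coeff q d * \<phi> d) (partitions_excess c d))"
    by (rule excess_weight_signed[OF q r]) (use \<kappa> \<epsilon>(1) z(1,2) c in auto)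
  then obtain \<phi> where span: "geo_span ((\<lambda>k. (-1) * (1 / q) ^ k) ` {1..\<kappa> 1}) \<phi>"
    and \<phi>: "\<And>d. (excess_weight q z c has_sum euler_coeff q d * \<phi> d) (partitions_excess c d)"
    unfolding \<epsilon>(2) by blast
  let ?B = "(\<lambda>k. (-1) * (1 / q) ^ k) ` {1..\<kappa> 1}"
  obtain a where a: "\<And>N. \<phi> N = (\<Sum>b\<in>?B. a b * b ^ N)" using span unfolding geo_span_def by blast
  have "((\<lambda>d. \<Sum>b\<in>?B. a b * (euler_coeff q d * b ^ d)) has_sum (\<Sum>b\<in>?B. a b * 0)) UNIV"
  proof (intro has_sum_sum has_sum_cmult_right)
    fix b assume "b \<in> ?B"
    then obtain k where k: "1 \<le> k" "b = - ((1 / q) ^ k)" by auto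
    have "summable (\<lambda>d. norm (euler_coeff q d * b ^ d))"
      using summable_euler_coeff[OF q, of "\<bar>b\<bar>"] euler_coeff_pos[OF q, THEN less_imp_le] by (simp add: abs_mult power_abs)
    then show "((\<lambda>d. euler_coeff q d * b ^ d) has_sum 0) UNIV"
      using suminf_euler_coeff_eq_0[OF q k(1)] summable_sums[OF summable_euler_coeff[OF q, of b]] unfolding k(2)
      by (intro norm_summable_imp_has_sum) auto
  qed
  then have hs: "((\<lambda>d. euler_coeff q d * \<phi> d) has_sum 0) UNIV"
    by (simp add: a sum_distrib_left mult_ac)
  have pos: "\<bar>z i\<bar> > 0" for i
    using z \<epsilon>(1)[of i] q by (cases "i = 0"; cases "i \<le> r") (auto simp: abs_mult)
  have one: "\<bar>z i\<bar> = 1" if "i > r" for i using z(2)[OF that] by simp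
  have "excess_weight q (\<lambda>i. \<bar>z i\<bar>) c summable_on partitions"
    using excess_weight_total[OF q, of "\<lambda>i. \<bar>z i\<bar>" r] pos one c by blast
  then have "(\<lambda>a. norm (excess_weight q z c a)) summable_on partitions" by (simp add: excess_weight_abs[OF q])
  then have "excess_weight q z c summable_on partitions" by (rule abs_summable_summable)
  then obtain s where s: "(excess_weight q z c has_sum s) partitions" by (auto simp: summable_on_def)
  then have "((\<lambda>(d, a). excess_weight q z c a) has_sum s) (Sigma UNIV (partitions_excess c))"
    using has_sum_partitions_iff_Sigma[OF c] by blast
  then have "((\<lambda>d. euler_coeff q d * \<phi> d) has_sum s) UNIV"
    by (rule has_sum_SigmaD) (use \<phi> in simp)
  then have "s = 0" using hs has_sum_unique by blast
  then show ?thesis using s by simp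
qed


section \<open>Moments\<close>

lemma strict_partition_less:
  assumes "\<kappa> \<in> partitions" "strict_partition \<kappa>" "1 \<le> j" "j < plength \<kappa>"
  shows "\<kappa> (Suc j) < \<kappa> j"
proof (rule ccontr)
  assume "\<not> \<kappa> (Suc j) < \<kappa> j"
  then have eq: "\<kappa> (Suc j) = \<kappa> j" using partition_antimono[OF assms(1,3), of "Suc j"] by simp
  have pos: "\<kappa> j > 0" using partition_pos_iff[OF assms(1), of j] assms by simp
  have "Suc j \<le> conjugate \<kappa> (\<kappa> j)" using le_conjugate_iff[OF assms(1), of "\<kappa> j" "Suc j"] pos eq by simp
  moreover have "\<not> j \<le> conjugate \<kappa> (Suc (\<kappa> j))" using le_conjugate_iff[OF assms(1), of "Suc (\<kappa> j)" j] assms by simp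
  moreover have "mult \<kappa> (\<kappa> j) \<le> 1" using assms(2) pos by (auto simp: strict_partition_def)
  ultimately show False by (simp add: mult_def)
qed

text \<open>In each column put a = c + d: the tilt exponent splits as kappa c + kappa d, and by
  \<open>choose_2_identity\<close> the rest is binom(c, 2) as exponent of p and binom(d+1, 2) as
  exponent of q. The part in c alone multiplies to p^(n(mu) + sum of kappa_i c_i).\<close>

lemma PSym_tilt_mult_Sur:
  assumes p: "p > 1" and \<kappa>: "\<kappa> \<in> partitions" and c: "c \<in> partitions" and a: "a \<in> partitions"
  defines "q \<equiv> 1 / p"
  shows "PSym_tilt p \<kappa> (conjugate a) * Sur p (conjugate a) (conjugate c) =
    qpoch_inf q (q\<^sup>2) * p ^ ((\<Sum>i=1..plength \<kappa>. \<kappa> i * c i) + pn (conjugate c)) * excess_weight q (\<lambda>i. p ^ \<kappa> i) c a"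
proof (cases "\<forall>i. c i \<le> a i")
  case False
  show ?thesis unfolding Sur_conjugate[OF p c a] excess_weight_def if_not_P[OF False] by simp
next
  case True
  define L where "L = max (plength a) (plength \<kappa>)"
  have q: "0 < q" "q < 1" using p by (auto simp: q_def)
  have a0: "a i = 0" "c i = 0" if "i > plength a" for i
    using partition_eq_0[OF a that] True by (auto, metis le_zero_eq)
  have pc: "plength c \<le> plength a" by (rule partition_plength_le[OF c a0(2)])
  have ext: "(\<Prod>i=1..plength a. f i) = (\<Prod>i=1..L. f i)" if "\<And>i. i > plength a \<Longrightarrow> f i = 1" for f :: "nat \<Rightarrow> real"
    by (rule prod.mono_neutral_left) (use that in \<open>auto simp: L_def\<close>)
  have exts: "(\<Sum>i=1..m. f i) = (\<Sum>i=1..L. f i)" if "\<And>i. i > m \<Longrightarrow> f i = 0" "m \<le> L" for f :: "nat \<Rightarrow> nat" and m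
    by (rule sum.mono_neutral_left) (use that in auto)
  have "PSym p (conjugate a) = qpoch_inf q (q\<^sup>2) * (\<Prod>i=1..plength a. q ^ (Suc (a i) choose 2) * parity_coeff q (a i - a (Suc i)))"
  proof -
    have "pn (conjugate a) + psize (conjugate a) = (\<Sum>i=1..plength a. Suc (a i) choose 2)"
      using psize_eq_sum[OF a order.refl] by (simp add: pn_conjugate[OF a] psize_conjugate[OF a] numeral_2_eq_2 sum.distrib)
    then show ?thesis
      by (simp add: PSym_def Let_def q_def[symmetric] conjugate_1[OF a] mult_conjugate[OF a] prod.distrib power_sum parity_coeff_def prod_dividef)
  qed
  also have "(\<Prod>i=1..plength a. q ^ (Suc (a i) choose 2) * parity_coeff q (a i - a (Suc i))) = (\<Prod>i=1..L. q ^ (Suc (a i) choose 2) * parity_coeff q (a i - a (Suc i)))"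
    by (rule ext) (simp add: a0 numeral_2_eq_2)
  finally have 1: "PSym p (conjugate a) = qpoch_inf q (q\<^sup>2) * (\<Prod>i=1..L. q ^ (Suc (a i) choose 2) * parity_coeff q (a i - a (Suc i)))" .
  have "(\<Sum>i=1..plength \<kappa>. \<kappa> i * conjugate (conjugate a) i) = (\<Sum>i=1..L. \<kappa> i * a i)"
    unfolding conjugate_conjugate[OF a] by (rule exts) (simp_all add: partition_eq_0[OF \<kappa>] L_def)
  then have 2: "p ^ (\<Sum>i=1..plength \<kappa>. \<kappa> i * conjugate (conjugate a) i) = (\<Prod>i=1..L. p ^ (\<kappa> i * a i))"
    by (simp add: power_sum)
  have 3: "Sur p (conjugate a) (conjugate c) = (\<Prod>i=1..L. p ^ (a i * c i) * qpoch q q (a i - c (Suc i)) / qpoch q q (a i - c i))"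
    unfolding Sur_conjugate[OF p c a] if_P[OF True] q_def[symmetric] by (rule ext) (simp add: a0)
  have "(\<Sum>i=1..plength \<kappa>. \<kappa> i * c i) = (\<Sum>i=1..L. \<kappa> i * c i)"
    by (rule exts) (simp_all add: partition_eq_0[OF \<kappa>] L_def)
  moreover have "pn (conjugate c) = (\<Sum>i=1..L. c i choose 2)"
    unfolding pn_conjugate[OF c] by (rule exts) (use pc in \<open>simp_all add: partition_eq_0[OF c] L_def numeral_2_eq_2\<close>)
  ultimately have 4: "p ^ ((\<Sum>i=1..plength \<kappa>. \<kappa> i * c i) + pn (conjugate c)) = (\<Prod>i=1..L. p ^ (\<kappa> i * c i) * p ^ (c i choose 2))"
    by (simp add: power_add power_sum prod.distrib)
  have 5: "excess_weight q (\<lambda>i. p ^ \<kappa> i) c a = (\<Prod>i=1..L. col_weight q (\<lambda>i. p ^ \<kappa> i) c a i)"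
    using excess_weight_eq[OF a, of L] True by (simp add: L_def)
  have "(\<Prod>i=1..L. p ^ (\<kappa> i * a i)) * (\<Prod>i=1..L. q ^ (Suc (a i) choose 2) * parity_coeff q (a i - a (Suc i)))
      * (\<Prod>i=1..L. p ^ (a i * c i) * qpoch q q (a i - c (Suc i)) / qpoch q q (a i - c i))
    = (\<Prod>i=1..L. p ^ (\<kappa> i * c i) * p ^ (c i choose 2)) * (\<Prod>i=1..L. col_weight q (\<lambda>i. p ^ \<kappa> i) c a i)"
    unfolding prod.distrib[symmetric]
  proof (intro prod.cong refl)
    fix i
    obtain d where d: "a i = c i + d" using True le_Suc_ex by blast
    have qp: "q ^ m * p ^ m = 1" for m using p by (simp add: q_def power_mult_distrib[symmetric])
    have "q ^ (Suc (a i) choose 2) * q ^ (c i choose 2) = q ^ (a i * c i) * q ^ (Suc d choose 2)"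
      unfolding power_add[symmetric] d choose_2_identity by (simp add: numeral_2_eq_2)
    then have "q ^ (Suc (a i) choose 2) * (q ^ (c i choose 2) * p ^ (c i choose 2)) * p ^ (a i * c i)
        = (q ^ (a i * c i) * p ^ (a i * c i)) * q ^ (Suc d choose 2) * p ^ (c i choose 2)"
      by (simp add: mult_ac)
    then have e: "q ^ (Suc (a i) choose 2) * p ^ (a i * c i) = q ^ (Suc d choose 2) * p ^ (c i choose 2)"
      unfolding qp by simp
    have k: "p ^ (\<kappa> i * a i) = p ^ (\<kappa> i * c i) * (p ^ \<kappa> i) ^ d"
      by (simp add: d distrib_left power_add power_mult)
    let ?r = "qpoch q q (a i - c (Suc i)) / qpoch q q (a i - c i)" and ?e = "parity_coeff q (a i - a (Suc i))"
    have "p ^ (\<kappa> i * a i) * (q ^ (Suc (a i) choose 2) * ?e) * (p ^ (a i * c i) * qpoch q q (a i - c (Suc i)) / qpoch q q (a i - c i))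
       = p ^ (\<kappa> i * a i) * (q ^ (Suc (a i) choose 2) * p ^ (a i * c i)) * ?r * ?e"
      by simp
    also have "\<dots> = p ^ (\<kappa> i * c i) * p ^ (c i choose 2) * ((p ^ \<kappa> i) ^ d * q ^ (Suc d choose 2) * ?r * ?e)"
      unfolding e k by (simp only: mult_ac)
    also have "(p ^ \<kappa> i) ^ d * q ^ (Suc d choose 2) * ?r * ?e = col_weight q (\<lambda>i. p ^ \<kappa> i) c a i"
      by (simp add: col_weight_def d)
    finally show "p ^ (\<kappa> i * a i) * (q ^ (Suc (a i) choose 2) * ?e) * (p ^ (a i * c i) * qpoch q q (a i - c (Suc i)) / qpoch q q (a i - c i))
       = p ^ (\<kappa> i * c i) * p ^ (c i choose 2) * col_weight q (\<lambda>i. p ^ \<kappa> i) c a i" .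
  qed
  then show ?thesis unfolding PSym_tilt_def 1 2 3 4 5 by (simp only: mult_ac)
qed

text \<open>The parity of a column of a is that of c plus that of the excess, and the latter sign
  can be absorbed into the tilt.\<close>

lemma neg_one_power_mult_excess_weight:
  assumes c: "c \<in> partitions" and a: "a \<in> partitions" and S: "S \<subseteq> {1..r}"
  shows "(- 1) ^ (\<Sum>i\<in>S. a i) * excess_weight q z c a = (- 1) ^ (\<Sum>i\<in>S. c i) * excess_weight q (\<lambda>i. (if i \<in> S then - 1 else 1) * z i) c a"
proof (cases "\<forall>i. c i \<le> a i")
  case False
  show ?thesis unfolding excess_weight_def if_not_P[OF False] by simp
next
  case True
  define L where "L = max (plength a) r"
  let ?\<epsilon> = "\<lambda>i. if i \<in> S then - 1 else 1 :: real"
  have L: "plength a \<le> L" by (simp add: L_def)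
  have fin: "finite S" using S finite_subset by blast
  have SL: "S \<subseteq> {1..L}" by (rule order.trans[OF S]) (auto simp: L_def)
  have "(\<Prod>i=1..L. col_weight q (\<lambda>i. ?\<epsilon> i * z i) c a i) = (\<Prod>i=1..L. ?\<epsilon> i ^ (a i - c i)) * (\<Prod>i=1..L. col_weight q z c a i)"
    unfolding prod.distrib[symmetric] by (intro prod.cong refl) (simp add: col_weight_def power_mult_distrib)
  also have "(\<Prod>i=1..L. ?\<epsilon> i ^ (a i - c i)) = (\<Prod>i\<in>S. (- 1) ^ (a i - c i))"
    by (rule prod.mono_neutral_cong_right) (use SL in auto)
  also have "\<dots> = (- 1) ^ (\<Sum>i\<in>S. a i - c i)" by (simp add: power_sum)
  finally have W: "excess_weight q (\<lambda>i. ?\<epsilon> i * z i) c a = (- 1) ^ (\<Sum>i\<in>S. a i - c i) * excess_weight q z c a"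
    unfolding excess_weight_eq[OF a L] if_P[OF True] .
  have "(\<Sum>i\<in>S. a i) = (\<Sum>i\<in>S. c i) + (\<Sum>i\<in>S. a i - c i)"
    unfolding sum.distrib[symmetric] by (intro sum.cong refl) (use True in simp)
  then show ?thesis unfolding W by (simp add: power_add)
qed

lemma has_sum_conjugate_iff: "((\<lambda>a. f (conjugate a)) has_sum s) partitions \<longleftrightarrow> (f has_sum s) partitions"
  by (rule has_sum_reindex_bij_betw[OF bij_conjugate])

lemma moment_PSym_tilt:
  assumes p: "p > 1" and \<kappa>: "\<kappa> \<in> partitions" and c: "c \<in> partitions"
    and W: "(excess_weight (1 / p) (\<lambda>i. p ^ \<kappa> i) c has_sum s) partitions"
  shows "((\<lambda>la. PSym_tilt p \<kappa> la * Sur p la (conjugate c)) has_sum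
    qpoch_inf (1 / p) ((1 / p)\<^sup>2) * p ^ ((\<Sum>i=1..plength \<kappa>. \<kappa> i * c i) + pn (conjugate c)) * s) partitions"
proof (subst has_sum_conjugate_iff[symmetric], subst has_sum_cong)
  fix a assume "a \<in> partitions"
  then show "PSym_tilt p \<kappa> (conjugate a) * Sur p (conjugate a) (conjugate c)
    = qpoch_inf (1 / p) ((1 / p)\<^sup>2) * p ^ ((\<Sum>i=1..plength \<kappa>. \<kappa> i * c i) + pn (conjugate c)) * excess_weight (1 / p) (\<lambda>i. p ^ \<kappa> i) c a"
    by (rule PSym_tilt_mult_Sur[OF p \<kappa> c])
qed (rule has_sum_cmult_right[OF W])

text \<open>Odd size of S makes the product of the signs -1, the case in which the total vanishes;
  it also guarantees at least one tilted column.\<close>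

lemma signed_moment_PSym_tilt:
  assumes p: "p > 1" and \<kappa>: "\<kappa> \<in> partitions" "strict_partition \<kappa>" and c: "c \<in> partitions"
    and S: "S \<subseteq> {1..plength \<kappa>}" "odd (card S)"
  shows "((\<lambda>la. (- 1) ^ (\<Sum>i\<in>S. conjugate la i) * (PSym_tilt p \<kappa> la * Sur p la (conjugate c))) has_sum 0) partitions"
proof -
  let ?q = "1 / p" and ?r = "plength \<kappa>"
  let ?\<epsilon> = "\<lambda>i. if i \<in> S then - 1 else 1 :: real"
  let ?K = "qpoch_inf ?q (?q\<^sup>2) * p ^ ((\<Sum>i=1..plength \<kappa>. \<kappa> i * c i) + pn (conjugate c))"
  have q: "0 < ?q" "?q < 1" using p by auto
  have r: "1 \<le> ?r" using S by (cases "?r") auto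
  have "(excess_weight ?q (\<lambda>i. ?\<epsilon> i * p ^ \<kappa> i) c has_sum 0) partitions"
  proof (rule excess_weight_signed_total[OF q r])
    show "1 \<le> \<kappa> i" if "1 \<le> i" "i \<le> ?r" for i using partition_pos_iff[OF \<kappa>(1), of i] that by simp
    show "\<kappa> (Suc i) < \<kappa> i" if "1 \<le> i" "i < ?r" for i by (rule strict_partition_less[OF \<kappa> that])
    have "(\<Prod>i=1..?r. ?\<epsilon> i) = (\<Prod>i\<in>S. - 1)"
      by (rule prod.mono_neutral_cong_right) (use S in auto)
    then show "(\<Prod>i=1..?r. ?\<epsilon> i) = - 1" using S by simp
    show "?\<epsilon> i * p ^ \<kappa> i = ?\<epsilon> i * (1 / ?q) ^ \<kappa> i" for i by simp
    show "?\<epsilon> i * p ^ \<kappa> i = 1" if "i > ?r" for i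
    proof -
      have "i \<notin> S" using S that by auto
      then show ?thesis using partition_eq_0[OF \<kappa>(1) that] by simp
    qed
    have "0 \<notin> S" using S by auto
    then show "?\<epsilon> 0 * p ^ \<kappa> 0 = 1" using partition_0[OF \<kappa>(1)] by simp
  qed (use c in auto)
  from has_sum_cmult_right[OF this, of "?K * (- 1) ^ (\<Sum>i\<in>S. c i)"]
  have hs: "((\<lambda>a. ?K * (- 1) ^ (\<Sum>i\<in>S. c i) * excess_weight ?q (\<lambda>i. ?\<epsilon> i * p ^ \<kappa> i) c a) has_sum 0) partitions"
    by simp
  show ?thesis
  proof (subst has_sum_conjugate_iff[symmetric], subst has_sum_cong)
    fix a assume a: "a \<in> partitions"
    have "(- 1) ^ (\<Sum>i\<in>S. a i) * (?K * excess_weight ?q (\<lambda>i. p ^ \<kappa> i) c a) = ?K * ((- 1) ^ (\<Sum>i\<in>S. a i) * excess_weight ?q (\<lambda>i. p ^ \<kappa> i) c a)"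
      by (simp only: mult_ac)
    also have "\<dots> = ?K * (- 1) ^ (\<Sum>i\<in>S. c i) * excess_weight ?q (\<lambda>i. ?\<epsilon> i * p ^ \<kappa> i) c a"
      unfolding neg_one_power_mult_excess_weight[OF c a S(1)] by (simp only: mult.assoc)
    finally show "(- 1) ^ (\<Sum>i\<in>S. conjugate (conjugate a) i) * (PSym_tilt p \<kappa> (conjugate a) * Sur p (conjugate a) (conjugate c))
        = ?K * (- 1) ^ (\<Sum>i\<in>S. c i) * excess_weight ?q (\<lambda>i. ?\<epsilon> i * p ^ \<kappa> i) c a"
      unfolding conjugate_conjugate[OF a] PSym_tilt_mult_Sur[OF p \<kappa>(1) c a] .
  qed (rule hs)
qed

theorem theorem1p8:
  fixes p :: real and \<kappa> :: "nat \<Rightarrow> nat"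
  assumes "p > 1" and "\<kappa> \<in> partitions"
  shows "(\<exists>C::real. \<forall>\<mu>\<in>partitions.
            has_moment p \<mu> (PSym_tilt p \<kappa>) \<and>
            moment p \<mu> (PSym_tilt p \<kappa>) \<le> C * p ^ (pn \<mu> + psize \<kappa> * plength \<mu>)) \<and>
         (strict_partition \<kappa> \<longrightarrow>
            (\<forall>\<mu>\<in>partitions. \<forall>S. S \<subseteq> {1..plength \<kappa>} \<and> odd (card S) \<longrightarrow>
               has_moment p \<mu> (PSym_tilt_sgn p \<kappa> S) \<and>
               moment p \<mu> (PSym_tilt_sgn p \<kappa> S) = moment p \<mu> (PSym_tilt p \<kappa>)))"
proof -
  let ?q = "1 / p" and ?z = "\<lambda>i. p ^ \<kappa> i"
  let ?Q = "qpoch_inf ?q (?q\<^sup>2)"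
  have q: "0 < ?q" "?q < 1" using assms by auto
  have z: "?z i > 0" for i using assms by simp
  have z1: "?z i = 1" if "i > plength \<kappa>" for i using partition_eq_0[OF assms(2) that] by simp
  obtain B where "\<forall>c\<in>partitions. excess_weight ?q ?z c summable_on partitions \<and> infsum (excess_weight ?q ?z c) partitions \<le> B"
    using excess_weight_total[OF q, of ?z "plength \<kappa>", OF z z1] by blast
  then have B: "(excess_weight ?q ?z c has_sum infsum (excess_weight ?q ?z c) partitions) partitions" "infsum (excess_weight ?q ?z c) partitions \<le> B"
    if "c \<in> partitions" for c using that by auto
  have main: "((\<lambda>la. PSym_tilt p \<kappa> la * Sur p la \<mu>) has_sum
      ?Q * p ^ ((\<Sum>i=1..plength \<kappa>. \<kappa> i * conjugate \<mu> i) + pn \<mu>) * infsum (excess_weight ?q ?z (conjugate \<mu>)) partitions) partitions"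
    if "\<mu> \<in> partitions" for \<mu>
    using moment_PSym_tilt[OF assms conjugate_in_partitions[OF that] B(1)[OF conjugate_in_partitions[OF that]]]
    unfolding conjugate_conjugate[OF that] .
  show ?thesis
  \<comment> \<open>B is uniform in c, so the constant does not depend on mu. The absolute values
    make it unnecessary to determine the signs of the infinite product and of B.\<close>
  proof (intro conjI impI ballI allI exI[of _ "\<bar>?Q\<bar> * \<bar>B\<bar>"])
    fix \<mu> assume \<mu>: "\<mu> \<in> partitions"
    let ?c = "conjugate \<mu>"
    let ?W = "infsum (excess_weight ?q ?z ?c) partitions"
    let ?E = "(\<Sum>i=1..plength \<kappa>. \<kappa> i * ?c i) + pn \<mu>"
    have c: "?c \<in> partitions" by (rule conjugate_in_partitions[OF \<mu>])
    show "has_moment p \<mu> (PSym_tilt p \<kappa>)"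
      unfolding has_moment_def using main[OF \<mu>] by (auto simp: summable_on_def)
    have W: "0 \<le> ?W" by (intro infsum_nonneg excess_weight_nonneg q less_imp_le[OF z])
    \<comment> \<open>No column of mu is higher than the first, whose height is l(mu).\<close>
    have "(\<Sum>i=1..plength \<kappa>. \<kappa> i * ?c i) \<le> (\<Sum>i=1..plength \<kappa>. \<kappa> i * plength \<mu>)"
      by (intro sum_mono mult_left_mono conjugate_le_plength[OF \<mu>]) simp
    also have "\<dots> = psize \<kappa> * plength \<mu>"
      using psize_eq_sum[OF assms(2) order.refl] by (simp add: sum_distrib_right)
    finally have "?E \<le> pn \<mu> + psize \<kappa> * plength \<mu>" by simp
    then have E: "p ^ ?E \<le> p ^ (pn \<mu> + psize \<kappa> * plength \<mu>)"
      using assms(1) by (intro power_increasing) auto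
    have "moment p \<mu> (PSym_tilt p \<kappa>) = ?Q * p ^ ?E * ?W"
      unfolding moment_def by (rule infsumI[OF main[OF \<mu>]])
    also have "\<dots> \<le> \<bar>?Q\<bar> * p ^ ?E * \<bar>B\<bar>"
      using W B(2)[OF c] assms(1) by (intro mult_mono mult_nonneg_nonneg) auto
    also have "\<dots> = \<bar>?Q\<bar> * \<bar>B\<bar> * p ^ ?E" by simp
    also have "\<dots> \<le> \<bar>?Q\<bar> * \<bar>B\<bar> * p ^ (pn \<mu> + psize \<kappa> * plength \<mu>)"
      by (intro mult_left_mono E) simp
    finally show "moment p \<mu> (PSym_tilt p \<kappa>) \<le> \<bar>?Q\<bar> * \<bar>B\<bar> * p ^ (pn \<mu> + psize \<kappa> * plength \<mu>)" .
  next
    fix \<mu> S assume strict: "strict_partition \<kappa>" and \<mu>: "\<mu> \<in> partitions"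
      and S: "S \<subseteq> {1..plength \<kappa>} \<and> odd (card S)"
    obtain s where s: "((\<lambda>la. PSym_tilt p \<kappa> la * Sur p la \<mu>) has_sum s) partitions" using main[OF \<mu>] by blast
    have "((\<lambda>la. (- 1) ^ (\<Sum>i\<in>S. conjugate la i) * (PSym_tilt p \<kappa> la * Sur p la \<mu>)) has_sum 0) partitions"
      using signed_moment_PSym_tilt[OF assms strict conjugate_in_partitions[OF \<mu>]] S
      unfolding conjugate_conjugate[OF \<mu>] by blast
    \<comment> \<open>The factor 1 + (-1)^(...) splits the signed moment into the plain one and a
      sum with value 0.\<close>
    from has_sum_add[OF s this]
    have "((\<lambda>la. PSym_tilt_sgn p \<kappa> S la * Sur p la \<mu>) has_sum s) partitions"
      by (simp add: PSym_tilt_sgn_def algebra_simps)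
    then show "has_moment p \<mu> (PSym_tilt_sgn p \<kappa> S)"
      "moment p \<mu> (PSym_tilt_sgn p \<kappa> S) = moment p \<mu> (PSym_tilt p \<kappa>)"
      unfolding has_moment_def moment_def using s by (auto simp: summable_on_def infsumI)
  qed
qed


end
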